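(* Let $n\ge 1$, let $\mathcal{Q}\subseteq H^2(\mathbb{T}^n)$ be a quotient module, and let $X\in\mathcal{B}_1(\mathcal{Q})$ be a module map. Set $\psi=X(P_{\mathcal{Q}}1)$, \[ \mathcal{M}_{\mathcal{Q}}=\mathcal{Q}^{conj}+\mathcal{M}_n+H^2_0(\mathbb{T}^n),\qquad \tilde{\mathcal{M}}_{\mathcal{Q},X}=(\mathcal{Q}^{conj}\ominus\{\bar\psi\})+\mathcal{M}_n+H^2_0(\mathbb{T}^n), \] both regarded as linear subspaces of $L^1(\mathbb{T}^n)$ with the norm $\|\cdot\|_1$. Then the following are equivalent: (1) $X$ is liftable; (2) the functional $X_{\mathcal{Q}}:(\mathcal{M}_{\mathcal{Q}},\|\cdot\|_1)\to\mathbb{C}$, $X_{\mathcal{Q}}f=\int_{\mathbb{T}^n}\psi f\,d\mu$, is contractive, i.e. $|\int_{\mathbb{T}^n}\psi f\,d\mu|\le\|f\|_1$ for all $f\in\mathcal{M}_{\mathcal{Q}}$; (3) $\operatorname{dist}_{L^1(\mathbb{T}^n)}\big(\bar\psi/\|\psi\|_2^2,\ \tilde{\mathcal{M}}_{\mathcal{Q},X}\big)\ge 1$.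
   Context: $\mathbb{D}$ is the open unit disc, $\mathbb{T}$ the unit circle, $\mu$ the normalized Lebesgue measure on $\mathbb{T}^n$. $H^2(\mathbb{T}^n)$ is the closed subspace of $L^2(\mathbb{T}^n)$ of functions whose Fourier coefficients vanish off $\mathbb{Z}_+^n$ (identified with analytic functions on $\mathbb{D}^n$ via radial limits); $\|\cdot\|_p$ is the $L^p(\mathbb{T}^n,\mu)$ norm. $H^\infty(\mathbb{D}^n)$ is the algebra of bounded analytic functions on $\mathbb{D}^n$ with the sup norm, and $\mathcal{S}(\mathbb{D}^n)$ is its closed unit ball. For $\varphi\in H^\infty(\mathbb{D}^n)$, $T_\varphi f=\varphi f$ on $H^2(\mathbb{T}^n)$; $T_{z_i}$ is multiplication by the coordinate $z_i$. A closed subspace $\mathcal{Q}\subseteq H^2(\mathbb{T}^n)$ is a quotient module if $T_{z_i}^*\mathcal{Q}\subseteq\mathcal{Q}$ for $i=1,\dots,n$; $P_{\mathcal{Q}}$ is the orthogonal projection of $H^2(\mathbb{T}^n)$ onto $\mathcal{Q}$ and $S_\varphi=P_{\mathcal{Q}}T_\varphi|_{\mathcal{Q}}$ (in particular $S_{z_i}=P_{\mathcal{Q}}T_{z_i}|_{\mathcal{Q}}$). $\mathcal{B}_1(\mathcal{Q})$ is the set of contractions on $\mathcal{Q}$. $X\in\mathcal{B}(\mathcal{Q})$ is a module map if $XS_{z_i}=S_{z_i}X$ for all $i$; a contractive module map $X$ is liftable if there exists $\varphi\in\mathcal{S}(\mathbb{D}^n)$ with $X=S_\varphi$. For $S\subseteq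 L^2(\mathbb{T}^n)$, $S^{conj}=\{\bar f:f\in S\}$. $H^2_0(\mathbb{T}^n)=\{f\in H^2(\mathbb{T}^n):f(0)=0\}$. $\mathcal{M}_n=L^2(\mathbb{T}^n)\ominus(H^2(\mathbb{T}^n)^{conj}+H^2(\mathbb{T}^n))$, the closed span of the monomials $z^k$, $k\in\mathbb{Z}^n$, having at least one positive and at least one negative exponent. The sums above are sums of mutually orthogonal subspaces of $L^2$; $\mathcal{Q}^{conj}\ominus\{\bar\psi\}$ is the orthogonal complement of $\bar\psi$ in $\mathcal{Q}^{conj}$. $\operatorname{dist}_{L^1}(g,M)=\inf_{h\in M}\|g-h\|_1$.
   Formalization: The formal theorem assumes that ψ is not zero almost everywhere (equivalently X ≠ 0); for X = 0 the quotient of ψ̄ by ‖ψ‖₂² in (3) is undefined, while (1) and (2) hold trivially. *)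

theory Defs
  imports "HOL-Analysis.Analysis"
begin

text \<open>Points of the torus T^n are parametrised by angles theta in [0,2pi]^n
  (index type 'n :: finite, so n = CARD('n) >= 1).  Functions on T^n are
  represented by complex-valued functions of the angle vector; elements of
  L^2 are such functions, and everything is stated up to a.e. equality.\<close>

type_synonym 'n tfun = "real^'n \<Rightarrow> complex"

definition torus_measure :: "(real^('n::finite)) measure" where
  "torus_measure = density (restrict_space lborel (cbox 0 (\<chi> i. 2 * pi)))
      (\<lambda>_. ennreal (1 / (2 * pi) ^ CARD('n)))"

definition L2 :: "('n::finite) tfun set" where
  "L2 = {f. f \<in> borel_measurable torus_measure \<and>
            integrable torus_measure (\<lambda>x. (cmod (f x))\<^sup>2)}"

definition l2inner :: "('n::finite) tfun \<Rightarrow> ('n::finite) tfun \<Rightarrow> complex" where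
  "l2inner f g = (LINT x|torus_measure. f x * cnj (g x))"

definition l2norm :: "('n::finite) tfun \<Rightarrow> real" where
  "l2norm f = sqrt (LINT x|torus_measure. (cmod (f x))\<^sup>2)"

definition l1norm :: "('n::finite) tfun \<Rightarrow> real" where
  "l1norm f = (LINT x|torus_measure. cmod (f x))"

definition chr :: "int^'n \<Rightarrow> ('n::finite) tfun" where
  "chr k x = exp (\<i> * complex_of_real (\<Sum>j\<in>UNIV. of_int (k $ j) * x $ j))"

definition zc :: "'n \<Rightarrow> ('n::finite) tfun" where
  "zc i x = exp (\<i> * complex_of_real (x $ i))"

definition fcoeff :: "('n::finite) tfun \<Rightarrow> int^'n \<Rightarrow> complex" where
  "fcoeff f k = l2inner f (chr k)"

definition H2 :: "('n::finite) tfun set" where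
  "H2 = {f \<in> L2. \<forall>k. (\<exists>j. k $ j < 0) \<longrightarrow> fcoeff f k = 0}"

definition H2_0 :: "('n::finite) tfun set" where
  "H2_0 = {f \<in> H2. fcoeff f 0 = 0}"

text \<open>M_n: closed span of z^k with at least one positive and one negative exponent.\<close>
definition Mn :: "('n::finite) tfun set" where
  "Mn = {f \<in> L2. \<forall>k. \<not> ((\<exists>i. k $ i > 0) \<and> (\<exists>j. k $ j < 0)) \<longrightarrow> fcoeff f k = 0}"

definition conj_set :: "('n::finite) tfun set \<Rightarrow> ('n::finite) tfun set" where
  "conj_set S = {(\<lambda>x. cnj (f x)) | f. f \<in> S}"

definition sum3 :: "('n::finite) tfun set \<Rightarrow> ('n::finite) tfun set \<Rightarrow> ('n::finite) tfun set \<Rightarrow> ('n::finite) tfun set" where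
  "sum3 A B C = {(\<lambda>x. a x + b x + c x) | a b c. a \<in> A \<and> b \<in> B \<and> c \<in> C}"

definition l2_closed_subspace :: "('n::finite) tfun set \<Rightarrow> bool" where
  "l2_closed_subspace S \<longleftrightarrow> S \<subseteq> L2 \<and> (\<lambda>_. 0) \<in> S \<and>
     (\<forall>f\<in>S. \<forall>g\<in>S. (\<lambda>x. f x + g x) \<in> S) \<and>
     (\<forall>c. \<forall>f\<in>S. (\<lambda>x. c * f x) \<in> S) \<and>
     (\<forall>f\<in>S. \<forall>g\<in>L2. (AE x in torus_measure. f x = g x) \<longrightarrow> g \<in> S) \<and>
     (\<forall>F f. (\<forall>k. F k \<in> S) \<longrightarrow> f \<in> L2 \<longrightarrow>
        (\<lambda>k. l2norm (\<lambda>x. F k x - f x)) \<longlonglongrightarrow> 0 \<longrightarrow> f \<in> S)"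

definition is_proj :: "('n::finite) tfun set \<Rightarrow> ('n::finite) tfun \<Rightarrow> ('n::finite) tfun \<Rightarrow> bool" where
  "is_proj S f g \<longleftrightarrow> g \<in> S \<and> (\<forall>h\<in>S. l2inner (\<lambda>x. f x - g x) h = 0)"

definition PQ :: "('n::finite) tfun set \<Rightarrow> ('n::finite) tfun \<Rightarrow> ('n::finite) tfun" where
  "PQ S f = (SOME g. is_proj S f g)"

text \<open>Quotient module: closed subspace of H^2 invariant under the adjoints
  T_{z_i}^* f = P_{H^2}(conj z_i * f).\<close>
definition quotient_module :: "('n::finite) tfun set \<Rightarrow> bool" where
  "quotient_module Q \<longleftrightarrow> l2_closed_subspace Q \<and> Q \<subseteq> H2 \<and>
     (\<forall>i. \<forall>f\<in>Q. \<forall>g. is_proj H2 (\<lambda>x. cnj (zc i x) * f x) g \<longrightarrow> g \<in> Q)"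

definition Sz :: "('n::finite) tfun set \<Rightarrow> 'n \<Rightarrow> ('n::finite) tfun \<Rightarrow> ('n::finite) tfun" where
  "Sz Q i f = PQ Q (\<lambda>x. zc i x * f x)"

definition contraction_on :: "('n::finite) tfun set \<Rightarrow> (('n::finite) tfun \<Rightarrow> ('n::finite) tfun) \<Rightarrow> bool" where
  "contraction_on Q X \<longleftrightarrow>
     (\<forall>f\<in>Q. X f \<in> Q) \<and>
     (\<forall>f\<in>Q. \<forall>g\<in>Q. (AE x in torus_measure. f x = g x) \<longrightarrow>
                    (AE x in torus_measure. X f x = X g x)) \<and>
     (\<forall>f\<in>Q. \<forall>g\<in>Q. AE x in torus_measure. X (\<lambda>y. f y + g y) x = X f x + X g x) \<and>
     (\<forall>c. \<forall>f\<in>Q. AE x in torus_measure. X (\<lambda>y. c * f y) x = c * X f x) \<and>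
     (\<forall>f\<in>Q. l2norm (X f) \<le> l2norm f)"

definition module_map :: "('n::finite) tfun set \<Rightarrow> (('n::finite) tfun \<Rightarrow> ('n::finite) tfun) \<Rightarrow> bool" where
  "module_map Q X \<longleftrightarrow> (\<forall>i. \<forall>f\<in>Q. AE x in torus_measure. X (Sz Q i f) x = Sz Q i (X f) x)"

definition polydisc :: "(complex^('n::finite)) set" where
  "polydisc = {z. \<forall>i. cmod (z $ i) < 1}"

definition hext :: "('n::finite) tfun \<Rightarrow> complex^'n \<Rightarrow> complex" where
  "hext f z = (\<Sum>\<^sub>\<infinity>k::nat^'n. fcoeff f (\<chi> j. int (k $ j)) * (\<Prod>j\<in>UNIV. (z $ j) ^ (k $ j)))"

text \<open>Analytic on the polydisc: continuous and holomorphic in each variable separately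
  (Osgood); Schur class: additionally bounded by 1.\<close>
definition schur :: "(complex^'n \<Rightarrow> complex) \<Rightarrow> bool" where
  "schur \<phi> \<longleftrightarrow> continuous_on polydisc \<phi> \<and>
     (\<forall>z\<in>polydisc. \<forall>i. (\<lambda>w. \<phi> (\<chi> j. if j = i then w else z $ j)) field_differentiable at (z $ i)) \<and>
     (\<forall>z\<in>polydisc. cmod (\<phi> z) \<le> 1)"

definition Tphi :: "(complex^'n \<Rightarrow> complex) \<Rightarrow> ('n::finite) tfun \<Rightarrow> ('n::finite) tfun" where
  "Tphi \<phi> f = (SOME g. g \<in> H2 \<and> (\<forall>z\<in>polydisc. hext g z = \<phi> z * hext f z))"

definition Sphi :: "('n::finite) tfun set \<Rightarrow> (complex^'n \<Rightarrow> complex) \<Rightarrow> ('n::finite) tfun \<Rightarrow> ('n::finite) tfun" where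
  "Sphi Q \<phi> f = PQ Q (Tphi \<phi> f)"

definition liftable :: "('n::finite) tfun set \<Rightarrow> (('n::finite) tfun \<Rightarrow> ('n::finite) tfun) \<Rightarrow> bool" where
  "liftable Q X \<longleftrightarrow> (\<exists>\<phi>. schur \<phi> \<and> (\<forall>f\<in>Q. AE x in torus_measure. X f x = Sphi Q \<phi> f x))"

end

theory Submission
  imports Defs "HOL-Complex_Analysis.Cauchy_Integral_Formula"
begin

text \<open>
  A lifting is a function \<open>\<phi>\<close> in the unit ball of \<open>H\<^sup>\<infinity>\<close> with \<open>P\<^sub>Q \<phi> = \<psi>\<close>: the complement of \<open>Q\<close> in \<open>H\<^sup>2\<close>
  is invariant under multiplication by \<open>\<phi>\<close>, and a module map is determined by its value \<open>\<psi>\<close> at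
  \<open>P\<^sub>Q 1\<close>. Integration against such a \<open>\<phi>\<close> and against \<open>\<psi>\<close> gives the same functional on the space
  \<open>Q\<^bsup>conj\<^esup> + M\<^sub>n + H\<^sup>2\<^sub>0\<close>, so the functional is contractive. Conversely, a contractive functional is
  represented on that space by a function \<open>\<phi>\<close> of modulus at most 1; orthogonality to the
  frequencies outside the positive cone puts \<open>\<phi>\<close> in \<open>H\<^sup>2\<close>, and \<open>\<phi> - \<psi>\<close> is orthogonal to \<open>Q\<close>.
  The distance condition is contractivity after normalising the functional to the value 1.
\<close>

subsection \<open>The torus measure\<close>

text \<open>Functions that agree a.e. are not identified, so a projection is determined only up to a
  null set, and the arguments use the relation \<open>is_proj\<close> rather than the selected value
  \<open>PQ\<close>. Liftability speaks of holomorphic functions on the polydisc, the functional of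
  functions on the torus. The bridge consists of Fourier coefficients instead of radial limits: a
  Schur function has square-summable Taylor coefficients, hence a boundary function \<open>p\<close>
  with \<open>hext p = \<phi>\<close> on the polydisc. The bound 1 passes from the polydisc to the
  torus by weak limits of dilations, and back by taking powers. Compactness is avoided in the same
  spirit: projections and the representing function of modulus at most 1 are obtained as minimisers,
  by the parallelogram law. The representation asks for a closed subspace of L^2. An annihilator is
  closed outright, and each element of the annihilator of the complement of \<open>Q\<close> in
  \<open>H2\<close> is split explicitly, after conjugation, into the three summands of the space of
  the functional.\<close>

abbreviation torus :: "(real^('n::finite)) measure" ("\<mu>")
  where "\<mu> \<equiv> torus_measure"

lemma space_torus: "space (\<mu> :: (real^'n::finite) measure) = cbox 0 (\<chi> i. 2 * pi)"
  by (simp add: torus_measure_def space_restrict_space)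

lemma sets_torus: "sets (\<mu> :: (real^'n::finite) measure) = sets (restrict_space borel (cbox 0 (\<chi> i. 2 * pi)))"
  by (simp add: torus_measure_def cong: sets_restrict_space_cong)

lemma measurable_torus:
  assumes "f \<in> borel_measurable borel"
  shows "f \<in> borel_measurable (\<mu> :: (real^'n::finite) measure)"
proof -
  have "f \<in> borel_measurable (restrict_space borel (cbox 0 (\<chi> i. 2 * pi)))"
    using assms by (rule measurable_restrict_space1)
  then show ?thesis
    by (simp add: measurable_cong_sets[OF sets_torus refl])
qed

text \<open>Extension by zero off the cube gives a Borel function on the whole space, which can then
  be composed with Borel maps such as the inverse of the angle parametrisation.\<close>

lemma measurable_torus_extend:
  fixes f :: "real^'n::finite \<Rightarrow> 'b::real_normed_vector"
  assumes "f \<in> borel_measurable \<mu>"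
  shows "(\<lambda>x. indicator (cbox 0 (\<chi> i. 2 * pi)) x *\<^sub>R f x) \<in> borel_measurable borel"
proof -
  have "f \<in> borel_measurable (restrict_space borel (cbox 0 (\<chi> i. 2 * pi)))"
    using assms by (rule measurable_cong_sets[OF sets_torus refl, THEN equalityD1, THEN subsetD])
  then show ?thesis
    by (rule borel_measurable_restrict_space_iff[THEN iffD1, rotated]) simp
qed

lemma integral_torus:
  fixes f :: "real^'n::finite \<Rightarrow> 'b::{banach, second_countable_topology}"
  assumes "f \<in> borel_measurable \<mu>"
  shows "integral\<^sup>L \<mu> f =
    (LINT x|lborel. indicator (cbox 0 (\<chi> i. 2 * pi)) x *\<^sub>R ((1 / (2 * pi) ^ CARD('n)) *\<^sub>R f x))"
proof -
  let ?R = "restrict_space lborel (cbox 0 (\<chi> i. 2 * pi)) :: (real^'n) measure"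
  have m: "f \<in> borel_measurable ?R"
    using assms unfolding torus_measure_def by (simp only: measurable_density_eq1)
  have "integral\<^sup>L \<mu> f = (LINT x|?R. (1 / (2 * pi) ^ CARD('n)) *\<^sub>R f x)"
    unfolding torus_measure_def
    by (rule integral_density[OF m]) (rule measurable_const, simp, simp)
  also have "\<dots> = (LINT x|lborel. indicator (cbox 0 (\<chi> i. 2 * pi)) x *\<^sub>R ((1 / (2 * pi) ^ CARD('n)) *\<^sub>R f x))"
    by (rule integral_restrict_space) simp
  finally show ?thesis .
qed

lemma emeasure_torus_space: "emeasure \<mu> (space (\<mu> :: (real^'n::finite) measure)) = 1"
proof -
  let ?R = "restrict_space lborel (cbox 0 (\<chi> i. 2 * pi)) :: (real^'n) measure"
  have c: "emeasure lborel (cbox 0 (\<chi> i. 2 * pi) :: (real^'n) set) = ennreal ((2 * pi) ^ CARD('n))"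
  proof -
    have "(\<Prod>b\<in>(Basis::(real^'n) set). ((\<chi> i. 2 * pi) - 0) \<bullet> b) = (\<Prod>b\<in>(Basis::(real^'n) set). 2 * pi)"
      by (rule prod.cong) (auto simp: Basis_vec_def inner_axis)
    then have "(\<Prod>b\<in>(Basis::(real^'n) set). ((\<chi> i. 2 * pi) - 0) \<bullet> b) = (2 * pi) ^ CARD('n)"
      by simp
    moreover have "emeasure lborel (cbox 0 (\<chi> i. 2 * pi) :: (real^'n) set)
        = (\<Prod>b\<in>(Basis::(real^'n) set). ((\<chi> i. 2 * pi) - 0) \<bullet> b)"
      by (rule emeasure_lborel_cbox) (auto simp: Basis_vec_def inner_axis)
    ultimately show ?thesis
      by simp
  qed
  have "emeasure \<mu> (space (\<mu> :: (real^'n::finite) measure)) =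
      (\<integral>\<^sup>+x. ennreal (1 / (2 * pi) ^ CARD('n)) * indicator (space ?R) x \<partial>?R)"
    unfolding torus_measure_def space_density
    by (rule emeasure_density) (rule measurable_const, simp, rule sets.top)
  also have "\<dots> = (\<integral>\<^sup>+x. ennreal (1 / (2 * pi) ^ CARD('n)) \<partial>?R)"
    by (rule nn_integral_cong) simp
  also have "\<dots> = ennreal (1 / (2 * pi) ^ CARD('n)) * emeasure lborel (cbox 0 (\<chi> i. 2 * pi) :: (real^'n) set)"
    by (simp add: space_restrict_space emeasure_restrict_space)
  also have "\<dots> = 1"
    unfolding c by (subst ennreal_mult[symmetric]) auto
  finally show ?thesis .
qed

interpretation torus: finite_measure "\<mu> :: (real^'n::finite) measure"
  by (rule finite_measureI) (simp add: emeasure_torus_space)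

lemma measure_torus_space [simp]: "measure \<mu> (space (\<mu> :: (real^'n::finite) measure)) = 1"
  by (simp add: measure_def emeasure_torus_space)

text \<open>The faces of the cube are null. Away from them each angle lies strictly between 0 and 2
  pi, so \<open>Arg2pi\<close> recovers it from its point on the circle.\<close>

lemma AE_torus_box: "AE x in (\<mu> :: (real^'n::finite) measure). x \<in> box 0 (\<chi> i. 2 * pi)"
proof -
  let ?N = "cbox 0 (\<chi> i. 2 * pi) - box 0 (\<chi> i. 2 * pi) :: (real^'n) set"
  have "negligible ?N"
    by (rule negligible_frontier_interval)
  moreover have "?N \<in> sets lborel"
    by simp
  ultimately have "?N \<in> null_sets lborel"
    by (simp add: negligible_iff_null_sets null_sets_completion_iff)
  then have "AE x in lborel. x \<notin> ?N"
    by (rule AE_not_in)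
  then have "AE x in (restrict_space lborel (cbox 0 (\<chi> i. 2 * pi)) :: (real^'n) measure). x \<in> box 0 (\<chi> i. 2 * pi)"
    by (subst AE_restrict_space_iff) auto
  then have "AE x in (restrict_space lborel (cbox 0 (\<chi> i. 2 * pi)) :: (real^'n) measure).
      0 < ennreal (1 / (2 * pi) ^ CARD('n)) \<longrightarrow> x \<in> box 0 (\<chi> i. 2 * pi)"
    by (rule eventually_mono) (rule impI)
  moreover have "(\<lambda>_. ennreal (1 / (2 * pi) ^ CARD('n))) \<in> borel_measurable
      (restrict_space lborel (cbox 0 (\<chi> i. 2 * pi)) :: (real^'n) measure)"
    by (rule measurable_const) simp
  ultimately show ?thesis
    unfolding torus_measure_def by (rule AE_density[THEN iffD2, rotated])
qed

subsection \<open>Square-integrable functions\<close>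

lemma L2_measurable [measurable_dest]: "f \<in> L2 \<Longrightarrow> f \<in> borel_measurable \<mu>"
  by (simp add: L2_def)

lemma L2_sq_integrable: "f \<in> L2 \<Longrightarrow> integrable \<mu> (\<lambda>x. (cmod (f x))\<^sup>2)"
  by (simp add: L2_def)

lemma L2_mult_integrable:
  assumes "f \<in> L2" "g \<in> L2"
  shows "integrable \<mu> (\<lambda>x. f x * g x)"
proof (rule Bochner_Integration.integrable_bound)
  show "integrable \<mu> (\<lambda>x. (cmod (f x))\<^sup>2 + (cmod (g x))\<^sup>2)"
    using assms by (intro Bochner_Integration.integrable_add L2_sq_integrable)
  show "(\<lambda>x. f x * g x) \<in> borel_measurable \<mu>"
    using assms by measurable
  have "cmod (f x * g x) \<le> (cmod (f x))\<^sup>2 + (cmod (g x))\<^sup>2" for x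
    using sum_squares_bound[of "cmod (f x)" "cmod (g x)"]
      mult_nonneg_nonneg[OF norm_ge_zero[of "f x"] norm_ge_zero[of "g x"]]
    unfolding norm_mult by linarith
  then show "AE x in \<mu>. norm (f x * g x) \<le> norm ((cmod (f x))\<^sup>2 + (cmod (g x))\<^sup>2)"
    by auto
qed

lemma borel_measurable_cnj [measurable]: "cnj \<in> borel_measurable borel"
  by (intro borel_measurable_continuous_onI continuous_intros)

lemma L2_cnj [simp]: "(\<lambda>x. cnj (f x)) \<in> L2 \<longleftrightarrow> f \<in> L2"
proof -
  have *: "(\<lambda>x. cnj (g x)) \<in> L2" if "g \<in> L2" for g :: "'n::finite tfun"
  proof -
    have "(\<lambda>x. cnj (g x)) \<in> borel_measurable \<mu>"
      using L2_measurable[OF that] by measurable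
    with that show ?thesis
      by (simp add: L2_def)
  qed
  show ?thesis
    using *[of f] *[of "\<lambda>x. cnj (f x)"] by (simp only: complex_cnj_cnj) blast
qed

lemma L2_add [intro]:
  assumes "f \<in> L2" "g \<in> L2"
  shows "(\<lambda>x. f x + g x) \<in> L2"
  unfolding L2_def
proof safe
  show m: "(\<lambda>x. f x + g x) \<in> borel_measurable \<mu>"
    using assms by measurable
  show "integrable \<mu> (\<lambda>x. (cmod (f x + g x))\<^sup>2)"
  proof (rule Bochner_Integration.integrable_bound)
    show "integrable \<mu> (\<lambda>x. 2 * (cmod (f x))\<^sup>2 + 2 * (cmod (g x))\<^sup>2)"
      using assms by (intro Bochner_Integration.integrable_add integrable_mult_right L2_sq_integrable)
    have "(cmod (f x + g x))\<^sup>2 \<le> 2 * (cmod (f x))\<^sup>2 + 2 * (cmod (g x))\<^sup>2" for x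
    proof -
      have "(cmod (f x + g x))\<^sup>2 \<le> (cmod (f x) + cmod (g x))\<^sup>2"
        by (intro power_mono norm_triangle_ineq) auto
      also have "\<dots> \<le> 2 * (cmod (f x))\<^sup>2 + 2 * (cmod (g x))\<^sup>2"
        using sum_squares_bound[of "cmod (f x)" "cmod (g x)"] by (simp add: power2_sum)
      finally show ?thesis .
    qed
    then show "AE x in \<mu>. norm ((cmod (f x + g x))\<^sup>2) \<le> norm (2 * (cmod (f x))\<^sup>2 + 2 * (cmod (g x))\<^sup>2)"
      by auto
  qed (use m in measurable)
qed

lemma L2_scale [intro]: "f \<in> L2 \<Longrightarrow> (\<lambda>x. c * f x) \<in> L2"
  by (auto simp: L2_def norm_mult power_mult_distrib)

lemma L2_zero [simp]: "(\<lambda>_. 0) \<in> L2"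
  by (simp add: L2_def)

lemma L2_uminus [intro]: "f \<in> L2 \<Longrightarrow> (\<lambda>x. - f x) \<in> L2"
  using L2_scale[of f "-1"] by simp

lemma L2_diff [intro]:
  assumes "f \<in> L2" "g \<in> L2"
  shows "(\<lambda>x. f x - g x) \<in> L2"
  using L2_add[OF assms(1) L2_uminus[OF assms(2)]] by simp

lemma L2_sum [intro]: "(\<And>i. i \<in> I \<Longrightarrow> f i \<in> L2) \<Longrightarrow> (\<lambda>x. \<Sum>i\<in>I. f i x) \<in> L2"
  by (induction I rule: infinite_finite_induct) auto

lemma L2_mult_bounded:
  assumes f: "f \<in> L2" and g[measurable]: "g \<in> borel_measurable \<mu>" and b: "AE x in \<mu>. cmod (g x) \<le> B"
  shows "(\<lambda>x. g x * f x) \<in> L2"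
  unfolding L2_def
proof safe
  show m: "(\<lambda>x. g x * f x) \<in> borel_measurable \<mu>"
    using f by measurable
  show "integrable \<mu> (\<lambda>x. (cmod (g x * f x))\<^sup>2)"
  proof (rule Bochner_Integration.integrable_bound)
    show "integrable \<mu> (\<lambda>x. B\<^sup>2 * (cmod (f x))\<^sup>2)"
      using f by (intro integrable_mult_right L2_sq_integrable)
    show "AE x in \<mu>. norm ((cmod (g x * f x))\<^sup>2) \<le> norm (B\<^sup>2 * (cmod (f x))\<^sup>2)"
      using b by eventually_elim (auto simp: norm_mult power_mult_distrib intro!: mult_right_mono power_mono)
  qed (use m in measurable)
qed

lemma L2_bounded:
  assumes "g \<in> borel_measurable \<mu>" "AE x in \<mu>. cmod (g x) \<le> B"
  shows "g \<in> L2"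
  using L2_mult_bounded[OF _ assms, of "\<lambda>_. 1"] by (simp add: L2_def)

lemma L2_integrable:
  assumes "f \<in> L2" shows "integrable \<mu> f"
  using L2_mult_integrable[OF assms L2_bounded[of "\<lambda>_. 1" 1]] by simp

section \<open>The inner product and its norm\<close>

lemma inner_integrable:
  assumes "f \<in> L2" "g \<in> L2"
  shows "integrable \<mu> (\<lambda>x. f x * cnj (g x))"
  using assms by (intro L2_mult_integrable) auto

lemma l2inner_add_left:
  "f \<in> L2 \<Longrightarrow> g \<in> L2 \<Longrightarrow> h \<in> L2 \<Longrightarrow> l2inner (\<lambda>x. f x + g x) h = l2inner f h + l2inner g h"
  unfolding l2inner_def
  by (subst Bochner_Integration.integral_add[symmetric]) (auto intro: inner_integrable simp: algebra_simps)

lemma l2inner_diff_left: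
  "f \<in> L2 \<Longrightarrow> g \<in> L2 \<Longrightarrow> h \<in> L2 \<Longrightarrow> l2inner (\<lambda>x. f x - g x) h = l2inner f h - l2inner g h"
  unfolding l2inner_def
  by (subst Bochner_Integration.integral_diff[symmetric]) (auto intro: inner_integrable simp: algebra_simps)

lemma l2inner_scale_left: "l2inner (\<lambda>x. c * f x) h = c * l2inner f h"
  unfolding l2inner_def by (simp add: mult.assoc)

lemma l2inner_commute: "l2inner g f = cnj (l2inner f g)"
  unfolding l2inner_def by (subst Bochner_Integration.integral_cnj[symmetric]) (simp add: mult.commute)

lemma l2inner_add_right:
  "f \<in> L2 \<Longrightarrow> g \<in> L2 \<Longrightarrow> h \<in> L2 \<Longrightarrow> l2inner h (\<lambda>x. f x + g x) = l2inner h f + l2inner h g"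
  by (subst (1 2 3) l2inner_commute) (simp add: l2inner_add_left)

lemma l2inner_diff_right:
  "f \<in> L2 \<Longrightarrow> g \<in> L2 \<Longrightarrow> h \<in> L2 \<Longrightarrow> l2inner h (\<lambda>x. f x - g x) = l2inner h f - l2inner h g"
  by (subst (1 2 3) l2inner_commute) (simp add: l2inner_diff_left)

lemma l2inner_scale_right: "l2inner h (\<lambda>x. c * f x) = cnj c * l2inner h f"
  by (subst (1 2) l2inner_commute) (simp add: l2inner_scale_left)

lemma l2inner_zero_left [simp]: "l2inner (\<lambda>_. 0) f = 0"
  by (simp add: l2inner_def)

lemma l2inner_sum_left:
  "(\<And>i. i \<in> I \<Longrightarrow> f i \<in> L2) \<Longrightarrow> h \<in> L2 \<Longrightarrow>
    l2inner (\<lambda>x. \<Sum>i\<in>I. f i x) h = (\<Sum>i\<in>I. l2inner (f i) h)"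
  by (induction I rule: infinite_finite_induct) (auto simp: l2inner_add_left L2_sum)

lemma l2inner_cong_AE:
  assumes "AE x in \<mu>. f x = f' x" "AE x in \<mu>. g x = g' x" "f \<in> L2" "f' \<in> L2" "g \<in> L2" "g' \<in> L2"
  shows "l2inner f g = l2inner f' g'"
  unfolding l2inner_def
  using assms by (intro Bochner_Integration.integral_cong_AE) (auto intro: inner_integrable borel_measurable_integrable)

lemma l2norm_nonneg [simp]: "l2norm f \<ge> 0"
  by (simp add: l2norm_def)

lemma l2norm_sq: "(l2norm f)\<^sup>2 = (LINT x|\<mu>. (cmod (f x))\<^sup>2)"
  by (simp add: l2norm_def)

lemma l2inner_self: "l2inner f f = of_real ((l2norm f)\<^sup>2)"
  by (simp add: l2inner_def l2norm_sq complex_norm_square[symmetric] del: of_real_power)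

lemma l2norm_cong_AE:
  assumes "AE x in \<mu>. f x = g x" "f \<in> L2" "g \<in> L2"
  shows "l2norm f = l2norm g"
  unfolding l2norm_def
  using assms by (intro arg_cong[of _ _ sqrt] Bochner_Integration.integral_cong_AE) (auto intro: L2_sq_integrable)

lemma l2norm_eq_0_iff:
  assumes "f \<in> L2"
  shows "l2norm f = 0 \<longleftrightarrow> (AE x in \<mu>. f x = 0)"
  using integral_nonneg_eq_0_iff_AE[OF L2_sq_integrable[OF assms]] by (simp add: l2norm_def)

lemma l2norm_diff_eq_0_iff:
  assumes "f \<in> L2" "g \<in> L2"
  shows "l2norm (\<lambda>x. f x - g x) = 0 \<longleftrightarrow> (AE x in \<mu>. f x = g x)"
  using l2norm_eq_0_iff[OF L2_diff[OF assms]] by simp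

lemma l2norm_scale: "l2norm (\<lambda>x. c * f x) = cmod c * l2norm f"
  by (simp add: l2norm_def norm_mult power_mult_distrib real_sqrt_mult)

lemma l2norm_minus_commute: "l2norm (\<lambda>x. f x - g x) = l2norm (\<lambda>x. g x - f x)"
  by (simp add: l2norm_def norm_minus_commute)

lemma l2norm_sq_diff_scale:
  assumes "f \<in> L2" "g \<in> L2"
  shows "(l2norm (\<lambda>x. f x - t * g x))\<^sup>2 = (l2norm f)\<^sup>2 - 2 * Re (cnj t * l2inner f g) + (cmod t)\<^sup>2 * (l2norm g)\<^sup>2"
proof -
  have "complex_of_real ((l2norm (\<lambda>x. f x - t * g x))\<^sup>2) = l2inner (\<lambda>x. f x - t * g x) (\<lambda>x. f x - t * g x)"
    by (simp add: l2inner_self)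
  also have "\<dots> = l2inner f f - (cnj t * l2inner f g + cnj (cnj t * l2inner f g)) + t * cnj t * l2inner g g"
    using assms l2inner_commute[of g f]
    by (simp add: l2inner_diff_left l2inner_diff_right L2_diff L2_scale l2inner_scale_left l2inner_scale_right algebra_simps)
  also have "\<dots> = of_real ((l2norm f)\<^sup>2 - 2 * Re (cnj t * l2inner f g) + (cmod t)\<^sup>2 * (l2norm g)\<^sup>2)"
    unfolding l2inner_self complex_add_cnj complex_norm_square[symmetric] by simp
  finally show ?thesis
    using of_real_eq_iff by blast
qed

lemma l2_cauchy_schwarz:
  assumes "f \<in> L2" "g \<in> L2"
  shows "cmod (l2inner f g) \<le> l2norm f * l2norm g"
proof -
  define c where "c = l2inner f g"
  \<comment> \<open>Expansion of the squared norm of \<open>f - s c g\<close>; the factor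
    \<open>c\<close> makes the cross term real for every real \<open>s\<close>. The choice
    \<open>s = 1 / (l2norm g)\<^sup>2\<close> gives the inequality.\<close>
  have *: "0 \<le> (l2norm f)\<^sup>2 - 2 * s * (cmod c)\<^sup>2 + s\<^sup>2 * (cmod c)\<^sup>2 * (l2norm g)\<^sup>2" for s :: real
  proof -
    have "Re (cnj (of_real s * c) * c) = s * (cmod c)\<^sup>2"
      unfolding cmod_power2 by (simp add: power2_eq_square algebra_simps)
    then show ?thesis
      using l2norm_sq_diff_scale[OF assms, of "of_real s * c"] zero_le_power2[of "l2norm (\<lambda>x. f x - of_real s * c * g x)"]
      by (simp add: c_def norm_mult power_mult_distrib)
  qed
  have "(cmod c)\<^sup>2 \<le> (l2norm f)\<^sup>2 * (l2norm g)\<^sup>2"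
  proof (cases "l2norm g = 0")
    case True
    have "cmod c = 0"
    proof (rule ccontr)
      assume "cmod c \<noteq> 0"
      then show False
        \<comment> \<open>With \<open>l2norm g = 0\<close> the quadratic is affine in
          \<open>s\<close>, and at this value of \<open>s\<close> it equals -1.\<close>
        using *[of "((l2norm f)\<^sup>2 + 1) / (2 * (cmod c)\<^sup>2)"] True by (simp add: field_simps)
    qed
    then show ?thesis by simp
  next
    case False
    then have "0 \<le> (l2norm f)\<^sup>2 - (cmod c)\<^sup>2 / (l2norm g)\<^sup>2"
      using *[of "1 / (l2norm g)\<^sup>2"] by (simp add: power2_eq_square)
    then show ?thesis
      using False by (simp add: pos_divide_le_eq)
  qed
  then have "(cmod c)\<^sup>2 \<le> (l2norm f * l2norm g)\<^sup>2"
    by (simp add: power_mult_distrib)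
  then show ?thesis
    unfolding c_def by (rule power2_le_imp_le) simp
qed

lemma l2norm_mult_le:
  assumes f: "f \<in> L2" and g: "g \<in> borel_measurable \<mu>" "AE x in \<mu>. cmod (g x) \<le> B" and B: "B \<ge> 0"
  shows "l2norm (\<lambda>x. g x * f x) \<le> B * l2norm f"
proof (rule power2_le_imp_le)
  have "(l2norm (\<lambda>x. g x * f x))\<^sup>2 \<le> (LINT x|\<mu>. B\<^sup>2 * (cmod (f x))\<^sup>2)"
    unfolding l2norm_sq
  proof (rule integral_mono_AE)
    show "integrable \<mu> (\<lambda>x. (cmod (g x * f x))\<^sup>2)"
      by (rule L2_sq_integrable[OF L2_mult_bounded[OF f g]])
    show "integrable \<mu> (\<lambda>x. B\<^sup>2 * (cmod (f x))\<^sup>2)"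
      by (intro integrable_mult_right L2_sq_integrable f)
    show "AE x in \<mu>. (cmod (g x * f x))\<^sup>2 \<le> B\<^sup>2 * (cmod (f x))\<^sup>2"
      using g(2) by eventually_elim (auto simp: norm_mult power_mult_distrib intro!: mult_right_mono power_mono)
  qed
  then show "(l2norm (\<lambda>x. g x * f x))\<^sup>2 \<le> (B * l2norm f)\<^sup>2"
    by (simp add: power_mult_distrib l2norm_sq)
qed (use B in simp)

lemma l2norm_triangle:
  assumes "f \<in> L2" "g \<in> L2"
  shows "l2norm (\<lambda>x. f x + g x) \<le> l2norm f + l2norm g"
proof (rule power2_le_imp_le)
  have "(l2norm (\<lambda>x. f x + g x))\<^sup>2 = (l2norm f)\<^sup>2 + 2 * Re (l2inner f g) + (l2norm g)\<^sup>2"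
    using l2norm_sq_diff_scale[OF assms, of "-1"] by simp
  also have "\<dots> \<le> (l2norm f)\<^sup>2 + 2 * (l2norm f * l2norm g) + (l2norm g)\<^sup>2"
    using l2_cauchy_schwarz[OF assms] complex_Re_le_cmod[of "l2inner f g"] by auto
  also have "\<dots> = (l2norm f + l2norm g)\<^sup>2"
    by (simp add: power2_sum)
  finally show "(l2norm (\<lambda>x. f x + g x))\<^sup>2 \<le> (l2norm f + l2norm g)\<^sup>2" .
qed simp

lemma l2norm_triangle_diff:
  assumes "f \<in> L2" "g \<in> L2" "h \<in> L2"
  shows "l2norm (\<lambda>x. f x - h x) \<le> l2norm (\<lambda>x. f x - g x) + l2norm (\<lambda>x. g x - h x)"
  using l2norm_triangle[of "\<lambda>x. f x - g x" "\<lambda>x. g x - h x"] assms by (auto simp: algebra_simps)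

lemma l2norm_triangle_sub:
  assumes "f \<in> L2" "g \<in> L2"
  shows "l2norm f \<le> l2norm g + l2norm (\<lambda>x. f x - g x)"
  using l2norm_triangle[of g "\<lambda>x. f x - g x"] assms by (auto simp: algebra_simps)

text \<open>The midpoint form suits convex sets: two elements of nearly minimal norm are close
  because their midpoint, again in the set, cannot have smaller norm than the infimum.\<close>

lemma l2_parallelogram:
  assumes "f \<in> L2" "g \<in> L2"
  shows "(l2norm (\<lambda>x. f x - g x))\<^sup>2 = 2 * (l2norm f)\<^sup>2 + 2 * (l2norm g)\<^sup>2 - 4 * (l2norm (\<lambda>x. (f x + g x) / 2))\<^sup>2"
proof -
  have "l2norm (\<lambda>x. (f x + g x) / 2) = l2norm (\<lambda>x. f x + g x) / 2"
    using l2norm_scale[of "1/2" "\<lambda>x. f x + g x"] by simp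
  then have "(l2norm (\<lambda>x. (f x + g x) / 2))\<^sup>2 = (l2norm (\<lambda>x. f x + g x))\<^sup>2 / 4"
    by (simp only: power_divide) simp
  then show ?thesis
    using l2norm_sq_diff_scale[OF assms, of "-1"] l2norm_sq_diff_scale[OF assms, of 1] by simp
qed

text \<open>Cauchy-Schwarz against the constant 1, which has norm 1 because the measure has total
  mass 1. It lets the L^1 theory supply an a.e. convergent subsequence of an L^2 Cauchy
  sequence.\<close>

lemma l1norm_le_l2norm:
  fixes f :: "'n::finite tfun"
  assumes "f \<in> L2" shows "l1norm f \<le> l2norm f"
proof -
  have 1: "(\<lambda>x. complex_of_real (cmod (f x))) \<in> L2" "(\<lambda>_::real^'n. 1) \<in> L2"
    using assms by (auto simp: L2_def)
  have "l2inner (\<lambda>x. complex_of_real (cmod (f x))) (\<lambda>_. 1) = of_real (l1norm f)"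
    by (simp add: l2inner_def l1norm_def)
  moreover have "l1norm f \<ge> 0"
    by (simp add: l1norm_def)
  moreover have "l2norm (\<lambda>x. complex_of_real (cmod (f x))) = l2norm f" "l2norm (\<lambda>_::real^'n. 1) = 1"
    by (auto simp: l2norm_def)
  ultimately show ?thesis
    using l2_cauchy_schwarz[OF 1] by simp
qed

subsection \<open>Completeness and orthogonal projections\<close>

lemma nn_integral_L2:
  assumes "f \<in> L2"
  shows "(\<integral>\<^sup>+x. ennreal ((cmod (f x))\<^sup>2) \<partial>\<mu>) = ennreal ((l2norm f)\<^sup>2)"
  unfolding l2norm_sq by (rule nn_integral_eq_integral[OF L2_sq_integrable[OF assms]]) simp

lemma L2_nn_integralI:
  assumes [measurable]: "f \<in> borel_measurable \<mu>"
    and le: "(\<integral>\<^sup>+x. ennreal ((cmod (f x))\<^sup>2) \<partial>\<mu>) \<le> ennreal (e\<^sup>2)" and e: "e \<ge> 0"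
  shows "f \<in> L2" "l2norm f \<le> e"
proof -
  have "integrable \<mu> (\<lambda>x. (cmod (f x))\<^sup>2)"
    using le_less_trans[OF le] by (intro integrableI_nonneg) auto
  then show "f \<in> L2"
    by (simp add: L2_def)
  then have "(l2norm f)\<^sup>2 \<le> e\<^sup>2"
    using le by (simp add: nn_integral_L2)
  then show "l2norm f \<le> e"
    using e by (rule power2_le_imp_le)
qed

text \<open>The a.e. limit of a subsequence is the candidate. Fatou's lemma carries the Cauchy
  estimate for \<open>F m - F (r i)\<close> over to \<open>F m - f\<close>, which also shows that
  the limit is square integrable.\<close>

lemma L2_complete:
  fixes F :: "nat \<Rightarrow> 'n::finite tfun"
  assumes F: "\<And>k. F k \<in> L2"
    and cauchy: "\<And>e. e > 0 \<Longrightarrow> \<exists>N. \<forall>m\<ge>N. \<forall>n\<ge>N. l2norm (\<lambda>x. F m x - F n x) < e"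
  obtains f where "f \<in> L2" "(\<lambda>k. l2norm (\<lambda>x. F k x - f x)) \<longlonglongrightarrow> 0"
proof -
  have "\<exists>N. \<forall>i\<ge>N. \<forall>j\<ge>N. (LINT x|\<mu>. norm (F i x - F j x)) < e" if "e > 0" for e
    using cauchy[OF that] l1norm_le_l2norm[OF L2_diff[OF F F]] unfolding l1norm_def
    by (meson le_less_trans)
  then obtain r where r: "strict_mono r" "AE x in \<mu>. Cauchy (\<lambda>i. F (r i) x)"
    using cauchy_L1_AE_cauchy_subseq[of \<mu> F] L2_integrable[OF F] by blast
  define f where "f x = lim (\<lambda>i. F (r i) x)" for x
  have [measurable]: "F k \<in> borel_measurable \<mu>" for k
    using F by measurable
  have [measurable]: "f \<in> borel_measurable \<mu>"
    unfolding f_def by measurable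
  have lim: "AE x in \<mu>. (\<lambda>i. F (r i) x) \<longlonglongrightarrow> f x"
    using r(2) by eventually_elim (simp add: f_def Cauchy_convergent_iff convergent_LIMSEQ_iff)
  have bound: "(\<lambda>x. F m x - f x) \<in> L2 \<and> l2norm (\<lambda>x. F m x - f x) \<le> e"
    if N: "\<forall>m\<ge>N. \<forall>n\<ge>N. l2norm (\<lambda>x. F m x - F n x) < e" and m: "m \<ge> N" and e: "e > 0" for e m N
  proof -
    have "(\<integral>\<^sup>+x. ennreal ((cmod (F m x - f x))\<^sup>2) \<partial>\<mu>) =
        (\<integral>\<^sup>+x. liminf (\<lambda>i. ennreal ((cmod (F m x - F (r i) x))\<^sup>2)) \<partial>\<mu>)"
    proof (rule nn_integral_cong_AE)
      show "AE x in \<mu>. ennreal ((cmod (F m x - f x))\<^sup>2) = liminf (\<lambda>i. ennreal ((cmod (F m x - F (r i) x))\<^sup>2))"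
        using lim
      proof eventually_elim
        case (elim x)
        then have "(\<lambda>i. ennreal ((cmod (F m x - F (r i) x))\<^sup>2)) \<longlonglongrightarrow> ennreal ((cmod (F m x - f x))\<^sup>2)"
          by (intro tendsto_intros)
        then show ?case
          by (rule lim_imp_Liminf[symmetric, rotated]) simp
      qed
    qed
    also have "\<dots> \<le> liminf (\<lambda>i. \<integral>\<^sup>+x. ennreal ((cmod (F m x - F (r i) x))\<^sup>2) \<partial>\<mu>)"
      by (rule nn_integral_liminf) measurable
    also have "\<dots> \<le> ennreal (e\<^sup>2)"
    proof (rule Liminf_le)
      show "\<forall>\<^sub>F i in sequentially. (\<integral>\<^sup>+x. ennreal ((cmod (F m x - F (r i) x))\<^sup>2) \<partial>\<mu>) \<le> ennreal (e\<^sup>2)"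
        using eventually_ge_at_top[of N]
      proof eventually_elim
        case (elim i)
        then have "r i \<ge> N"
          using seq_suble[OF r(1), of i] by simp
        then have "l2norm (\<lambda>x. F m x - F (r i) x) < e"
          using N m by blast
        then have "(l2norm (\<lambda>x. F m x - F (r i) x))\<^sup>2 \<le> e\<^sup>2"
          by (intro power_mono) auto
        then show ?case
          by (simp add: nn_integral_L2 L2_diff F)
      qed
    qed simp
    finally show ?thesis
      using e by (auto intro!: L2_nn_integralI[where f = "\<lambda>x. F m x - f x" and e = e])
  qed
  have "f \<in> L2"
  proof -
    obtain N where "\<forall>m\<ge>N. \<forall>n\<ge>N. l2norm (\<lambda>x. F m x - F n x) < 1"
      using cauchy[of 1] by auto
    then have "(\<lambda>x. F N x - f x) \<in> L2"
      using bound[of N 1 N] by simp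
    then have "(\<lambda>x. F N x - (F N x - f x)) \<in> L2"
      by (rule L2_diff[OF F])
    then show ?thesis
      by simp
  qed
  moreover have "(\<lambda>k. l2norm (\<lambda>x. F k x - f x)) \<longlonglongrightarrow> 0"
  proof (rule LIMSEQ_I)
    fix e :: real assume e: "e > 0"
    obtain N where "\<forall>m\<ge>N. \<forall>n\<ge>N. l2norm (\<lambda>x. F m x - F n x) < e / 2"
      using cauchy[of "e / 2"] e by auto
    then have "norm (l2norm (\<lambda>x. F m x - f x) - 0) < e" if "m \<ge> N" for m
      using bound[of N "e / 2" m] that e by simp
    then show "\<exists>N. \<forall>m\<ge>N. norm (l2norm (\<lambda>x. F m x - f x) - 0) < e"
      by blast
  qed
  ultimately show ?thesis
    by (rule that)
qed

text \<open>The bound is on the square of the distance because this is what the parallelogram law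
  and the Pythagorean identity for partial sums deliver.\<close>

lemma L2_convergentI:
  fixes F :: "nat \<Rightarrow> 'n::finite tfun"
  assumes F: "\<And>k. F k \<in> L2" and h: "h \<longlonglongrightarrow> 0"
    and dist: "\<And>j k. k \<le> j \<Longrightarrow> (l2norm (\<lambda>x. F j x - F k x))\<^sup>2 \<le> h k"
  obtains f where "f \<in> L2" "(\<lambda>k. l2norm (\<lambda>x. F k x - f x)) \<longlonglongrightarrow> 0"
proof -
  have "\<exists>N. \<forall>m\<ge>N. \<forall>n\<ge>N. l2norm (\<lambda>x. F m x - F n x) < e" if e: "e > 0" for e
  proof -
    have "\<forall>\<^sub>F k in sequentially. h k < e\<^sup>2"
      using h e by (intro order_tendstoD) auto
    then obtain N where N: "\<And>k. k \<ge> N \<Longrightarrow> h k < e\<^sup>2"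
      unfolding eventually_sequentially by auto
    have *: "l2norm (\<lambda>x. F m x - F n x) < e" if "n \<ge> N" "n \<le> m" for m n
    proof (rule power2_less_imp_less)
      show "(l2norm (\<lambda>x. F m x - F n x))\<^sup>2 < e\<^sup>2"
        using dist[OF that(2)] N[OF that(1)] by simp
    qed (use e in simp)
    show ?thesis
    proof (intro exI[of _ N] allI impI)
      fix m n assume "N \<le> m" "N \<le> n"
      then show "l2norm (\<lambda>x. F m x - F n x) < e"
        using *[of n m] *[of m n] l2norm_minus_commute[of "F m" "F n"] by (cases "n \<le> m") auto
    qed
  qed
  then show ?thesis
    using L2_complete[of F] F that by blast
qed

text \<open>The elements of minimal norm form a Cauchy sequence; this replaces weak compactness.\<close>

lemma L2_nested_closed_convex:
  fixes C :: "nat \<Rightarrow> 'n::finite tfun set"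
  assumes sub: "C 0 \<subseteq> L2" and ne: "\<And>k. C k \<noteq> {}" and dec: "\<And>k. C (Suc k) \<subseteq> C k"
    and mid: "\<And>k f g. f \<in> C k \<Longrightarrow> g \<in> C k \<Longrightarrow> (\<lambda>x. (f x + g x) / 2) \<in> C k"
    and clo: "\<And>k F f. (\<And>i. F i \<in> C k) \<Longrightarrow> f \<in> L2 \<Longrightarrow>
        (\<lambda>i. l2norm (\<lambda>x. F i x - f x)) \<longlonglongrightarrow> 0 \<Longrightarrow> f \<in> C k"
    and bnd: "\<And>f. f \<in> C 0 \<Longrightarrow> l2norm f \<le> B"
  obtains f where "\<And>k. f \<in> C k"
proof -
  have anti: "C j \<subseteq> C k" if "k \<le> j" for j k
    using that dec by (rule lift_Suc_antimono_le[rotated])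
  have CL2: "f \<in> L2" if "f \<in> C k" for f k
    using that anti[of 0 k] sub by auto
  define d where "d k = (INF f\<in>C k. l2norm f)" for k
  have bdd: "bdd_below (l2norm ` C k)" for k
    by (rule bdd_belowI[of _ 0]) auto
  have d_le: "d k \<le> l2norm f" if "f \<in> C k" for k f
    unfolding d_def using that by (intro cINF_lower bdd)
  have d_nonneg: "d k \<ge> 0" for k
    unfolding d_def using ne by (intro cINF_greatest) auto
  have d_mono: "incseq d"
    unfolding incseq_def d_def using ne anti bdd by (intro allI impI cINF_superset_mono) auto
  have d_bdd: "d k \<le> B" for k
  proof -
    obtain f where "f \<in> C k" using ne by blast
    then show ?thesis
      using d_le[of f k] bnd[of f] anti[of 0 k] by fastforce
  qed
  obtain D where D: "d \<longlonglongrightarrow> D"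
    using incseq_convergent[OF d_mono, of B] d_bdd by blast
  have dD: "d k \<le> D" for k
    using d_mono D by (rule incseq_le)
  have "\<exists>f\<in>C k. l2norm f \<le> d k + 1 / real (Suc k)" for k
  proof -
    have "(INF f\<in>C k. l2norm f) < d k + 1 / real (Suc k)"
      by (simp add: d_def)
    then obtain f where "f \<in> C k" "l2norm f < d k + 1 / real (Suc k)"
      using ne bdd by (subst (asm) cINF_less_iff) auto
    then show ?thesis by (intro bexI[of _ f]) auto
  qed
  then obtain F where F: "\<And>k. F k \<in> C k" "\<And>k. l2norm (F k) \<le> d k + 1 / real (Suc k)"
    by metis
  \<comment> \<open>The parallelogram law for \<open>F j\<close> and \<open>F k\<close>, both in
    \<open>C k\<close>: each norm is at most \<open>D + 1 / real (Suc k)\<close>, and the midpoint,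
    again in \<open>C k\<close>, has norm at least \<open>d k\<close>.\<close>
  define h where "h k = 4 * ((D + 1 / real (Suc k))\<^sup>2 - (d k)\<^sup>2)" for k
  have h0: "h \<longlonglongrightarrow> 0"
  proof -
    have "h \<longlonglongrightarrow> 4 * ((D + 0)\<^sup>2 - D\<^sup>2)"
      unfolding h_def using D
      by (intro tendsto_intros LIMSEQ_inverse_real_of_nat[unfolded inverse_eq_divide])
    then show ?thesis by simp
  qed
  have dist: "(l2norm (\<lambda>x. F j x - F k x))\<^sup>2 \<le> h k" if "k \<le> j" for j k
  proof -
    have Fj: "F j \<in> C k"
      using F(1) anti[OF that] by blast
    have "d k \<le> l2norm (\<lambda>x. (F j x + F k x) / 2)"
      using mid[OF Fj F(1)] by (rule d_le)
    then have "(d k)\<^sup>2 \<le> (l2norm (\<lambda>x. (F j x + F k x) / 2))\<^sup>2"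
      using d_nonneg by (intro power_mono)
    moreover have "1 / real (Suc j) \<le> 1 / real (Suc k)"
      using that by (simp add: frac_le)
    then have "(l2norm (F j))\<^sup>2 \<le> (D + 1 / real (Suc k))\<^sup>2"
      using F(2)[of j] dD[of j] by (intro power_mono) auto
    moreover have "(l2norm (F k))\<^sup>2 \<le> (D + 1 / real (Suc k))\<^sup>2"
      using F(2)[of k] dD[of k] by (intro power_mono) auto
    ultimately show ?thesis
      using l2_parallelogram[OF CL2[OF F(1)] CL2[OF F(1)], of j k] by (simp add: h_def)
  qed
  then obtain f where f: "f \<in> L2" "(\<lambda>k. l2norm (\<lambda>x. F k x - f x)) \<longlonglongrightarrow> 0"
    using L2_convergentI[of F h] CL2[OF F(1)] h0 by blast
  have "f \<in> C k" for k
  proof (rule clo)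
    show "F (i + k) \<in> C k" for i
      using F(1) anti[of k "i + k"] by auto
    show "(\<lambda>i. l2norm (\<lambda>x. F (i + k) x - f x)) \<longlonglongrightarrow> 0"
      using f(2) by (rule LIMSEQ_ignore_initial_segment)
  qed (rule f(1))
  then show ?thesis
    by (rule that)
qed

text \<open>The sets of near minimisers are nested, and convexity, continuity and coercivity of
  \<open>N\<close> make them convex, closed and bounded, so they have a common point.
  \<open>N\<close> is left abstract because it is a distance for projections and the norm of a
  projected difference in the duality theorem.\<close>

lemma L2_minimizer:
  fixes K :: "('n::finite) tfun set"
  assumes K: "K \<subseteq> L2" "K \<noteq> {}"
    and mid: "\<And>k l. k \<in> K \<Longrightarrow> l \<in> K \<Longrightarrow> (\<lambda>x. (k x + l x) / 2) \<in> K"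
    and clo: "\<And>F k. (\<And>i. F i \<in> K) \<Longrightarrow> k \<in> L2 \<Longrightarrow> (\<lambda>i. l2norm (\<lambda>x. F i x - k x)) \<longlonglongrightarrow> 0 \<Longrightarrow> k \<in> K"
    and nonneg: "\<And>k. k \<in> K \<Longrightarrow> 0 \<le> N k"
    and conv: "\<And>k l. k \<in> K \<Longrightarrow> l \<in> K \<Longrightarrow> N (\<lambda>x. (k x + l x) / 2) \<le> (N k + N l) / 2"
    and cont: "\<And>k l. k \<in> K \<Longrightarrow> l \<in> K \<Longrightarrow> N k \<le> N l + l2norm (\<lambda>x. l x - k x)"
    and coercive: "\<And>k. k \<in> K \<Longrightarrow> l2norm k \<le> N k + B"
  obtains k where "k \<in> K" "\<And>l. l \<in> K \<Longrightarrow> N k \<le> N l"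
proof -
  define D where "D = (INF k\<in>K. N k)"
  have bdd: "bdd_below (N ` K)"
    using nonneg by (intro bdd_belowI[of _ 0]) auto
  have D_le: "D \<le> N k" if "k \<in> K" for k
    unfolding D_def using that by (intro cINF_lower bdd)
  define C where "C m = {k \<in> K. N k \<le> D + 1 / real (Suc m)}" for m :: nat
  have "\<exists>k. \<forall>m. k \<in> C m"
  proof (rule L2_nested_closed_convex[of C "D + 1 + B"])
    show "C 0 \<subseteq> L2"
      using K by (auto simp: C_def)
    show "C m \<noteq> {}" for m
    proof -
      have "(INF k\<in>K. N k) < D + 1 / real (Suc m)"
        by (simp add: D_def)
      then obtain k where "k \<in> K" "N k < D + 1 / real (Suc m)"
        using K(2) bdd by (subst (asm) cINF_less_iff) auto
      then have "k \<in> C m" by (simp add: C_def)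
      then show ?thesis by blast
    qed
    show "C (Suc m) \<subseteq> C m" for m
    proof -
      have "1 / real (Suc (Suc m)) \<le> 1 / real (Suc m)"
        by (simp add: frac_le)
      then show ?thesis
        by (fastforce simp: C_def)
    qed
    show "(\<lambda>x. (k x + l x) / 2) \<in> C m" if "k \<in> C m" "l \<in> C m" for m k l
    proof -
      have "k \<in> K" "l \<in> K" "N k \<le> D + 1 / real (Suc m)" "N l \<le> D + 1 / real (Suc m)"
        using that by (simp_all add: C_def)
      with mid[of k l] conv[of k l] show ?thesis
        unfolding C_def by simp
    qed
    show "k \<in> C m" if F: "\<And>i. F i \<in> C m" and k: "k \<in> L2" and lim: "(\<lambda>i. l2norm (\<lambda>x. F i x - k x)) \<longlonglongrightarrow> 0"
      for m F k
    proof -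
      have FK: "F i \<in> K" "N (F i) \<le> D + 1 / real (Suc m)" for i
        using F[of i] by (simp_all add: C_def)
      have kK: "k \<in> K"
        using clo[OF FK(1) k lim] .
      have "N k \<le> D + 1 / real (Suc m) + l2norm (\<lambda>x. F i x - k x)" for i
        using cont[OF kK FK(1)[of i]] FK(2)[of i] by linarith
      moreover have "(\<lambda>i. D + 1 / real (Suc m) + l2norm (\<lambda>x. F i x - k x)) \<longlonglongrightarrow> D + 1 / real (Suc m) + 0"
        by (intro tendsto_intros lim)
      ultimately have "N k \<le> D + 1 / real (Suc m) + 0"
        by (intro LIMSEQ_le_const) auto
      then show ?thesis
        using kK by (simp add: C_def)
    qed
    show "l2norm k \<le> D + 1 + B" if "k \<in> C 0" for k
      using that coercive[of k] by (simp add: C_def)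
  qed blast
  then obtain k where k: "\<And>m. k \<in> C m" by blast
  have "N k \<le> D + 0"
  proof (rule LIMSEQ_le_const[where X = "\<lambda>m. D + 1 / real (Suc m)"])
    show "(\<lambda>m. D + 1 / real (Suc m)) \<longlonglongrightarrow> D + 0"
      by (intro tendsto_intros LIMSEQ_inverse_real_of_nat[unfolded inverse_eq_divide])
    have "N k \<le> D + 1 / real (Suc m)" for m
      using k[of m] by (simp only: C_def mem_Collect_eq)
    then show "\<exists>M. \<forall>m\<ge>M. N k \<le> D + 1 / real (Suc m)"
      by blast
  qed
  moreover have "k \<in> K"
    using k[of 0] by (simp add: C_def)
  ultimately show ?thesis
    using D_le by (intro that[of k]) fastforce+
qed

section \<open>Closed subspaces and orthogonal projections\<close>

lemma l2_closed_subspaceD: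
  assumes "l2_closed_subspace S"
  shows "f \<in> S \<Longrightarrow> f \<in> L2" "(\<lambda>_. 0) \<in> S"
    "f \<in> S \<Longrightarrow> g \<in> S \<Longrightarrow> (\<lambda>x. f x + g x) \<in> S"
    "f \<in> S \<Longrightarrow> (\<lambda>x. c * f x) \<in> S"
    "f \<in> S \<Longrightarrow> g \<in> L2 \<Longrightarrow> AE x in \<mu>. f x = g x \<Longrightarrow> g \<in> S"
    "(\<And>k. F k \<in> S) \<Longrightarrow> f \<in> L2 \<Longrightarrow> (\<lambda>k. l2norm (\<lambda>x. F k x - f x)) \<longlonglongrightarrow> 0 \<Longrightarrow> f \<in> S"
  using assms unfolding l2_closed_subspace_def by blast+

lemma l2_closed_subspace_subset: "l2_closed_subspace S \<Longrightarrow> S \<subseteq> L2"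
  unfolding l2_closed_subspace_def by (rule conjunct1)

lemma l2_closed_subspace_diff:
  assumes "l2_closed_subspace S" "f \<in> S" "g \<in> S"
  shows "(\<lambda>x. f x - g x) \<in> S"
  using l2_closed_subspaceD(3)[OF assms(1,2) l2_closed_subspaceD(4)[OF assms(1,3), of "-1"]] by simp

text \<open>First-order condition at a minimum: the squared norm of \<open>u - t v\<close> has
  derivative \<open>-2 * Re (l2inner u v)\<close> at 0. Only \<open>t\<close> in (0, 1] are tested,
  the range in which a segment inside a convex set supplies competitors.\<close>

lemma l2_variation_le:
  assumes "u \<in> L2" "v \<in> L2" and *: "\<And>t. 0 < t \<Longrightarrow> t \<le> 1 \<Longrightarrow> l2norm u \<le> l2norm (\<lambda>x. u x - of_real t * v x)"
  shows "Re (l2inner u v) \<le> 0"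
proof (rule ccontr)
  assume "\<not> ?thesis"
  then have a: "Re (l2inner u v) > 0" by simp
  define a where "a = Re (l2inner u v)"
  define b where "b = (l2norm v)\<^sup>2 + 1"
  have "b > 0" by (simp add: b_def add_nonneg_pos)
  \<comment> \<open>This makes the quadratic term at most \<open>t * a\<close>, half of the linear
    gain \<open>2 * t * a\<close>; the summand 1 in \<open>b\<close> avoids a division by
    zero.\<close>
  define t where "t = min 1 (a / b)"
  have t: "0 < t" "t \<le> 1" "t * b \<le> a"
    using a \<open>b > 0\<close> by (auto simp: t_def a_def min_def field_simps)
  have "(l2norm u)\<^sup>2 \<le> (l2norm (\<lambda>x. u x - of_real t * v x))\<^sup>2"
    using *[OF t(1,2)] by (rule power_mono) simp
  also have "\<dots> = (l2norm u)\<^sup>2 - 2 * (t * a) + t\<^sup>2 * (l2norm v)\<^sup>2"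
    using l2norm_sq_diff_scale[OF assms(1,2), of "of_real t"] by (simp add: a_def)
  also have "t\<^sup>2 * (l2norm v)\<^sup>2 \<le> t * (t * b)"
    using t(1) by (simp add: b_def power2_eq_square algebra_simps)
  also have "\<dots> \<le> t * a"
    using t by (intro mult_left_mono) auto
  finally have "t * a \<le> 0" by linarith
  then show False
    using t(1) a by (simp add: a_def mult_le_0_iff)
qed

lemma is_proj_exists:
  assumes S: "l2_closed_subspace S" and f: "f \<in> L2"
  obtains g where "is_proj S f g"
proof -
  note SD = l2_closed_subspaceD[OF S]
  have "\<exists>g\<in>S. \<forall>h\<in>S. l2norm (\<lambda>x. f x - g x) \<le> l2norm (\<lambda>x. f x - h x)"
  proof (rule L2_minimizer[of S "\<lambda>g. l2norm (\<lambda>x. f x - g x)" "l2norm f"])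
    show "S \<subseteq> L2" by (rule l2_closed_subspace_subset[OF S])
    show "S \<noteq> {}" using SD(2) by blast
    show "(\<lambda>x. (g x + h x) / 2) \<in> S" if "g \<in> S" "h \<in> S" for g h
      using SD(4)[OF SD(3)[OF that], of "1/2"] by simp
    show "g \<in> S" if "\<And>i. G i \<in> S" "g \<in> L2" "(\<lambda>i. l2norm (\<lambda>x. G i x - g x)) \<longlonglongrightarrow> 0" for G g
      using that by (rule SD(6))
    show "l2norm (\<lambda>x. f x - (g x + h x) / 2) \<le> (l2norm (\<lambda>x. f x - g x) + l2norm (\<lambda>x. f x - h x)) / 2"
      if "g \<in> S" "h \<in> S" for g h
    proof -
      have "l2norm (\<lambda>x. f x - (g x + h x) / 2) = l2norm (\<lambda>x. (1/2) * ((f x - g x) + (f x - h x)))"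
        by (rule arg_cong[where f = l2norm]) (auto simp: field_simps)
      also have "\<dots> \<le> (l2norm (\<lambda>x. f x - g x) + l2norm (\<lambda>x. f x - h x)) / 2"
        unfolding l2norm_scale
        using l2norm_triangle[of "\<lambda>x. f x - g x" "\<lambda>x. f x - h x"] f SD(1)[OF that(1)] SD(1)[OF that(2)] by auto
      finally show ?thesis .
    qed
    show "l2norm (\<lambda>x. f x - g x) \<le> l2norm (\<lambda>x. f x - h x) + l2norm (\<lambda>x. h x - g x)" if "g \<in> S" "h \<in> S" for g h
      using f SD(1)[OF that(1)] SD(1)[OF that(2)] by (intro l2norm_triangle_diff)
    show "l2norm g \<le> l2norm (\<lambda>x. f x - g x) + l2norm f" if "g \<in> S" for g
      using l2norm_triangle_sub[of g f] SD(1)[OF that] f l2norm_minus_commute[of g f] by simp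
  qed auto
  then obtain g where gS: "g \<in> S" and g_min: "\<And>h. h \<in> S \<Longrightarrow> l2norm (\<lambda>x. f x - g x) \<le> l2norm (\<lambda>x. f x - h x)"
    by blast
  have gL: "g \<in> L2" by (rule SD(1)[OF gS])
  have "l2inner (\<lambda>x. f x - g x) h = 0" if h: "h \<in> S" for h
  proof -
    \<comment> \<open>Varying along \<open>c * h\<close> turns the real part of the inner product
      into \<open>(cmod c)\<^sup>2\<close>, so the one-sided condition already forces
      \<open>c = 0\<close>.\<close>
    define c where "c = l2inner (\<lambda>x. f x - g x) h"
    have "Re (l2inner (\<lambda>x. f x - g x) (\<lambda>x. c * h x)) \<le> 0"
    proof (rule l2_variation_le)
      show "l2norm (\<lambda>x. f x - g x) \<le> l2norm (\<lambda>x. f x - g x - of_real t * (c * h x))" for t :: real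
      proof -
        have "(\<lambda>x. g x + of_real t * c * h x) \<in> S"
          by (rule SD(3)[OF gS SD(4)[OF h]])
        then have "l2norm (\<lambda>x. f x - g x) \<le> l2norm (\<lambda>x. f x - (g x + of_real t * c * h x))"
          by (rule g_min)
        then show ?thesis
          by (simp add: algebra_simps)
      qed
    qed (use f gL SD(1)[OF h] in auto)
    then have "(cmod c)\<^sup>2 \<le> 0"
      unfolding l2inner_scale_right c_def[symmetric]
      unfolding cmod_power2 by (simp add: power2_eq_square)
    then show ?thesis
      by (simp add: c_def)
  qed
  then have "is_proj S f g"
    using gS by (simp add: is_proj_def)
  then show ?thesis
    by (rule that)
qed

text \<open>Closedness under limits is Cauchy-Schwarz. The spectral subspaces and the subspace to
  which duality is applied are obtained in this form.\<close>

lemma l2_closed_subspace_orth: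
  assumes "N \<subseteq> L2"
  shows "l2_closed_subspace {f \<in> L2. \<forall>h\<in>N. l2inner f h = 0}"
  unfolding l2_closed_subspace_def
proof (intro conjI allI ballI impI)
  fix F f assume F: "\<forall>k. F k \<in> {f \<in> L2. \<forall>h\<in>N. l2inner f h = 0}" and f: "f \<in> L2"
    and lim: "(\<lambda>k. l2norm (\<lambda>x. F k x - f x)) \<longlonglongrightarrow> 0"
  have "l2inner f h = 0" if h: "h \<in> N" for h
  proof -
    have hL: "h \<in> L2" using h assms by auto
    have "cmod (l2inner f h) \<le> l2norm (\<lambda>x. F k x - f x) * l2norm h" for k
    proof -
      have "l2inner f h = - l2inner (\<lambda>x. F k x - f x) h"
        using F f h hL by (simp add: l2inner_diff_left)
      then show ?thesis
        using l2_cauchy_schwarz[of "\<lambda>x. F k x - f x" h] F f hL by (auto simp: L2_diff)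
    qed
    moreover have "(\<lambda>k. l2norm (\<lambda>x. F k x - f x) * l2norm h) \<longlonglongrightarrow> 0 * l2norm h"
      by (intro tendsto_intros lim)
    ultimately have "cmod (l2inner f h) \<le> 0 * l2norm h"
      by (intro LIMSEQ_le_const) auto
    then show ?thesis by simp
  qed
  with f show "f \<in> {f \<in> L2. \<forall>h\<in>N. l2inner f h = 0}" by simp
next
  fix f g assume *: "f \<in> {f \<in> L2. \<forall>h\<in>N. l2inner f h = 0}" "g \<in> L2" "AE x in \<mu>. f x = g x"
  have "l2inner g h = l2inner f h" if "h \<in> N" for h
    using * that assms by (intro l2inner_cong_AE) auto
  with * show "g \<in> {f \<in> L2. \<forall>h\<in>N. l2inner f h = 0}" by simp
qed (use assms in \<open>auto simp: l2inner_add_left l2inner_scale_left subset_iff\<close>)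

text \<open>\<open>PQ\<close> selects one of many a.e. equal projections; this relation is all that
  is known of the selection.\<close>

lemma is_proj_PQ:
  assumes "l2_closed_subspace S" "f \<in> L2"
  shows "is_proj S f (PQ S f)"
  unfolding PQ_def using is_proj_exists[OF assms] by (metis someI)

lemma is_projD:
  assumes "is_proj S f g"
  shows "g \<in> S" "h \<in> S \<Longrightarrow> l2inner (\<lambda>x. f x - g x) h = 0"
  using assms by (auto simp: is_proj_def)

lemma is_proj_inner:
  assumes "is_proj S f g" "h \<in> S" "S \<subseteq> L2" "f \<in> L2"
  shows "l2inner f h = l2inner g h"
  using is_projD[OF assms(1)] assms(2-) l2inner_diff_left[of f g h] by auto

lemma is_projI:
  assumes "g \<in> S" "S \<subseteq> L2" "f \<in> L2" "\<And>h. h \<in> S \<Longrightarrow> l2inner f h = l2inner g h"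
  shows "is_proj S f g"
  unfolding is_proj_def using assms by (auto simp: l2inner_diff_left subset_iff)

lemma is_proj_unique:
  assumes S: "l2_closed_subspace S" and f: "f \<in> L2" and p: "is_proj S f g" "is_proj S f h"
  shows "AE x in \<mu>. g x = h x"
proof -
  note SL = l2_closed_subspace_subset[OF S]
  have gh: "g \<in> S" "h \<in> S" "g \<in> L2" "h \<in> L2"
    using is_projD(1)[OF p(1)] is_projD(1)[OF p(2)] SL by auto
  have d: "(\<lambda>x. g x - h x) \<in> S"
    using l2_closed_subspace_diff[OF S gh(1,2)] .
  have "l2inner (\<lambda>x. g x - h x) (\<lambda>x. g x - h x) = 0"
    using is_proj_inner[OF p(1) d SL f] is_proj_inner[OF p(2) d SL f] gh
    by (subst l2inner_diff_left) auto
  then have "l2norm (\<lambda>x. g x - h x) = 0"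
    by (simp add: l2inner_self)
  then show ?thesis
    using gh by (simp add: l2norm_diff_eq_0_iff)
qed

lemma is_proj_add:
  assumes S: "l2_closed_subspace S" and "f \<in> L2" "f' \<in> L2" "is_proj S f g" "is_proj S f' g'"
  shows "is_proj S (\<lambda>x. f x + f' x) (\<lambda>x. g x + g' x)"
proof -
  have "S \<subseteq> L2" by (rule l2_closed_subspace_subset[OF S])
  then show ?thesis
    using assms is_proj_inner[of S f g] is_proj_inner[of S f' g'] is_projD(1)[OF assms(4)] is_projD(1)[OF assms(5)]
    by (intro is_projI) (auto intro: l2_closed_subspaceD(3) simp: l2inner_add_left subset_iff)
qed

lemma is_proj_scale:
  assumes S: "l2_closed_subspace S" and "f \<in> L2" "is_proj S f g"
  shows "is_proj S (\<lambda>x. c * f x) (\<lambda>x. c * g x)"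
proof -
  have "S \<subseteq> L2" by (rule l2_closed_subspace_subset[OF S])
  then show ?thesis
    using assms is_proj_inner[of S f g] is_projD(1)[OF assms(3)]
    by (intro is_projI) (auto intro: l2_closed_subspaceD(4) simp: l2inner_scale_left subset_iff)
qed

lemma is_proj_diff:
  assumes S: "l2_closed_subspace S" and "f \<in> L2" "f' \<in> L2" "is_proj S f g" "is_proj S f' g'"
  shows "is_proj S (\<lambda>x. f x - f' x) (\<lambda>x. g x - g' x)"
  using is_proj_add[OF S assms(2) L2_scale[OF assms(3)] assms(4) is_proj_scale[OF S assms(3,5)], of "-1"]
  by simp

lemma is_proj_norm_le:
  assumes S: "l2_closed_subspace S" and f: "f \<in> L2" and p: "is_proj S f g"
  shows "l2norm g \<le> l2norm f"
proof (cases "l2norm g = 0")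
  case False
  note SL = l2_closed_subspace_subset[OF S]
  have g: "g \<in> S" "g \<in> L2" using is_projD(1)[OF p] SL by auto
  have "(l2norm g)\<^sup>2 = cmod (l2inner f g)"
    using is_proj_inner[OF p g(1) SL f] by (simp add: l2inner_self norm_power del: of_real_power)
  also have "\<dots> \<le> l2norm f * l2norm g"
    using f g(2) by (rule l2_cauchy_schwarz)
  finally show ?thesis
    using False by (simp add: power2_eq_square less_le)
qed simp

subsection \<open>Characters\<close>

lemma chr_0 [simp]: "chr 0 = (\<lambda>_. 1)"
  by (simp add: chr_def fun_eq_iff)

lemma chr_add: "chr (k + l) x = chr k x * chr l x"
  by (simp add: chr_def exp_add[symmetric] algebra_simps sum.distrib)

lemma chr_uminus: "chr (- k) x = cnj (chr k x)"
  by (simp add: chr_def exp_cnj sum_negf)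

lemma chr_diff: "chr (k - l) x = chr k x * cnj (chr l x)"
  using chr_add[of k "- l" x] by (simp add: chr_uminus)

lemma norm_chr [simp]: "cmod (chr k x) = 1"
  unfolding chr_def by (rule norm_exp_i_times)

lemma zc_eq_chr:
  fixes i :: "'n::finite"
  shows "zc i = chr (axis i 1)"
proof
  fix x :: "real^'n"
  have "(\<Sum>j\<in>UNIV. of_int (axis i 1 $ j) * x $ j) = (\<Sum>j\<in>UNIV. if j = i then x $ j else 0)"
    by (rule sum.cong) (auto simp: axis_def)
  then show "zc i x = chr (axis i 1) x"
    by (simp add: zc_def chr_def)
qed

lemma continuous_on_chr [continuous_intros]: "continuous_on S (chr k)"
  unfolding chr_def by (intro continuous_intros)

lemma L2_continuous:
  assumes "continuous_on UNIV f"
  shows "f \<in> L2"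
proof -
  have "compact (f ` cbox 0 (\<chi> i. 2 * pi))"
    by (rule compact_continuous_image[OF continuous_on_subset[OF assms]]) auto
  then obtain B where B: "\<And>x. x \<in> cbox 0 (\<chi> i. 2 * pi) \<Longrightarrow> cmod (f x) \<le> B"
    unfolding compact_eq_bounded_closed bounded_iff by auto
  show ?thesis
  proof (rule L2_bounded)
    show "f \<in> borel_measurable \<mu>"
      by (rule measurable_torus[OF borel_measurable_continuous_onI[OF assms]])
    show "AE x in \<mu>. cmod (f x) \<le> B"
      using AE_space by eventually_elim (simp add: space_torus B)
  qed
qed

lemma chr_L2 [simp]: "chr k \<in> L2"
  by (intro L2_continuous continuous_intros)

lemma measurable_chr [measurable]: "chr k \<in> borel_measurable \<mu>"
  by (rule L2_measurable[OF chr_L2])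

lemma one_L2 [simp]: "(\<lambda>_. 1) \<in> L2"
  using chr_L2[of 0] by simp

lemma chr_mult_L2 [intro]: "f \<in> L2 \<Longrightarrow> (\<lambda>x. chr k x * f x) \<in> L2"
  by (rule L2_mult_bounded[where B = 1]) auto

section \<open>Lebesgue measure on vectors as a product of lines\<close>

lemma prod_Basis_vec: "(\<Prod>b\<in>(Basis :: (real^'n::finite) set). f b) = (\<Prod>i\<in>UNIV. f (axis i 1))"
proof -
  have eq: "(Basis :: (real^'n) set) = range (\<lambda>i. axis i 1)"
    by (auto simp: Basis_vec_def)
  have "inj (\<lambda>i::'n. axis i (1::real))"
    by (auto intro!: injI simp: axis_eq_axis)
  then have "prod f (range (\<lambda>i. axis i 1)) = prod (f \<circ> (\<lambda>i. axis i 1)) UNIV"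
    by (rule prod.reindex)
  then show ?thesis
    unfolding eq comp_def .
qed

lemma measurable_vec_lambda_PiM:
  "(\<lambda>\<omega>. \<chi> i. \<omega> i) \<in> measurable (PiM UNIV (\<lambda>_::'n::finite. lborel)) (borel :: (real^'n) measure)"
proof (rule borel_measurable_euclidean_space[THEN iffD2], intro ballI)
  fix b :: "real^'n" assume "b \<in> Basis"
  then obtain i where b: "b = axis i 1"
    by (auto simp: Basis_vec_def)
  have "(\<lambda>\<omega>. (\<chi> i. \<omega> i) \<bullet> b) = (\<lambda>\<omega>. \<omega> i)"
    by (simp add: b inner_axis fun_eq_iff)
  moreover have "(\<lambda>\<omega>. \<omega> i) \<in> measurable (PiM UNIV (\<lambda>_::'n::finite. lborel)) (lborel :: real measure)"
    by (rule measurable_component_singleton) simp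
  ultimately show "(\<lambda>\<omega>. (\<chi> i. \<omega> i) \<bullet> b) \<in> borel_measurable (PiM UNIV (\<lambda>_::'n::finite. lborel))"
    by simp
qed

text \<open>Both measures agree on boxes. The product is a measure on functions
  \<open>'n \<Rightarrow> real\<close>, whence the image under the map to vectors; the gain is
  Fubini's theorem one coordinate at a time.\<close>

lemma lborel_vec_eq:
  "(lborel :: (real^'n::finite) measure) = distr (PiM UNIV (\<lambda>_::'n. lborel)) borel (\<lambda>\<omega>. \<chi> i. \<omega> i)"
proof (rule lborel_eqI)
  fix l u :: "real^'n" assume le: "\<And>b. b \<in> Basis \<Longrightarrow> l \<bullet> b \<le> u \<bullet> b"
  interpret product_sigma_finite "\<lambda>_::'n. lborel :: real measure" ..
  have le': "l $ i \<le> u $ i" for i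
    using le[of "axis i 1"] by (auto simp: inner_axis Basis_vec_def)
  have "emeasure (distr (PiM UNIV (\<lambda>_::'n. lborel)) borel (\<lambda>\<omega>. \<chi> i. \<omega> i)) (box l u) =
      emeasure (PiM UNIV (\<lambda>_::'n. lborel)) (PiE UNIV (\<lambda>i. {l $ i<..<u $ i}))"
    by (subst emeasure_distr[OF measurable_vec_lambda_PiM])
       (auto intro!: arg_cong[where f = "emeasure _"] simp: space_PiM mem_box_cart PiE_iff)
  also have "\<dots> = (\<Prod>i\<in>UNIV. emeasure lborel {l $ i<..<u $ i})"
    by (rule emeasure_PiM) auto
  also have "\<dots> = (\<Prod>i\<in>UNIV. ennreal (u $ i - l $ i))"
    using le' by simp
  also have "\<dots> = ennreal (\<Prod>i\<in>UNIV. u $ i - l $ i)"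
    using le' by (intro prod_ennreal) simp
  also have "\<dots> = (\<Prod>b\<in>Basis. (u - l) \<bullet> b)"
    by (subst prod_Basis_vec) (simp add: inner_axis)
  finally show "emeasure (distr (PiM UNIV (\<lambda>_::'n. lborel)) borel (\<lambda>\<omega>. \<chi> i. \<omega> i)) (box l u) =
      (\<Prod>b\<in>Basis. (u - l) \<bullet> b)" .
qed simp

text \<open>The uniform density on [0, 2 pi], complex valued and defined on the whole line. With it
  the torus integral lives on the full product of lines and its weight factors over the
  coordinates.\<close>

abbreviation unif :: "real \<Rightarrow> complex" where
  "unif t \<equiv> complex_of_real (indicator {0..2*pi} t / (2*pi))"

lemma integral_torus_PiM:
  fixes f :: "real^'n::finite \<Rightarrow> complex"
  assumes f: "f \<in> borel_measurable borel"
  shows "integral\<^sup>L \<mu> f =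
    (LINT \<omega>|PiM UNIV (\<lambda>_::'n. lborel). (\<Prod>i\<in>UNIV. unif (\<omega> i)) * f (\<chi> i. \<omega> i))"
proof -
  have "integral\<^sup>L \<mu> f =
    (LINT x|distr (PiM UNIV (\<lambda>_::'n. lborel)) borel (\<lambda>\<omega>. \<chi> i. \<omega> i).
       indicator (cbox 0 (\<chi> i. 2 * pi)) x *\<^sub>R ((1 / (2 * pi) ^ CARD('n)) *\<^sub>R f x))"
    unfolding integral_torus[OF measurable_torus[OF f]] lborel_vec_eq ..
  also have "\<dots> = (LINT \<omega>|PiM UNIV (\<lambda>_::'n. lborel).
       indicator (cbox 0 (\<chi> i. 2 * pi)) (\<chi> i. \<omega> i) *\<^sub>R ((1 / (2 * pi) ^ CARD('n)) *\<^sub>R f (\<chi> i. \<omega> i)))"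
    using f by (intro integral_distr[OF measurable_vec_lambda_PiM]) measurable
  also have "\<dots> = (LINT \<omega>|PiM UNIV (\<lambda>_::'n. lborel). (\<Prod>i\<in>UNIV. unif (\<omega> i)) * f (\<chi> i. \<omega> i))"
  proof (rule Bochner_Integration.integral_cong[OF refl])
    fix \<omega> :: "'n \<Rightarrow> real"
    have "(indicator (cbox 0 (\<chi> i. 2 * pi)) ((\<chi> i. \<omega> i) :: real^'n) :: real) = (\<Prod>i\<in>UNIV. indicator {0..2*pi} (\<omega> i))"
      by (auto simp: indicator_def mem_box_cart)
    then have "(\<Prod>i\<in>UNIV. indicator {0..2*pi} (\<omega> i) / (2*pi)) =
        indicator (cbox 0 (\<chi> i. 2 * pi)) ((\<chi> i. \<omega> i) :: real^'n) / (2 * pi) ^ CARD('n)"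
      by (simp add: prod_dividef)
    then show "indicator (cbox 0 (\<chi> i. 2 * pi)) (\<chi> i. \<omega> i) *\<^sub>R ((1 / (2 * pi) ^ CARD('n)) *\<^sub>R f (\<chi> i. \<omega> i)) =
        (\<Prod>i\<in>UNIV. unif (\<omega> i)) * f (\<chi> i. \<omega> i)"
      unfolding of_real_prod[symmetric] by (simp add: scaleR_conv_of_real)
  qed
  finally show ?thesis .
qed

lemma integrable_unif_mult:
  assumes "continuous_on {0..2*pi} f"
  shows "integrable lborel (\<lambda>t. unif t * f t)"
proof -
  have "integrable lborel (\<lambda>t. indicator {0..2*pi} t *\<^sub>R (f t / (2*pi)))"
    by (intro borel_integrable_compact[unfolded set_integrable_def] continuous_intros assms) auto
  then show ?thesis
    by (rule Bochner_Integration.integrable_cong[THEN iffD1, OF refl, rotated]) (auto simp: scaleR_conv_of_real)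
qed

lemma integral_exp_period:
  fixes m :: int
  shows "(LINT t|lborel. unif t * exp (\<i> * of_real (of_int m * t))) =
    (if m = 0 then 1 else 0)"
proof (cases "m = 0")
  case True
  have "(LINT t|lborel. unif t * exp (\<i> * of_real (of_int m * t))) =
      complex_of_real (LINT t|lborel. indicator {0..2*pi} t / (2*pi))"
    by (simp add: True)
  then show ?thesis
    using True by simp
next
  case False
  define F where "F t = exp (\<i> * of_real (of_int m * t)) / (\<i> * of_int m * (2*pi))" for t :: real
  have "(LINT t|lborel. unif t * exp (\<i> * of_real (of_int m * t))) =
      (LINT t|lborel. indicator {0..2*pi} t *\<^sub>R (exp (\<i> * of_real (of_int m * t)) / (2*pi)))"
    by (rule Bochner_Integration.integral_cong) (auto simp: scaleR_conv_of_real)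
  also have "\<dots> = F (2*pi) - F 0"
  proof (rule integral_FTC_Icc)
    show "(F has_vector_derivative exp (\<i> * of_real (of_int m * t)) / (2*pi)) (at t within {0..2*pi})" for t
      unfolding F_def using False
      by (auto intro!: derivative_eq_intros has_vector_derivative_real_field simp: field_simps)
    show "continuous_on {0..2*pi} (\<lambda>t. exp (\<i> * of_real (of_int m * t)) / (2*pi))"
      by (intro continuous_intros) auto
  qed simp
  also have "exp (\<i> * of_real (of_int m * (2*pi))) = 1"
    using exp_integer_2pi[of "of_int m"] by (simp add: mult_ac)
  then have "F (2*pi) - F 0 = 0"
    by (simp add: F_def)
  finally show ?thesis
    using False by simp
qed

lemma integral_chr: "integral\<^sup>L \<mu> (chr (k :: int^'n::finite)) = (if k = 0 then 1 else 0)"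
proof -
  interpret product_sigma_finite "\<lambda>_::'n. lborel :: real measure" ..
  define g where "g i t = unif t * exp (\<i> * of_real (of_int (k $ i) * t))" for i t
  have "integral\<^sup>L \<mu> (chr k) = (LINT \<omega>|PiM UNIV (\<lambda>_::'n. lborel). (\<Prod>i\<in>UNIV. unif (\<omega> i)) * chr k (\<chi> i. \<omega> i))"
    by (intro integral_torus_PiM borel_measurable_continuous_onI continuous_intros)
  also have "\<dots> = (LINT \<omega>|PiM UNIV (\<lambda>_::'n. lborel). (\<Prod>i\<in>UNIV. g i (\<omega> i)))"
    unfolding g_def prod.distrib
    by (simp add: chr_def exp_sum sum_distrib_left)
  also have "\<dots> = (\<Prod>i\<in>UNIV. integral\<^sup>L lborel (g i))"
    unfolding g_def by (intro product_integral_prod integrable_unif_mult continuous_intros) simp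
  also have "\<dots> = (\<Prod>i\<in>UNIV. if k $ i = 0 then 1 else 0)"
    unfolding g_def integral_exp_period ..
  also have "\<dots> = (if k = 0 then 1 else 0)"
    by (auto simp: vec_eq_iff)
  finally show ?thesis .
qed

lemma l2inner_chr: "l2inner (chr k) (chr l) = (if k = l then 1 else 0)"
  unfolding l2inner_def chr_diff[symmetric] integral_chr by simp

lemma fcoeff_chr: "fcoeff (chr k) l = (if k = l then 1 else 0)"
  by (simp add: fcoeff_def l2inner_chr)

lemma fcoeff_diff: "f \<in> L2 \<Longrightarrow> g \<in> L2 \<Longrightarrow> fcoeff (\<lambda>x. f x - g x) k = fcoeff f k - fcoeff g k"
  by (simp add: fcoeff_def l2inner_diff_left)

lemma fcoeff_scale: "fcoeff (\<lambda>x. c * f x) k = c * fcoeff f k"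
  by (simp add: fcoeff_def l2inner_scale_left)

lemma fcoeff_cnj: "fcoeff (\<lambda>x. cnj (f x)) k = cnj (fcoeff f (- k))"
  unfolding fcoeff_def l2inner_def Bochner_Integration.integral_cnj[symmetric] by (simp add: chr_uminus)

lemma fcoeff_chr_mult: "fcoeff (\<lambda>x. chr l x * f x) k = fcoeff f (k - l)"
  unfolding fcoeff_def l2inner_def chr_diff by (simp add: mult_ac)

subsection \<open>Uniqueness of Fourier coefficients\<close>

text \<open>The algebra to which Stone-Weierstrass is applied. Constants come from
  \<open>chr 0\<close>, and closure under products is a consequence of
  \<open>chr_add\<close>.\<close>

inductive_set trig_polys :: "('n::finite) tfun set" where
  chr: "chr k \<in> trig_polys"
| add: "f \<in> trig_polys \<Longrightarrow> g \<in> trig_polys \<Longrightarrow> (\<lambda>x. f x + g x) \<in> trig_polys"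
| scale: "f \<in> trig_polys \<Longrightarrow> (\<lambda>x. c * f x) \<in> trig_polys"

lemma trig_polys_chr_mult: "f \<in> trig_polys \<Longrightarrow> (\<lambda>x. chr k x * f x) \<in> trig_polys"
proof (induction rule: trig_polys.induct)
  case (chr l)
  show ?case
    unfolding chr_add[symmetric] by (rule trig_polys.chr)
next
  case (add f g)
  then show ?case
    using trig_polys.add[OF add.IH] by (simp add: algebra_simps)
next
  case (scale f c)
  then show ?case
    using trig_polys.scale[OF scale.IH, of c] by (simp add: mult_ac)
qed

lemma trig_polys_mult: "f \<in> trig_polys \<Longrightarrow> g \<in> trig_polys \<Longrightarrow> (\<lambda>x. f x * g x) \<in> trig_polys"
proof (induction rule: trig_polys.induct)
  case (chr l)
  then show ?case
    by (rule trig_polys_chr_mult)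
next
  case (add f1 f2)
  show ?case
    using trig_polys.add[OF add.IH(1)[OF add.prems] add.IH(2)[OF add.prems]] by (simp add: algebra_simps)
next
  case (scale f c)
  show ?case
    using trig_polys.scale[OF scale.IH[OF scale.prems], of c] by (simp add: mult_ac)
qed

lemma trig_polys_L2: "p \<in> trig_polys \<Longrightarrow> p \<in> L2"
  by (induction rule: trig_polys.induct) auto

lemma trig_polys_const: "(\<lambda>_. c) \<in> trig_polys"
  using trig_polys.scale[OF trig_polys.chr[of 0], of c] by simp

lemma l2inner_trig_polys_zero:
  assumes f: "f \<in> L2" "\<And>k. fcoeff f k = 0" and p: "p \<in> trig_polys"
  shows "l2inner f p = 0"
  using p
proof (induction rule: trig_polys.induct)
  case (chr k)
  then show ?case using f by (simp add: fcoeff_def)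
next
  case (add p q)
  then show ?case using f by (simp add: l2inner_add_right trig_polys_L2)
next
  case (scale p c)
  then show ?case by (simp add: l2inner_scale_right)
qed

section \<open>Uniform approximation on the torus\<close>

definition cis_vec :: "real^'n::finite \<Rightarrow> complex^'n" where
  "cis_vec x = (\<chi> j. exp (\<i> * of_real (x $ j)))"

definition ctorus :: "(complex^'n::finite) set" where
  "ctorus = {z. \<forall>j. cmod (z $ j) = 1}"

lemma cis_vec_ctorus [simp]: "cis_vec x \<in> ctorus"
  by (simp add: cis_vec_def ctorus_def)

lemma cis_vec_nth: "cis_vec x $ j = chr (axis j 1) x"
  using zc_eq_chr[of j] by (simp add: cis_vec_def zc_def fun_eq_iff)

lemma continuous_on_cis_vec [continuous_intros]: "continuous_on S cis_vec"
  unfolding cis_vec_def by (intro continuous_intros)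

lemma measurable_cis_vec [measurable]: "cis_vec \<in> measurable \<mu> borel"
  by (intro measurable_torus borel_measurable_continuous_onI continuous_intros)

lemma compact_ctorus: "compact (ctorus :: (complex^'n::finite) set)"
proof (rule compact_eq_bounded_closed[THEN iffD2], intro conjI)
  show "bounded (ctorus :: (complex^'n) set)"
  proof (rule boundedI)
    fix z :: "complex^'n" assume "z \<in> ctorus"
    then show "norm z \<le> (\<Sum>j\<in>(UNIV :: 'n set). 1)"
      using L2_set_le_sum[of UNIV "\<lambda>j. cmod (z $ j)"] by (simp add: ctorus_def norm_vec_def)
  qed
  have "ctorus = (\<Inter>j. {z :: complex^'n. cmod (z $ j) = 1})"
    by (auto simp: ctorus_def)
  also have "closed \<dots>"
    by (intro closed_INT ballI closed_Collect_eq continuous_intros)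
  finally show "closed (ctorus :: (complex^'n) set)" .
qed

text \<open>Stone-Weierstrass is used on the torus in C^n and not on the cube of angles, where the
  characters cannot separate opposite faces. The ring consists of the real functions whose pullback
  to angles is a trigonometric polynomial; real and imaginary parts of the coordinates separate
  points.\<close>

lemma continuous_on_ctorus_approx:
  fixes g :: "complex^'n::finite \<Rightarrow> real"
  assumes g: "continuous_on ctorus g" and e: "e > 0"
  obtains p where "p \<in> trig_polys" "\<And>x. cmod (of_real (g (cis_vec x)) - p x) < e"
proof -
  define R where "R = {r :: complex^'n \<Rightarrow> real. continuous_on ctorus r \<and> (\<lambda>x. of_real (r (cis_vec x))) \<in> trig_polys}"
  interpret function_ring_on R "ctorus :: (complex^'n) set"
  proof
    show "compact (ctorus :: (complex^'n) set)"
      by (rule compact_ctorus)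
    show "(\<lambda>x. f x + g x) \<in> R" if "f \<in> R" "g \<in> R" for f g
      using that trig_polys.add by (fastforce simp: R_def intro: continuous_intros)
    show "(\<lambda>x. f x * g x) \<in> R" if "f \<in> R" "g \<in> R" for f g
      using that trig_polys_mult by (fastforce simp: R_def intro: continuous_intros)
    show "(\<lambda>_. c) \<in> R" for c
      by (simp add: R_def trig_polys_const)
    show "\<exists>f\<in>R. f z \<noteq> f w" if ne: "z \<noteq> w" for z w :: "complex^'n"
    proof -
      obtain j where j: "z $ j \<noteq> w $ j"
        using ne unfolding vec_eq_iff by blast
      have c: "cnj (cis_vec x $ j) = chr (- axis j 1) x" for x
        by (simp add: cis_vec_nth chr_uminus)
      have Re: "(\<lambda>z :: complex^'n. Re (z $ j)) \<in> R"
      proof -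
        have "(\<lambda>x. (1/2) * chr (axis j 1) x + (1/2) * chr (- axis j 1) x) \<in> trig_polys"
          by (intro trig_polys.intros)
        moreover have "(\<lambda>x. (1/2) * chr (axis j 1) x + (1/2) * chr (- axis j 1) x) = (\<lambda>x. of_real (Re (cis_vec x $ j)))"
          by (auto simp: c[symmetric] cis_vec_nth[symmetric] complex_eq_iff)
        ultimately show ?thesis
          by (auto simp: R_def intro!: continuous_intros)
      qed
      have Im: "(\<lambda>z :: complex^'n. Im (z $ j)) \<in> R"
      proof -
        have "(\<lambda>x. (-\<i>/2) * chr (axis j 1) x + (\<i>/2) * chr (- axis j 1) x) \<in> trig_polys"
          by (intro trig_polys.intros)
        moreover have "(\<lambda>x. (-\<i>/2) * chr (axis j 1) x + (\<i>/2) * chr (- axis j 1) x) = (\<lambda>x. of_real (Im (cis_vec x $ j)))"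
          by (auto simp: c[symmetric] cis_vec_nth[symmetric] complex_eq_iff)
        ultimately show ?thesis
          by (auto simp: R_def intro!: continuous_intros)
      qed
      show ?thesis
        using j bexI[OF _ Re, of "\<lambda>f. f z \<noteq> f w"] bexI[OF _ Im, of "\<lambda>f. f z \<noteq> f w"]
        unfolding complex_eq_iff by blast
    qed
  qed (simp add: R_def)
  obtain r where r: "r \<in> R" "\<And>z. z \<in> ctorus \<Longrightarrow> \<bar>g z - r z\<bar> < e"
    using Stone_Weierstrass_basic[OF g e] by blast
  show ?thesis
  proof
    show "(\<lambda>x. of_real (r (cis_vec x))) \<in> trig_polys"
      using r(1) by (simp add: R_def)
    show "cmod (of_real (g (cis_vec x)) - of_real (r (cis_vec x))) < e" for x
      using r(2)[of "cis_vec x"] by (simp flip: of_real_diff)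
  qed
qed

text \<open>\<open>f\<close> is orthogonal to every trigonometric polynomial, so the integral is at
  most \<open>l1norm f\<close> times a uniform approximation error, which is arbitrarily
  small.\<close>

lemma l2inner_continuous_zero:
  fixes g :: "complex^'n::finite \<Rightarrow> real"
  assumes f: "f \<in> L2" "\<And>k. fcoeff f k = 0" and g: "continuous_on UNIV g"
  shows "(LINT x|\<mu>. f x * of_real (g (cis_vec x))) = 0"
proof -
  let ?g = "\<lambda>x. complex_of_real (g (cis_vec x))"
  have gb: "?g \<in> borel_measurable \<mu>"
    using borel_measurable_continuous_onI[OF g] by measurable
  have "continuous_on ctorus g"
    using g continuous_on_subset by blast
  then have "compact (g ` ctorus)"
    by (rule compact_continuous_image[OF _ compact_ctorus])
  then obtain B where B: "\<And>z. z \<in> ctorus \<Longrightarrow> \<bar>g z\<bar> \<le> B"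
    unfolding compact_eq_bounded_closed bounded_iff by auto
  have gL: "?g \<in> L2"
    using B by (intro L2_bounded[OF gb, of B]) auto
  have "cmod (l2inner f ?g) \<le> l1norm f * e" if e: "e > 0" for e
  proof -
    obtain p where p: "p \<in> trig_polys" "\<And>x. cmod (?g x - p x) < e"
      using continuous_on_ctorus_approx[OF continuous_on_subset[OF g] e] by blast
    have pL: "p \<in> L2" using p(1) by (rule trig_polys_L2)
    have "l2inner f ?g = l2inner f (\<lambda>x. ?g x - p x)"
      using l2inner_trig_polys_zero[OF f p(1)] f(1) gL pL by (simp add: l2inner_diff_right)
    also have "cmod \<dots> \<le> (LINT x|\<mu>. cmod (f x * cnj (?g x - p x)))"
      unfolding l2inner_def by (rule integral_norm_bound)
    also have "\<dots> \<le> (LINT x|\<mu>. cmod (f x) * e)"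
    proof (rule integral_mono)
      show "integrable \<mu> (\<lambda>x. cmod (f x * cnj (?g x - p x)))"
        by (intro integrable_norm inner_integrable L2_diff f gL pL)
      show "integrable \<mu> (\<lambda>x. cmod (f x) * e)"
        by (intro integrable_mult_left integrable_norm L2_integrable f)
      show "cmod (f x * cnj (?g x - p x)) \<le> cmod (f x) * e" for x
        unfolding norm_mult complex_mod_cnj using p(2)[of x] by (intro mult_left_mono) auto
    qed
    finally show ?thesis
      by (simp add: l1norm_def)
  qed
  then have "\<forall>\<^sub>F e in at_right 0. cmod (l2inner f ?g) \<le> l1norm f * e"
    by (auto simp: eventually_at_right_field intro!: exI[of _ 1])
  moreover have "((\<lambda>e. l1norm f * e) \<longlongrightarrow> l1norm f * 0) (at_right 0)"
    by (intro tendsto_intros)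
  ultimately have "cmod (l2inner f ?g) \<le> l1norm f * 0"
    by (intro tendsto_lowerbound[where F = "at_right (0::real)"]) auto
  then show ?thesis
    by (simp add: l2inner_def)
qed

section \<open>From continuous functions to Borel sets\<close>

lemma integral_vimage_closed_zero:
  fixes f :: "'n::finite tfun"
  assumes f: "f \<in> L2" "\<And>k. fcoeff f k = 0" and B: "closed B"
  shows "(LINT x:(cis_vec -` B \<inter> space \<mu>)|\<mu>. f x) = 0"
proof (cases "B = {}")
  case True
  then show ?thesis by (simp add: set_lebesgue_integral_def)
next
  case False
  \<comment> \<open>Continuous functions equal to 1 on \<open>B\<close> and supported ever closer to
    \<open>B\<close>; they converge to its indicator because \<open>B\<close> is closed.\<close>
  define g where "g m z = max 0 (1 - real m * infdist z B)" for m and z :: "complex^'n"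
  have gc: "continuous_on UNIV (g m)" for m
    unfolding g_def by (intro continuous_intros)
  have [measurable]: "g m \<in> borel_measurable borel" for m
    by (rule borel_measurable_continuous_onI[OF gc])
  have [measurable]: "B \<in> sets borel"
    using B by simp
  have [measurable]: "f \<in> borel_measurable \<mu>"
    using f by measurable
  have lim: "(\<lambda>m. g m z) \<longlonglongrightarrow> indicator B z" for z
  proof (cases "z \<in> B")
    case True
    then show ?thesis by (simp add: g_def)
  next
    case nz: False
    then have pos: "infdist z B > 0"
      using B False by (simp add: infdist_pos_not_in_closed)
    have "\<forall>\<^sub>F m in sequentially. g m z = 0"
    proof -
      obtain N where N: "real N * infdist z B > 1"
        using reals_Archimedean3[OF pos] by blast
      have "g m z = 0" if "m \<ge> N" for m
      proof -
        have "real N * infdist z B \<le> real m * infdist z B"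
          using that pos by (intro mult_right_mono) auto
        then show ?thesis using N by (simp add: g_def)
      qed
      then show ?thesis
        by (auto simp: eventually_sequentially)
    qed
    then show ?thesis
      using nz by (simp add: tendsto_eventually)
  qed
  have "(\<lambda>m. LINT x|\<mu>. f x * of_real (g m (cis_vec x))) \<longlonglongrightarrow> (LINT x|\<mu>. f x * of_real (indicator B (cis_vec x)))"
  proof (rule integral_dominated_convergence[where w = "\<lambda>x. cmod (f x)"])
    show "integrable \<mu> (\<lambda>x. cmod (f x))"
      by (intro integrable_norm L2_integrable f)
    show "AE x in \<mu>. (\<lambda>m. f x * of_real (g m (cis_vec x))) \<longlonglongrightarrow> f x * of_real (indicator B (cis_vec x))"
      by (intro AE_I2 tendsto_intros lim)
    show "AE x in \<mu>. cmod (f x * of_real (g m (cis_vec x))) \<le> cmod (f x)" for m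
    proof (rule AE_I2)
      fix x
      have "\<bar>g m (cis_vec x)\<bar> \<le> 1"
        by (auto simp: g_def infdist_nonneg)
      then have "cmod (f x) * \<bar>g m (cis_vec x)\<bar> \<le> cmod (f x) * 1"
        by (intro mult_left_mono) auto
      then show "cmod (f x * of_real (g m (cis_vec x))) \<le> cmod (f x)"
        by (simp add: norm_mult)
    qed
  qed measurable
  then have "(LINT x|\<mu>. f x * of_real (indicator B (cis_vec x))) = 0"
    unfolding l2inner_continuous_zero[OF f gc] by (simp add: LIMSEQ_const_iff)
  moreover have "(LINT x:(cis_vec -` B \<inter> space \<mu>)|\<mu>. f x) = (LINT x|\<mu>. f x * of_real (indicator B (cis_vec x)))"
    unfolding set_lebesgue_integral_def
    by (rule Bochner_Integration.integral_cong) (auto simp: indicator_def)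
  ultimately show ?thesis
    by simp
qed

text \<open>The sets over whose preimage \<open>f\<close> has integral zero are stable under
  complements and countable disjoint unions and contain the closed sets, an intersection-stable
  generator.\<close>

lemma integral_vimage_borel_zero:
  fixes f :: "'n::finite tfun"
  assumes f: "f \<in> L2" "\<And>k. fcoeff f k = 0" and B: "B \<in> sets borel"
  shows "(LINT x:(cis_vec -` B \<inter> space \<mu>)|\<mu>. f x) = 0"
proof -
  have int: "set_integrable \<mu> (space \<mu>) f"
    unfolding set_integrable_def by (rule integrable_mult_indicator[OF sets.top L2_integrable[OF f(1)]])
  have B': "B \<in> sigma_sets UNIV (Collect closed)"
    using B by (simp add: borel_eq_closed)
  have meas: "cis_vec -` A \<inter> space \<mu> \<in> sets \<mu>" if "A \<in> sigma_sets UNIV (Collect closed)" for A :: "(complex^'n) set"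
    using that by (intro measurable_sets[OF measurable_cis_vec]) (simp add: borel_eq_closed)
  show ?thesis
    using _ _ B'
  proof (rule sigma_sets_induct_disjoint)
    show "Int_stable (Collect closed :: (complex^'n) set set)"
      by (auto simp: Int_stable_def)
    show "(LINT x:(cis_vec -` A \<inter> space \<mu>)|\<mu>. f x) = 0" if "A \<in> Collect closed" for A :: "(complex^'n) set"
      using integral_vimage_closed_zero[OF f] that by simp
    show "(LINT x:(cis_vec -` {} \<inter> space \<mu>)|\<mu>. f x) = 0"
      by (simp add: set_lebesgue_integral_def)
    show "(LINT x:(cis_vec -` (UNIV - A) \<inter> space \<mu>)|\<mu>. f x) = 0"
      if A: "A \<in> sigma_sets UNIV (Collect closed)" and 0: "(LINT x:(cis_vec -` A \<inter> space \<mu>)|\<mu>. f x) = 0"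
      for A :: "(complex^'n) set"
    proof -
      let ?A = "cis_vec -` A \<inter> space \<mu>" and ?C = "cis_vec -` (UNIV - A) \<inter> space \<mu>"
      have C: "?C \<in> sets \<mu>"
        using meas[OF A] by (metis Diff_Int_distrib2 sets.compl_sets vimage_Diff vimage_UNIV Int_UNIV_left)
      have "(LINT x:(?A \<union> ?C)|\<mu>. f x) = (LINT x:?A|\<mu>. f x) + (LINT x:?C|\<mu>. f x)"
        by (rule set_integral_Un) (use C meas[OF A] in \<open>auto intro!: set_integrable_subset[OF int]\<close>)
      moreover have "?A \<union> ?C = cis_vec -` UNIV \<inter> space \<mu>"
        by auto
      ultimately show ?thesis
        using integral_vimage_closed_zero[OF f closed_UNIV] 0 by simp
    qed
    show "(LINT x:(cis_vec -` (\<Union>i. A i) \<inter> space \<mu>)|\<mu>. f x) = 0"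
      if A: "disjoint_family A" "range A \<subseteq> sigma_sets UNIV (Collect closed)"
        and 0: "\<And>i. (LINT x:(cis_vec -` A i \<inter> space \<mu>)|\<mu>. f x) = 0"
      for A :: "nat \<Rightarrow> (complex^'n) set"
    proof -
      have eq: "cis_vec -` (\<Union>i. A i) \<inter> space \<mu> = (\<Union>i. cis_vec -` A i \<inter> space \<mu>)"
        by auto
      have m: "cis_vec -` A i \<inter> space \<mu> \<in> sets \<mu>" for i
        using A(2) by (intro meas) auto
      have "(LINT x:(\<Union>i. cis_vec -` A i \<inter> space \<mu>)|\<mu>. f x) = (\<Sum>i. (LINT x:(cis_vec -` A i \<inter> space \<mu>)|\<mu>. f x))"
      proof (rule lebesgue_integral_countable_add)
        show "set_integrable \<mu> (\<Union>i. cis_vec -` A i \<inter> space \<mu>) f"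
          by (rule set_integrable_subset[OF int]) (use m in blast)+
        show "(cis_vec -` A i \<inter> space \<mu>) \<inter> (cis_vec -` A j \<inter> space \<mu>) = {}" if "i \<noteq> j" for i j
          using A(1) that by (auto simp: disjoint_family_on_def)
      qed (rule m)
      then show ?thesis
        unfolding eq using 0 by simp
    qed
  qed auto
qed

lemma measurable_Arg2pi [measurable]: "Arg2pi \<in> borel_measurable borel"
proof (rule borel_measurableI_greater)
  show "{z \<in> space borel. t < Arg2pi z} \<in> sets borel" for t
    using open_Arg2pi2pi_gt[of t] by simp
qed

lemma Arg2pi_exp_real: "0 \<le> t \<Longrightarrow> t < 2 * pi \<Longrightarrow> Arg2pi (exp (\<i> * of_real t)) = t"
  by (subst Arg2pi_exp) auto

text \<open>The set where \<open>Re (g x)\<close> is positive is, up to a null set, the preimage of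
  a Borel set under \<open>cis_vec\<close>, because almost every angle vector can be recovered from
  its point on the torus. Hence the positive part of the real part has integral zero.\<close>

theorem L2_eq_0_if_fcoeff_zero:
  fixes f :: "'n::finite tfun"
  assumes f: "f \<in> L2" "\<And>k. fcoeff f k = 0"
  shows "AE x in \<mu>. f x = 0"
proof -
  have Re_le: "AE x in \<mu>. Re (g x) \<le> 0" if g: "g \<in> L2" "\<And>k. fcoeff g k = 0" for g :: "'n tfun"
  proof -
    define ge where "ge x = indicator (cbox 0 (\<chi> i. 2 * pi)) x *\<^sub>R g x" for x
    have [measurable]: "ge \<in> borel_measurable borel"
      unfolding ge_def by (intro measurable_torus_extend L2_measurable g)
    \<comment> \<open>A left inverse of \<open>cis_vec\<close> on the open cube.\<close>
    define G where "G z = (\<chi> j. Arg2pi (z $ j))" for z :: "complex^'n"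
    have [measurable]: "G \<in> borel_measurable borel"
    proof (rule borel_measurable_euclidean_space[THEN iffD2], intro ballI)
      fix b :: "real^'n" assume "b \<in> Basis"
      then obtain i where b: "b = axis i 1"
        by (auto simp: Basis_vec_def)
      have "(\<lambda>z :: complex^'n. z $ i) \<in> borel_measurable borel"
        by (intro borel_measurable_continuous_onI continuous_intros)
      then show "(\<lambda>z. G z \<bullet> b) \<in> borel_measurable borel"
        unfolding b by (simp add: inner_axis G_def)
    qed
    define B where "B = {z. Re (ge (G z)) > 0}"
    have B: "B \<in> sets borel"
      unfolding B_def by measurable
    have ind: "AE x in \<mu>. indicator (cis_vec -` B \<inter> space \<mu>) x = (if Re (g x) > 0 then 1 else 0 :: real)"
      using AE_torus_box AE_space
    proof eventually_elim
      case (elim x)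
      have "G (cis_vec x) = x"
      proof -
        have "0 \<le> x $ j \<and> x $ j < 2 * pi" for j
          using elim(1) by (auto simp: mem_box_cart less_imp_le)
        then show ?thesis
          by (simp add: G_def cis_vec_def vec_eq_iff Arg2pi_exp_real)
      qed
      moreover have "ge x = g x"
        using elim(2) by (simp add: ge_def space_torus)
      ultimately show ?case
        using elim(2) by (simp add: B_def)
    qed
    have gint: "integrable \<mu> (\<lambda>x. Re (g x))"
      using L2_integrable[OF g(1)] by simp
    have [measurable]: "cis_vec -` B \<inter> space \<mu> \<in> sets \<mu>"
      by (rule measurable_sets[OF measurable_cis_vec B])
    have gint2: "integrable \<mu> (\<lambda>x. indicator (cis_vec -` B \<inter> space \<mu>) x *\<^sub>R g x)"
      by (intro integrable_mult_indicator L2_integrable g) measurable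
    have gint3: "integrable \<mu> (\<lambda>x. max 0 (Re (g x)))"
      by (intro integrable_max gint) simp
    have "Re (LINT x:(cis_vec -` B \<inter> space \<mu>)|\<mu>. g x) =
        (LINT x|\<mu>. Re (indicator (cis_vec -` B \<inter> space \<mu>) x *\<^sub>R g x))"
      unfolding set_lebesgue_integral_def by (rule integral_Re[symmetric, OF gint2])
    also have "\<dots> = (LINT x|\<mu>. max 0 (Re (g x)))"
    proof (rule Bochner_Integration.integral_cong_AE)
      show "AE x in \<mu>. Re (indicator (cis_vec -` B \<inter> space \<mu>) x *\<^sub>R g x) = max 0 (Re (g x))"
        using ind by eventually_elim auto
    qed (rule borel_measurable_integrable, rule integrable_Re[OF gint2],
        rule borel_measurable_integrable, rule gint3)
    finally have "(LINT x|\<mu>. max 0 (Re (g x))) = 0"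
      using integral_vimage_borel_zero[OF g B] by simp
    then have "AE x in \<mu>. max 0 (Re (g x)) = 0"
      by (subst (asm) integral_nonneg_eq_0_iff_AE[OF gint3]) auto
    then show ?thesis
      by eventually_elim auto
  qed
  \<comment> \<open>The one-sided bound for the four rotations of \<open>f\<close> controls both
    signs of its real and imaginary parts.\<close>
  have *: "AE x in \<mu>. Re (c * f x) \<le> 0" for c
    using f by (intro Re_le) (auto simp: fcoeff_scale)
  from *[of 1] *[of "-1"] *[of \<i>] *[of "-\<i>"] show ?thesis
    by eventually_elim (auto simp: complex_eq_iff)
qed

subsection \<open>Fourier series\<close>

definition trig_sum :: "(int^'n \<Rightarrow> complex) \<Rightarrow> (int^'n) set \<Rightarrow> ('n::finite) tfun" where
  "trig_sum c F x = (\<Sum>k\<in>F. c k * chr k x)"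

lemma trig_sum_L2 [simp]: "trig_sum c F \<in> L2"
  unfolding trig_sum_def [abs_def] by (intro L2_sum L2_scale chr_L2)

lemma l2inner_trig_sum_left: "g \<in> L2 \<Longrightarrow> l2inner (trig_sum c F) g = (\<Sum>k\<in>F. c k * cnj (fcoeff g k))"
  unfolding trig_sum_def [abs_def] fcoeff_def
  by (subst l2inner_sum_left) (auto simp: l2inner_scale_left l2inner_commute[of _ g] intro!: L2_scale)

lemma fcoeff_trig_sum: "finite F \<Longrightarrow> fcoeff (trig_sum c F) k = (if k \<in> F then c k else 0)"
  by (simp add: fcoeff_def l2inner_trig_sum_left fcoeff_chr[unfolded fcoeff_def] if_distrib[of cnj] if_distrib[of "(*) _"] cong: if_cong)

lemma l2norm_trig_sum: 
  assumes "finite F" shows "(l2norm (trig_sum c F))\<^sup>2 = (\<Sum>k\<in>F. (cmod (c k))\<^sup>2)"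
proof -
  have "complex_of_real ((l2norm (trig_sum c F))\<^sup>2) = (\<Sum>k\<in>F. c k * cnj (c k))"
    unfolding l2inner_self[symmetric] using assms by (simp add: l2inner_trig_sum_left fcoeff_trig_sum)
  also have "\<dots> = complex_of_real (\<Sum>k\<in>F. (cmod (c k))\<^sup>2)"
    by (simp only: complex_norm_square[symmetric] of_real_sum)
  finally show ?thesis
    using of_real_eq_iff by blast
qed

lemma bessel:
  assumes f: "f \<in> L2" and F: "finite F"
  shows "(\<Sum>k\<in>F. (cmod (fcoeff f k))\<^sup>2) \<le> (l2norm f)\<^sup>2"
proof -
  define s where "s = (\<Sum>k\<in>F. (cmod (fcoeff f k))\<^sup>2)"
  have "l2inner f (trig_sum (fcoeff f) F) = cnj (\<Sum>k\<in>F. fcoeff f k * cnj (fcoeff f k))"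
    using f by (subst l2inner_commute) (simp add: l2inner_trig_sum_left)
  also have "\<dots> = of_real s"
    unfolding s_def by (simp only: complex_norm_square[symmetric] of_real_sum[symmetric] complex_cnj_complex_of_real)
  finally have "(l2norm (\<lambda>x. f x - 1 * trig_sum (fcoeff f) F x))\<^sup>2 = (l2norm f)\<^sup>2 - s"
    using l2norm_sq_diff_scale[OF f trig_sum_L2, of 1 "fcoeff f" F] l2norm_trig_sum[OF F, of "fcoeff f"]
    by (simp add: s_def)
  then show ?thesis
    using zero_le_power2[of "l2norm (\<lambda>x. f x - 1 * trig_sum (fcoeff f) F x)"] by (simp add: s_def)
qed

lemma trig_sum_diff:
  "finite F \<Longrightarrow> G \<subseteq> F \<Longrightarrow> (\<lambda>x. trig_sum c F x - trig_sum c G x) = trig_sum c (F - G)"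
  by (auto simp: trig_sum_def fun_eq_iff sum_diff)

text \<open>The frequencies are enumerated so that Fourier partial sums form a sequence, to which
  completeness for sequences applies.\<close>

definition exhaust :: "nat \<Rightarrow> (int^'n::finite) set" where
  "exhaust N = from_nat ` {..<N}"

lemma finite_exhaust [simp]: "finite (exhaust N)"
  by (simp add: exhaust_def)

lemma exhaust_mono: "M \<le> N \<Longrightarrow> exhaust M \<subseteq> exhaust N"
  by (auto simp: exhaust_def)

lemma mem_exhaust: "\<exists>N. k \<in> exhaust N"
  by (rule exI[of _ "Suc (to_nat k)"]) (auto simp: exhaust_def intro!: image_eqI[of _ _ "to_nat k"])

text \<open>Pythagoras makes the partial sums Cauchy. Their convergence to \<open>g\<close> is
  recorded along with the coefficients because the Fourier series of a given function is later
  recognised as this one.\<close>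

theorem riesz_fischer:
  fixes c :: "int^'n::finite \<Rightarrow> complex"
  assumes bnd: "\<And>F. finite F \<Longrightarrow> (\<Sum>k\<in>F. (cmod (c k))\<^sup>2) \<le> B"
  obtains g where "g \<in> L2" "\<And>k. fcoeff g k = c k"
    "(\<lambda>N. l2norm (\<lambda>x. trig_sum c (exhaust N) x - g x)) \<longlonglongrightarrow> 0"
proof -
  define s where "s N = (\<Sum>k\<in>exhaust N. (cmod (c k))\<^sup>2)" for N
  have "incseq s"
    unfolding incseq_def s_def using exhaust_mono by (auto intro!: sum_mono2)
  moreover have "s N \<le> B" for N
    unfolding s_def by (rule bnd) simp
  ultimately obtain L where L: "s \<longlonglongrightarrow> L"
    using incseq_convergent[of s B] by blast
  then have h: "(\<lambda>N. L - s N) \<longlonglongrightarrow> 0"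
    using tendsto_diff[OF tendsto_const[of L] L] by simp
  have dist: "(l2norm (\<lambda>x. trig_sum c (exhaust M) x - trig_sum c (exhaust N) x))\<^sup>2 \<le> L - s N" if "N \<le> M" for M N
  proof -
    have "(l2norm (\<lambda>x. trig_sum c (exhaust M) x - trig_sum c (exhaust N) x))\<^sup>2 = s M - s N"
      unfolding trig_sum_diff[OF finite_exhaust exhaust_mono[OF that]] s_def
      by (subst l2norm_trig_sum) (simp, rule sum_diff[OF finite_exhaust exhaust_mono[OF that]])
    then show ?thesis
      using incseq_le[OF \<open>incseq s\<close> L, of M] by simp
  qed
  then obtain g where g: "g \<in> L2" "(\<lambda>N. l2norm (\<lambda>x. trig_sum c (exhaust N) x - g x)) \<longlonglongrightarrow> 0"
    using L2_convergentI[of "\<lambda>N. trig_sum c (exhaust N)" "\<lambda>N. L - s N", OF trig_sum_L2 h dist] by blast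
  have "fcoeff g k = c k" for k
  proof -
    obtain N where N: "k \<in> exhaust N"
      using mem_exhaust by blast
    have "cmod (c k - fcoeff g k) \<le> l2norm (\<lambda>x. trig_sum c (exhaust M) x - g x)" if "M \<ge> N" for M
    proof -
      have "c k - fcoeff g k = fcoeff (\<lambda>x. trig_sum c (exhaust M) x - g x) k"
        using N exhaust_mono[OF that] g(1) by (auto simp: fcoeff_diff fcoeff_trig_sum)
      moreover have "(l2norm (chr k))\<^sup>2 = 1"
        by (simp add: l2norm_sq)
      then have "l2norm (chr k) = 1"
        using l2norm_nonneg[of "chr k"] by (simp add: power2_eq_1_iff)
      ultimately show ?thesis
        using l2_cauchy_schwarz[of "\<lambda>x. trig_sum c (exhaust M) x - g x" "chr k"] g(1)
        by (simp add: fcoeff_def L2_diff)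
    qed
    then have "cmod (c k - fcoeff g k) \<le> 0"
      using g(2) by (intro LIMSEQ_le_const) auto
    then show ?thesis by simp
  qed
  with g show ?thesis
    by (intro that)
qed

lemma L2_eqI_fcoeff:
  assumes "f \<in> L2" "g \<in> L2" "\<And>k. fcoeff f k = fcoeff g k"
  shows "AE x in \<mu>. f x = g x"
  using L2_eq_0_if_fcoeff_zero[of "\<lambda>x. f x - g x"] assms by (simp add: fcoeff_diff L2_diff)

text \<open>Riesz-Fischer provides a limit of the partial sums with the same coefficients as
  \<open>f\<close>, and uniqueness of Fourier coefficients identifies that limit with
  \<open>f\<close>.\<close>

theorem trig_sum_tendsto:
  assumes f: "f \<in> L2"
  shows "(\<lambda>N. l2norm (\<lambda>x. trig_sum (fcoeff f) (exhaust N) x - f x)) \<longlonglongrightarrow> 0"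
proof -
  obtain g where g: "g \<in> L2" "\<And>k. fcoeff g k = fcoeff f k"
    "(\<lambda>N. l2norm (\<lambda>x. trig_sum (fcoeff f) (exhaust N) x - g x)) \<longlonglongrightarrow> 0"
    using riesz_fischer[of "fcoeff f"] bessel[OF f] by blast
  have "AE x in \<mu>. f x = g x"
    using f g by (intro L2_eqI_fcoeff) auto
  then have "l2norm (\<lambda>x. trig_sum (fcoeff f) (exhaust N) x - g x) = l2norm (\<lambda>x. trig_sum (fcoeff f) (exhaust N) x - f x)" for N
    using f g(1) by (intro l2norm_cong_AE) auto
  then show ?thesis
    using g(3) by simp
qed

text \<open>The case of Parseval's identity in which every term vanishes; it turns orthogonality of
  subspaces into disjointness of sets of frequencies.\<close>

lemma l2inner_zero_if_fcoeff:
  assumes f: "f \<in> L2" and g: "g \<in> L2" and 0: "\<And>k. fcoeff f k * cnj (fcoeff g k) = 0"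
  shows "l2inner f g = 0"
proof -
  have "cmod (l2inner f g) \<le> l2norm (\<lambda>x. trig_sum (fcoeff f) (exhaust N) x - f x) * l2norm g" for N
  proof -
    have "l2inner (\<lambda>x. trig_sum (fcoeff f) (exhaust N) x - f x) g = - l2inner f g"
      using f g by (simp only: l2inner_diff_left l2inner_trig_sum_left trig_sum_L2 0 sum.neutral_const) simp
    then show ?thesis
      using l2_cauchy_schwarz[of "\<lambda>x. trig_sum (fcoeff f) (exhaust N) x - f x" g] f g by (simp add: L2_diff)
  qed
  moreover have "(\<lambda>N. l2norm (\<lambda>x. trig_sum (fcoeff f) (exhaust N) x - f x) * l2norm g) \<longlonglongrightarrow> 0 * l2norm g"
    by (intro tendsto_intros trig_sum_tendsto f)
  ultimately have "cmod (l2inner f g) \<le> 0 * l2norm g"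
    by (intro LIMSEQ_le_const) auto
  then show ?thesis by simp
qed

subsection \<open>Holomorphic extension\<close>

definition of_nat_vec :: "nat^'n::finite \<Rightarrow> int^'n" where
  "of_nat_vec k = (\<chi> j. int (k $ j))"

definition zpow :: "complex^'n::finite \<Rightarrow> nat^'n \<Rightarrow> complex" where
  "zpow z k = (\<Prod>j\<in>UNIV. (z $ j) ^ (k $ j))"

lemma hext_altdef: "hext f z = (\<Sum>\<^sub>\<infinity>k. fcoeff f (of_nat_vec k) * zpow z k)"
  by (simp add: hext_def of_nat_vec_def zpow_def)

lemma norm_zpow: "cmod (zpow z k) = (\<Prod>j\<in>UNIV. cmod (z $ j) ^ (k $ j))"
  by (simp add: zpow_def prod_norm[symmetric] norm_power)

lemma zpow_add: "zpow z (k + l) = zpow z k * zpow z l"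
  by (simp add: zpow_def power_add prod.distrib)

lemma of_nat_vec_add: "of_nat_vec (k + l) = of_nat_vec k + of_nat_vec l"
  by (simp add: of_nat_vec_def vec_eq_iff)

lemma nonneg_eq_of_nat_vec:
  assumes "\<And>j. k $ j \<ge> 0" shows "\<exists>m. k = of_nat_vec m"
  using assms by (intro exI[of _ "\<chi> j. nat (k $ j)"]) (simp add: of_nat_vec_def vec_eq_iff)

text \<open>A finite set of exponents lies in a cube, and over the cube the sum factors into
  one-variable geometric sums.\<close>

lemma summable_geometric_vec:
  fixes r :: real
  assumes "0 \<le> r" "r < 1"
  shows "(\<lambda>k::nat^'n::finite. \<Prod>j\<in>UNIV. r ^ (k $ j)) summable_on UNIV"
proof (rule nonneg_bdd_above_summable_on)
  show "bdd_above (sum (\<lambda>k::nat^'n. \<Prod>j\<in>UNIV. r ^ (k $ j)) ` {F. F \<subseteq> UNIV \<and> finite F})"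
  proof (rule bdd_aboveI2)
    fix F :: "(nat^'n) set" assume "F \<in> {F. F \<subseteq> UNIV \<and> finite F}"
    then have F: "finite F" by simp
    define N where "N = Suc (\<Sum>k\<in>F. \<Sum>j\<in>UNIV. k $ j)"
    have lt: "k $ j < N" if "k \<in> F" for k j
    proof -
      have "k $ j \<le> (\<Sum>j\<in>UNIV. k $ j)"
        by (rule member_le_sum) auto
      also have "\<dots> \<le> (\<Sum>k\<in>F. \<Sum>j\<in>UNIV. k $ j)"
        using that F by (intro member_le_sum) auto
      finally show ?thesis by (simp add: N_def)
    qed
    have "(\<Sum>k\<in>F. \<Prod>j\<in>UNIV. r ^ (k $ j)) = (\<Sum>g\<in>vec_nth ` F. \<Prod>j\<in>UNIV. r ^ (g j))"
      by (subst sum.reindex) (auto simp: inj_on_def vec_eq_iff fun_eq_iff)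
    also have "\<dots> \<le> (\<Sum>g\<in>PiE (UNIV :: 'n set) (\<lambda>_. {..<N}). \<Prod>j\<in>UNIV. r ^ (g j))"
    proof (rule sum_mono2)
      show "vec_nth ` F \<subseteq> PiE UNIV (\<lambda>_. {..<N})"
        using lt by auto
    qed (use assms(1) in \<open>auto intro!: finite_PiE prod_nonneg\<close>)
    also have "\<dots> = (\<Prod>j\<in>(UNIV :: 'n set). \<Sum>i<N. r ^ i)"
      by (subst prod_sum_PiE) auto
    also have "\<dots> \<le> (\<Prod>j\<in>(UNIV :: 'n set). 1 / (1 - r))"
    proof (rule prod_mono, rule conjI)
      show "0 \<le> (\<Sum>i<N. r ^ i)"
        using assms by (intro sum_nonneg) simp
      show "(\<Sum>i<N. r ^ i) \<le> 1 / (1 - r)"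
        using assms by (auto simp: sum_gp_strict divide_right_mono)
    qed
    finally show "(\<Sum>k\<in>F. \<Prod>j\<in>UNIV. r ^ (k $ j)) \<le> (\<Prod>j\<in>(UNIV :: 'n set). 1 / (1 - r))" .
  qed
qed (use assms in \<open>auto intro!: prod_nonneg\<close>)

lemma polydisc_radius:
  assumes "z \<in> polydisc"
  obtains r where "0 < r" "r < 1" "\<And>j. cmod (z $ j) < r"
proof -
  define m where "m = Max (range (\<lambda>j. cmod (z $ j)))"
  have m: "cmod (z $ j) \<le> m" for j
    unfolding m_def by (rule Max_ge) auto
  have "m \<in> range (\<lambda>j. cmod (z $ j))"
    unfolding m_def by (rule Max_in) auto
  then have "m < 1" "m \<ge> 0"
    using assms by (auto simp: polydisc_def)
  then show ?thesis
    using m by (intro that[of "(m + 1) / 2"] le_less_trans[OF m]) auto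
qed

lemma l2norm_le_bound:
  assumes "f \<in> L2" "AE x in \<mu>. cmod (f x) \<le> e" "e \<ge> 0"
  shows "l2norm f \<le> e"
proof -
  have "(l2norm f)\<^sup>2 \<le> (LINT x|(\<mu> :: (real^'a) measure). e\<^sup>2)"
    unfolding l2norm_sq
    by (rule integral_mono_AE[OF L2_sq_integrable[OF assms(1)]]) (use assms(2) in \<open>auto elim!: eventually_mono intro: power_mono\<close>)
  also have "\<dots> = e\<^sup>2" by simp
  finally show ?thesis
    using assms(3) by (rule power2_le_imp_le)
qed

lemma fcoeff_bound: "f \<in> L2 \<Longrightarrow> cmod (fcoeff f k) \<le> l2norm f"
  using l2_cauchy_schwarz[of f "chr k"] l2norm_le_bound[of "chr k" 1]
    mult_left_mono[of "l2norm (chr k)" 1 "l2norm f"]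
  by (auto simp: fcoeff_def)

lemma tendsto_l2norm_uniform_limit:
  assumes "uniform_limit UNIV G g F" "\<And>n. G n \<in> L2" "g \<in> L2"
  shows "((\<lambda>n. l2norm (\<lambda>x. G n x - g x)) \<longlongrightarrow> 0) F"
proof (rule tendstoI)
  fix e :: real assume e: "e > 0"
  have "\<forall>\<^sub>F n in F. \<forall>x\<in>UNIV. dist (G n x) (g x) < e / 2"
    using assms(1) e by (intro uniform_limitD) auto
  then show "\<forall>\<^sub>F n in F. dist (l2norm (\<lambda>x. G n x - g x)) 0 < e"
  proof eventually_elim
    case (elim n)
    then have "l2norm (\<lambda>x. G n x - g x) \<le> e / 2"
      using assms e by (intro l2norm_le_bound L2_diff) (auto simp: dist_norm less_imp_le)
    then show ?case using e by simp
  qed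
qed

lemma tendsto_l2inner_left:
  assumes lim: "((\<lambda>n. l2norm (\<lambda>x. G n x - g x)) \<longlongrightarrow> 0) F" and L: "\<And>n. G n \<in> L2" "g \<in> L2" "h \<in> L2"
  shows "((\<lambda>n. l2inner (G n) h) \<longlongrightarrow> l2inner g h) F"
proof (rule Lim_transform_bound[where f = "\<lambda>n. l2inner (G n) h - l2inner g h", THEN Lim_null[THEN iffD2]])
  show "\<forall>\<^sub>F n in F. norm (l2inner (G n) h - l2inner g h) \<le> norm (l2norm (\<lambda>x. G n x - g x) * l2norm h)"
    using l2_cauchy_schwarz[OF L2_diff[OF L(1,2)] L(3)] L
    by (intro always_eventually allI) (simp add: l2inner_diff_left)
  show "((\<lambda>n. l2norm (\<lambda>x. G n x - g x) * l2norm h) \<longlongrightarrow> 0) F"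
    using lim by (rule tendsto_mult_left_zero)
qed

lemma tendsto_l2inner_right:
  assumes lim: "((\<lambda>n. l2norm (\<lambda>x. G n x - g x)) \<longlongrightarrow> 0) F" and L: "\<And>n. G n \<in> L2" "g \<in> L2" "h \<in> L2"
  shows "((\<lambda>n. l2inner h (G n)) \<longlongrightarrow> l2inner h g) F"
  using tendsto_cnj[OF tendsto_l2inner_left[OF lim L]] unfolding l2inner_commute[symmetric] .

text \<open>The Szego kernel, the reproducing kernel of the Hardy space: pairing with
  \<open>szego z\<close> is evaluation of \<open>hext\<close> at \<open>z\<close>. This makes
  \<open>hext\<close> linear and L^2-continuous in its function argument.\<close>

definition szego :: "complex^'n \<Rightarrow> ('n::finite) tfun" where
  "szego z x = (\<Sum>\<^sub>\<infinity>k. cnj (zpow z k) * chr (of_nat_vec k) x)"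

lemma szego_uniform_limit:
  assumes "z \<in> polydisc"
  shows "uniform_limit UNIV (\<lambda>F x. \<Sum>k\<in>F. cnj (zpow z k) * chr (of_nat_vec k) x) (szego z) (finite_subsets_at_top UNIV)"
proof -
  obtain r where r: "0 < r" "r < 1" "\<And>j. cmod (z $ j) < r"
    using polydisc_radius[OF assms] by blast
  show ?thesis
    unfolding szego_def [abs_def]
  proof (rule Weierstrass_m_test_general)
    show "(\<lambda>k::nat^'a. \<Prod>j\<in>UNIV. r ^ (k $ j)) summable_on UNIV"
      using r by (intro summable_geometric_vec) auto
    show "norm (cnj (zpow z k) * chr (of_nat_vec k) x) \<le> (\<Prod>j\<in>UNIV. r ^ (k $ j))" for k x
      unfolding norm_mult complex_mod_cnj norm_zpow norm_chr mult_1_right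
      using less_imp_le[OF r(3)] by (intro prod_mono) (auto intro: power_mono)
  qed
qed

lemma szego_L2:
  assumes "z \<in> polydisc"
  shows "szego z \<in> L2"
  by (rule L2_continuous[OF uniform_limit_theorem[OF _ szego_uniform_limit[OF assms]]])
    (auto intro!: always_eventually continuous_intros)

text \<open>The power series is the pairing of \<open>f\<close> with the series of the kernel. That
  series converges uniformly, hence in L^2, so the pairings with its finite sums converge.\<close>

lemma hext_has_sum:
  assumes f: "f \<in> L2" and z: "z \<in> polydisc"
  shows "((\<lambda>k. fcoeff f (of_nat_vec k) * zpow z k) has_sum l2inner f (szego z)) UNIV"
proof -
  let ?G = "\<lambda>F x. \<Sum>k\<in>F. cnj (zpow z k) * chr (of_nat_vec k) x"
  have GL: "?G F \<in> L2" for F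
    by (intro L2_sum L2_scale chr_L2)
  have "((\<lambda>F. l2norm (\<lambda>x. ?G F x - szego z x)) \<longlongrightarrow> 0) (finite_subsets_at_top UNIV)"
    by (rule tendsto_l2norm_uniform_limit[OF szego_uniform_limit[OF z] GL szego_L2[OF z]])
  then have "((\<lambda>F. l2inner f (?G F)) \<longlongrightarrow> l2inner f (szego z)) (finite_subsets_at_top UNIV)"
    by (rule tendsto_l2inner_right[OF _ GL szego_L2[OF z] f])
  moreover have "l2inner f (?G F) = (\<Sum>k\<in>F. fcoeff f (of_nat_vec k) * zpow z k)" for F
    using f by (subst l2inner_commute, subst l2inner_sum_left)
      (auto simp: l2inner_scale_left fcoeff_def l2inner_commute[of "chr _" f] mult_ac intro!: L2_scale)
  ultimately show ?thesis
    unfolding has_sum_def by simp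
qed

lemma hext_eq_inner: "f \<in> L2 \<Longrightarrow> z \<in> polydisc \<Longrightarrow> hext f z = l2inner f (szego z)"
  unfolding hext_altdef by (rule infsumI[OF hext_has_sum])

lemma hext_scale: "f \<in> L2 \<Longrightarrow> z \<in> polydisc \<Longrightarrow> hext (\<lambda>x. c * f x) z = c * hext f z"
  by (simp add: hext_eq_inner L2_scale l2inner_scale_left)

lemma hext_sum:
  "(\<And>i. i \<in> I \<Longrightarrow> f i \<in> L2) \<Longrightarrow> z \<in> polydisc \<Longrightarrow> hext (\<lambda>x. \<Sum>i\<in>I. f i x) z = (\<Sum>i\<in>I. hext (f i) z)"
  by (simp add: hext_eq_inner L2_sum l2inner_sum_left szego_L2)

lemma tendsto_hext:
  "((\<lambda>n. l2norm (\<lambda>x. G n x - g x)) \<longlongrightarrow> 0) F \<Longrightarrow> (\<And>n. G n \<in> L2) \<Longrightarrow> g \<in> L2 \<Longrightarrow> z \<in> polydisc \<Longrightarrow>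
    ((\<lambda>n. hext (G n) z) \<longlongrightarrow> hext g z) F"
  using tendsto_l2inner_left[of G g F "szego z"] by (simp add: hext_eq_inner szego_L2)

text \<open>The Weierstrass test on a closed polydisc of radius below 1, with all coefficients
  bounded by \<open>l2norm f\<close>. Continuity and separate holomorphy of \<open>hext f\<close>
  are read off from it.\<close>

lemma hext_uniform_limit:
  assumes f: "f \<in> L2" and r: "0 \<le> r" "r < 1"
  shows "uniform_limit {z. \<forall>j. cmod (z $ j) \<le> r}
    (\<lambda>F z. \<Sum>k\<in>F. fcoeff f (of_nat_vec k) * zpow z k) (hext f) (finite_subsets_at_top UNIV)"
  unfolding hext_altdef [abs_def]
proof (rule Weierstrass_m_test_general)
  show "(\<lambda>k::nat^'a. l2norm f * (\<Prod>j\<in>UNIV. r ^ (k $ j))) summable_on UNIV"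
    using r by (intro summable_on_cmult_right summable_geometric_vec) auto
  show "norm (fcoeff f (of_nat_vec k) * zpow z k) \<le> l2norm f * (\<Prod>j\<in>UNIV. r ^ (k $ j))"
    if "z \<in> {z. \<forall>j. cmod (z $ j) \<le> r}" for k z
    unfolding norm_mult norm_zpow
    using that by (intro mult_mono fcoeff_bound[OF f] prod_mono) (auto intro!: power_mono prod_nonneg)
qed

lemma continuous_on_zpow [continuous_intros]: "continuous_on S (\<lambda>z. zpow z k)"
  unfolding zpow_def by (intro continuous_intros)

lemma open_polydisc_radius: "open {z :: complex^'n::finite. \<forall>j. cmod (z $ j) < r}"
proof -
  have "{z :: complex^'n. \<forall>j. cmod (z $ j) < r} = (\<Inter>j. {z. cmod (z $ j) < r})"
    by auto
  also have "open \<dots>"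
    by (intro open_INT ballI open_Collect_less continuous_intros) auto
  finally show ?thesis .
qed

lemma continuous_on_hext:
  assumes f: "f \<in> L2"
  shows "continuous_on polydisc (hext f)"
proof (rule continuous_at_imp_continuous_on, rule ballI)
  fix z :: "complex^'a" assume z: "z \<in> polydisc"
  obtain r where r: "0 < r" "r < 1" "\<And>j. cmod (z $ j) < r"
    using polydisc_radius[OF z] by blast
  let ?U = "{z :: complex^'a. \<forall>j. cmod (z $ j) < r}"
  have "uniform_limit ?U (\<lambda>F z. \<Sum>k\<in>F. fcoeff f (of_nat_vec k) * zpow z k) (hext f) (finite_subsets_at_top UNIV)"
    using r by (intro uniform_limit_on_subset[OF hext_uniform_limit[OF f, of r]]) (auto intro: less_imp_le)
  then have "continuous_on ?U (hext f)"
    by (rule uniform_limit_theorem[rotated]) (auto intro!: always_eventually continuous_intros)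
  then show "isCont (hext f) z"
    using r(3) continuous_on_eq_continuous_at[OF open_polydisc_radius] by blast
qed

lemma hext_field_differentiable:
  assumes f: "f \<in> L2" and z: "z \<in> polydisc"
  shows "(\<lambda>w. hext f (\<chi> j. if j = i then w else z $ j)) field_differentiable at (z $ i)"
proof -
  obtain r where r: "0 < r" "r < 1" "\<And>j. cmod (z $ j) < r"
    using polydisc_radius[OF z] by blast
  define e where "e = r - cmod (z $ i)"
  have e: "e > 0" using r by (simp add: e_def)
  let ?h = "\<lambda>w. (\<chi> j. if j = i then w else z $ j)"
  have sub: "?h w \<in> {z. \<forall>j. cmod (z $ j) \<le> r}" if "w \<in> cball (z $ i) e" for w
    using that r norm_triangle_sub[of w "z $ i"] by (auto simp: e_def dist_norm norm_minus_commute less_imp_le)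
  let ?G = "\<lambda>F w. \<Sum>k\<in>F. fcoeff f (of_nat_vec k) * zpow (?h w) k"
  have ul: "uniform_limit (cball (z $ i) e) ?G (\<lambda>w. hext f (?h w)) (finite_subsets_at_top UNIV)"
  proof (rule uniform_limitI)
    fix d :: real assume "d > 0"
    then have "\<forall>\<^sub>F F in finite_subsets_at_top UNIV. \<forall>z\<in>{z. \<forall>j. cmod (z $ j) \<le> r}.
        dist (\<Sum>k\<in>F. fcoeff f (of_nat_vec k) * zpow z k) (hext f z) < d"
      using r by (intro uniform_limitD[OF hext_uniform_limit[OF f]]) auto
    then show "\<forall>\<^sub>F F in finite_subsets_at_top UNIV. \<forall>w\<in>cball (z $ i) e. dist (?G F w) (hext f (?h w)) < d"
      by eventually_elim (use sub in blast)
  qed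
  have hol: "?G F holomorphic_on S" for F S
    unfolding zpow_def
  proof (intro holomorphic_intros)
    show "(\<lambda>w. (\<chi> j. if j = i then w else z $ j) $ j) holomorphic_on S" for j
      by (cases "j = i") (auto intro!: holomorphic_intros)
  qed
  have "(\<lambda>w. hext f (?h w)) holomorphic_on ball (z $ i) e"
  proof (rule holomorphic_uniform_limit[OF _ ul])
    show "\<forall>\<^sub>F F in finite_subsets_at_top UNIV. continuous_on (cball (z $ i) e) (?G F) \<and> ?G F holomorphic_on ball (z $ i) e"
      using hol holomorphic_on_imp_continuous_on by (intro always_eventually) blast
  qed auto
  then show ?thesis
    by (rule holomorphic_on_imp_differentiable_at) (use e in auto)
qed

subsection \<open>Multiplication by bounded functions\<close>

text \<open>One scheme for \<open>H2\<close>, \<open>H2_0\<close> and \<open>Mn\<close>: closedness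
  is proved once, and orthogonality and conjugation become statements about sets of
  frequencies.\<close>

definition spectral :: "(int^'n::finite) set \<Rightarrow> 'n tfun set" where
  "spectral A = {f \<in> L2. \<forall>k. k \<notin> A \<longrightarrow> fcoeff f k = 0}"

lemma H2_eq_spectral: "H2 = spectral {k. \<forall>j. k $ j \<ge> 0}"
  by (simp add: H2_def spectral_def not_le)

lemma H2_0_eq_spectral: "H2_0 = spectral ({k. \<forall>j. k $ j \<ge> 0} - {0})"
  by (auto simp: H2_0_def H2_eq_spectral spectral_def)

lemma Mn_eq_spectral: "Mn = spectral {k. (\<exists>i. k $ i > 0) \<and> (\<exists>j. k $ j < 0)}"
  by (auto simp: Mn_def spectral_def)

lemma spectral_L2: "f \<in> spectral A \<Longrightarrow> f \<in> L2"
  by (simp add: spectral_def)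

lemma spectral_fcoeff: "f \<in> spectral A \<Longrightarrow> k \<notin> A \<Longrightarrow> fcoeff f k = 0"
  by (simp add: spectral_def)

lemma H2_L2: "f \<in> H2 \<Longrightarrow> f \<in> L2"
  by (simp add: H2_def)

lemma H2_fcoeff: "f \<in> H2 \<Longrightarrow> k $ j < 0 \<Longrightarrow> fcoeff f k = 0"
  by (auto simp: H2_def)

lemma l2_closed_subspace_spectral: "l2_closed_subspace (spectral A)"
proof -
  have "spectral A = {f \<in> L2. \<forall>h\<in>chr ` (- A). l2inner f h = 0}"
    by (auto simp: spectral_def fcoeff_def)
  then show ?thesis
    using l2_closed_subspace_orth[of "chr ` (- A)"] by (metis chr_L2 image_subsetI)
qed

lemma l2_closed_subspace_H2: "l2_closed_subspace H2"
  unfolding H2_eq_spectral by (rule l2_closed_subspace_spectral)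

lemma spectral_orthogonal:
  "f \<in> spectral A \<Longrightarrow> g \<in> spectral B \<Longrightarrow> A \<inter> B = {} \<Longrightarrow> l2inner f g = 0"
  by (rule l2inner_zero_if_fcoeff) (auto simp: spectral_def)

lemma spectral_cnj: "(\<lambda>x. cnj (f x)) \<in> spectral A \<longleftrightarrow> f \<in> spectral (uminus ` A)"
proof -
  have "(\<forall>k. k \<notin> A \<longrightarrow> fcoeff f (- k) = 0) \<longleftrightarrow> (\<forall>k. k \<notin> uminus ` A \<longrightarrow> fcoeff f k = 0)"
  proof (intro iffI allI impI)
    fix k assume *: "\<forall>k. k \<notin> A \<longrightarrow> fcoeff f (- k) = 0" "k \<notin> uminus ` A"
    then have "- k \<notin> A"
      using image_eqI[of k uminus "- k" A] by auto
    then show "fcoeff f k = 0"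
      using *(1)[rule_format, of "- k"] by simp
  next
    fix k assume *: "\<forall>k. k \<notin> uminus ` A \<longrightarrow> fcoeff f k = 0" "k \<notin> A"
    then have "- k \<notin> uminus ` A"
      by auto
    then show "fcoeff f (- k) = 0"
      using *(1) by blast
  qed
  then show ?thesis
    by (simp add: spectral_def fcoeff_cnj)
qed

lemma chr_in_H2: "chr (of_nat_vec k) \<in> H2"
  by (auto simp: H2_def fcoeff_chr of_nat_vec_def)

lemma one_in_H2: "(\<lambda>_. 1) \<in> H2"
  by (auto simp: H2_def fcoeff_chr[of 0, simplified])

lemma chr_mult_H2:
  assumes "f \<in> H2"
  shows "(\<lambda>x. chr (of_nat_vec k) x * f x) \<in> H2"
  unfolding H2_def
proof (intro CollectI conjI allI impI)
  show "(\<lambda>x. chr (of_nat_vec k) x * f x) \<in> L2"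
    using assms by (intro chr_mult_L2 H2_L2)
  fix m :: "int^'a" assume "\<exists>j. m $ j < 0"
  then obtain j where "m $ j < 0" by blast
  then have "(m - of_nat_vec k) $ j < 0"
    by (simp add: of_nat_vec_def)
  then show "fcoeff (\<lambda>x. chr (of_nat_vec k) x * f x) m = 0"
    unfolding fcoeff_chr_mult by (rule H2_fcoeff[OF assms])
qed

text \<open>Multiplication by a monomial shifts the coefficients. Indices outside the shifted cone
  contribute nothing because \<open>f\<close> has no frequency with a negative entry.\<close>

lemma hext_chr_mult:
  assumes f: "f \<in> H2" and z: "z \<in> polydisc"
  shows "hext (\<lambda>x. chr (of_nat_vec k) x * f x) z = zpow z k * hext f z"
proof -
  let ?a = "\<lambda>m. fcoeff f (of_nat_vec m - of_nat_vec k) * zpow z m"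
  have "hext (\<lambda>x. chr (of_nat_vec k) x * f x) z = infsum ?a UNIV"
    by (simp add: hext_altdef fcoeff_chr_mult)
  also have "\<dots> = infsum ?a ((\<lambda>m. m + k) ` UNIV)"
  proof (rule infsum_cong_neutral)
    fix m assume m: "m \<in> UNIV - (\<lambda>m. m + k) ` UNIV"
    have "\<exists>j. m $ j < k $ j"
    proof (rule ccontr)
      assume "\<not> ?thesis"
      then have "m = (\<chi> j. m $ j - k $ j) + k"
        by (simp add: vec_eq_iff not_less)
      with m show False by blast
    qed
    then obtain j where "(of_nat_vec m - of_nat_vec k) $ j < 0"
      by (auto simp: of_nat_vec_def)
    then show "?a m = 0"
      using H2_fcoeff[OF f] by simp
  qed auto
  also have "\<dots> = infsum (?a \<circ> (\<lambda>m. m + k)) UNIV"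
    by (rule infsum_reindex) (auto simp: inj_on_def)
  also have "?a \<circ> (\<lambda>m. m + k) = (\<lambda>m. zpow z k * (fcoeff f (of_nat_vec m) * zpow z m))"
    by (auto simp: of_nat_vec_add zpow_add)
  also have "infsum \<dots> UNIV = zpow z k * hext f z"
    unfolding hext_altdef by (rule infsum_cmult_right')
  finally show ?thesis .
qed

lemma hext_one: "hext (\<lambda>_. 1) z = 1"
proof -
  have "hext (\<lambda>_. 1) z = (\<Sum>\<^sub>\<infinity>k\<in>{0}. fcoeff (\<lambda>_. 1) (of_nat_vec k) * zpow z k)"
    unfolding hext_altdef
    by (rule infsum_cong_neutral) (auto simp: fcoeff_chr[of 0, simplified] of_nat_vec_def vec_eq_iff)
  then show ?thesis
    by (simp add: fcoeff_chr[of 0, simplified] of_nat_vec_def zpow_def vec_eq_iff)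
qed

lemma hext_chr: "z \<in> polydisc \<Longrightarrow> hext (chr (of_nat_vec k)) z = zpow z k"
  using hext_chr_mult[OF one_in_H2, of z k] by (simp add: hext_one)

lemma H2_sum: "(\<And>i. i \<in> I \<Longrightarrow> f i \<in> H2) \<Longrightarrow> (\<lambda>x. \<Sum>i\<in>I. f i x) \<in> H2"
proof (induction I rule: infinite_finite_induct)
  case (insert i I)
  then show ?case
    using l2_closed_subspaceD(3)[OF l2_closed_subspace_H2, of "f i" "\<lambda>x. \<Sum>i\<in>I. f i x"] by simp
qed (auto simp: l2_closed_subspaceD(2)[OF l2_closed_subspace_H2])

text \<open>For a monomial factor both claims are shifts of coefficients. The Fourier sums of
  \<open>f\<close> carry them over: multiplication by the bounded \<open>p\<close> is
  L^2-continuous, \<open>H2\<close> is closed, and so is evaluation of \<open>hext\<close> at a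
  point continuous.\<close>

theorem H2_mult_bounded:
  assumes p: "p \<in> H2" "AE x in \<mu>. cmod (p x) \<le> B" and B: "B \<ge> 0" and f: "f \<in> H2"
  shows "(\<lambda>x. p x * f x) \<in> H2" and "z \<in> polydisc \<Longrightarrow> hext (\<lambda>x. p x * f x) z = hext p z * hext f z"
proof -
  note H2S = l2_closed_subspaceD[OF l2_closed_subspace_H2]
  have pm[measurable]: "p \<in> borel_measurable \<mu>"
    using p(1) by (intro L2_measurable H2_L2)
  have monom: "(\<lambda>x. p x * (fcoeff f k * chr k x)) \<in> H2 \<and>
      (\<forall>z\<in>polydisc. hext (\<lambda>x. p x * (fcoeff f k * chr k x)) z = hext p z * hext (\<lambda>x. fcoeff f k * chr k x) z)" for k
  proof (cases "\<exists>j. k $ j < 0")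
    case True
    then have "fcoeff f k = 0"
      using H2_fcoeff[OF f] by blast
    then show ?thesis
      using H2S(2) by (simp add: hext_eq_inner)
  next
    case False
    then obtain m where m: "k = of_nat_vec m"
      using nonneg_eq_of_nat_vec[of k] by (auto simp: not_less)
    have eq: "(\<lambda>x. p x * (fcoeff f k * chr k x)) = (\<lambda>x. fcoeff f k * (chr (of_nat_vec m) x * p x))"
      by (auto simp: m)
    show ?thesis
      unfolding eq using H2S(4)[OF chr_mult_H2[OF p(1)]] p(1)
      by (auto simp: hext_scale chr_mult_H2 H2_L2 hext_chr_mult hext_chr m)
  qed
  let ?S = "\<lambda>N. trig_sum (fcoeff f) (exhaust N)"
  have eqS: "(\<lambda>x. p x * ?S N x) = (\<lambda>x. \<Sum>k\<in>exhaust N. p x * (fcoeff f k * chr k x))" for N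
    by (simp add: trig_sum_def sum_distrib_left)
  have S: "(\<lambda>x. p x * ?S N x) \<in> H2" for N
    unfolding eqS using monom by (intro H2_sum) blast
  have pf: "(\<lambda>x. p x * f x) \<in> L2"
    by (rule L2_mult_bounded[OF H2_L2[OF f] pm p(2)])
  have le: "l2norm (\<lambda>x. p x * ?S N x - p x * f x) \<le> B * l2norm (\<lambda>x. ?S N x - f x)" for N
    using l2norm_mult_le[OF L2_diff[OF trig_sum_L2 H2_L2[OF f]] pm p(2) B]
    by (simp add: right_diff_distrib)
  have lim0: "(\<lambda>N. l2norm (\<lambda>x. ?S N x - f x)) \<longlonglongrightarrow> 0"
    by (rule trig_sum_tendsto[OF H2_L2[OF f]])
  have lim: "(\<lambda>N. l2norm (\<lambda>x. p x * ?S N x - p x * f x)) \<longlonglongrightarrow> 0"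
  proof (rule tendsto_sandwich[OF _ _ tendsto_const])
    show "(\<lambda>N. B * l2norm (\<lambda>x. ?S N x - f x)) \<longlonglongrightarrow> 0"
      using lim0 by (rule tendsto_mult_right_zero)
  qed (use le in auto)
  show "(\<lambda>x. p x * f x) \<in> H2"
    using H2S(6)[OF S pf lim] .
  show "hext (\<lambda>x. p x * f x) z = hext p z * hext f z" if z: "z \<in> polydisc"
  proof (rule LIMSEQ_unique)
    show "(\<lambda>N. hext (\<lambda>x. p x * ?S N x) z) \<longlonglongrightarrow> hext (\<lambda>x. p x * f x) z"
      by (rule tendsto_hext[OF lim H2_L2[OF S] pf z])
    have "hext (\<lambda>x. p x * ?S N x) z = hext p z * hext (?S N) z" for N
    proof -
      have "hext (\<lambda>x. p x * ?S N x) z = (\<Sum>k\<in>exhaust N. hext p z * hext (\<lambda>x. fcoeff f k * chr k x) z)"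
        unfolding eqS using monom z by (subst hext_sum) (auto intro: H2_L2)
      also have "\<dots> = hext p z * hext (?S N) z"
        unfolding trig_sum_def [abs_def] sum_distrib_left[symmetric]
        by (subst hext_sum) (auto simp: z L2_scale)
      finally show ?thesis .
    qed
    then show "(\<lambda>N. hext (\<lambda>x. p x * ?S N x) z) \<longlonglongrightarrow> hext p z * hext f z"
      using tendsto_mult_left[OF tendsto_hext[OF lim0 trig_sum_L2 H2_L2[OF f] z], of "hext p z"] by simp
  qed
qed

text \<open>No Poisson kernel is needed: \<open>hext p z ^ m = hext (p ^ m) z\<close> stays bounded in \<open>m\<close>.\<close>

lemma hext_norm_le_1:
  assumes p: "p \<in> H2" "AE x in \<mu>. cmod (p x) \<le> 1" and z: "z \<in> polydisc"
  shows "cmod (hext p z) \<le> 1"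
proof (rule ccontr)
  assume "\<not> ?thesis"
  then have gt: "cmod (hext p z) > 1" by simp
  have pow: "(\<lambda>x. p x ^ m) \<in> H2 \<and> hext (\<lambda>x. p x ^ m) z = hext p z ^ m" for m
  proof (induction m)
    case 0
    then show ?case by (simp add: one_in_H2 hext_one)
  next
    case (Suc m)
    then have "(\<lambda>x. p x ^ m) \<in> H2" by simp
    then show ?case
      using H2_mult_bounded(1)[OF p zero_le_one] H2_mult_bounded(2)[OF p zero_le_one _ z] Suc by simp
  qed
  have "cmod (hext p z) ^ m \<le> l2norm (szego z)" for m
  proof -
    have pL: "(\<lambda>x. p x ^ m) \<in> L2"
      using pow by (blast intro: H2_L2)
    have "l2norm (\<lambda>x. p x ^ m) \<le> 1"
      using p(2) by (intro l2norm_le_bound pL) (auto elim!: eventually_mono simp: norm_power power_le_one)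
    then have "l2norm (\<lambda>x. p x ^ m) * l2norm (szego z) \<le> 1 * l2norm (szego z)"
      by (intro mult_right_mono) auto
    moreover have "cmod (hext p z) ^ m = cmod (l2inner (\<lambda>x. p x ^ m) (szego z))"
      using pow[of m] hext_eq_inner[OF pL z] by (simp add: norm_power[symmetric])
    ultimately show ?thesis
      using l2_cauchy_schwarz[OF pL szego_L2[OF z]] by simp
  qed
  moreover obtain m where "cmod (hext p z) ^ m > l2norm (szego z)"
    using real_arch_pow[OF gt] by blast
  ultimately show False
    by (simp add: not_less[symmetric])
qed

theorem schur_hext:
  assumes "p \<in> H2" "AE x in \<mu>. cmod (p x) \<le> 1"
  shows "schur (hext p)"
  unfolding schur_def
  using hext_norm_le_1[OF assms] continuous_on_hext[OF H2_L2[OF assms(1)]]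
    hext_field_differentiable[OF H2_L2[OF assms(1)]] by blast

subsection \<open>Dilations\<close>

text \<open>The radii vary independently, so that coordinates can be treated one at a time; the
  value 0 is allowed so that every point of the polydisc has polar coordinates.\<close>

definition radii :: "(real^'n::finite) set" where
  "radii = {r. \<forall>j. 0 \<le> r $ j \<and> r $ j < 1}"

definition polar :: "real^'n::finite \<Rightarrow> real^'n \<Rightarrow> complex^'n" where
  "polar r x = (\<chi> j. of_real (r $ j) * exp (\<i> * of_real (x $ j)))"

definition rpow :: "real^'n::finite \<Rightarrow> nat^'n \<Rightarrow> real" where
  "rpow r k = (\<Prod>j\<in>UNIV. (r $ j) ^ (k $ j))"

definition dil :: "('n::finite) tfun \<Rightarrow> real^'n \<Rightarrow> 'n tfun" where
  "dil f r x = hext f (polar r x)"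

lemma norm_polar_nth: "r \<in> radii \<Longrightarrow> cmod (polar r x $ j) = r $ j"
  by (simp add: polar_def norm_mult radii_def)

lemma polar_polydisc: "r \<in> radii \<Longrightarrow> polar r x \<in> polydisc"
  using norm_polar_nth[of r x] by (simp add: polydisc_def radii_def)

lemma polar_cases:
  assumes "z \<in> polydisc"
  obtains r x where "r \<in> radii" "x \<in> cbox 0 (\<chi> i. 2 * pi)" "z = polar r x"
proof -
  let ?r = "\<chi> j. cmod (z $ j)" and ?x = "\<chi> j. Arg2pi (z $ j)"
  have "?r \<in> radii"
    using assms by (simp add: radii_def polydisc_def)
  moreover have "?x \<in> cbox 0 (\<chi> i. 2 * pi)"
    using Arg2pi_ge_0 Arg2pi_lt_2pi by (simp add: mem_box_cart less_imp_le)
  moreover have "z = polar ?r ?x"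
    using Arg2pi_eq by (simp add: vec_eq_iff polar_def)
  ultimately show ?thesis
    by (rule that)
qed

lemma continuous_on_polar [continuous_intros]: "continuous_on S (polar r)"
  unfolding polar_def by (intro continuous_intros)

lemma zpow_polar: "zpow (polar r x) k = of_real (rpow r k) * chr (of_nat_vec k) x"
proof -
  have "chr (of_nat_vec k) x = (\<Prod>j\<in>UNIV. exp (\<i> * of_real (x $ j)) ^ (k $ j))"
    by (simp add: chr_def of_nat_vec_def exp_sum sum_distrib_left exp_of_nat_mult[symmetric] mult_ac)
  then show ?thesis
    by (simp add: zpow_def polar_def rpow_def power_mult_distrib prod.distrib)
qed

lemma dil_uniform_limit:
  assumes "f \<in> L2" "r \<in> radii"
  shows "uniform_limit UNIV
    (\<lambda>F x. \<Sum>k\<in>F. fcoeff f (of_nat_vec k) * of_real (rpow r k) * chr (of_nat_vec k) x)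
    (dil f r) (finite_subsets_at_top UNIV)"
proof (rule uniform_limitI)
  fix d :: real assume "d > 0"
  obtain q where q: "0 < q" "q < 1" "\<And>j. cmod (polar r 0 $ j) < q"
    using polydisc_radius[OF polar_polydisc[OF assms(2), of 0]] by blast
  then have rq: "r $ j \<le> q" for j
    using norm_polar_nth[OF assms(2), of 0 j] by (metis less_imp_le)
  have "\<forall>\<^sub>F F in finite_subsets_at_top UNIV. \<forall>z\<in>{z. \<forall>j. cmod (z $ j) \<le> q}.
      dist (\<Sum>k\<in>F. fcoeff f (of_nat_vec k) * zpow z k) (hext f z) < d"
    using assms q \<open>d > 0\<close> by (intro uniform_limitD[OF hext_uniform_limit]) auto
  then show "\<forall>\<^sub>F F in finite_subsets_at_top UNIV. \<forall>x\<in>UNIV.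
      dist (\<Sum>k\<in>F. fcoeff f (of_nat_vec k) * of_real (rpow r k) * chr (of_nat_vec k) x) (dil f r x) < d"
  proof eventually_elim
    case (elim F)
    show ?case
    proof
      fix x :: "real^'a"
      have "polar r x \<in> {z. \<forall>j. cmod (z $ j) \<le> q}"
        using rq by (simp add: norm_polar_nth[OF assms(2)])
      from elim[rule_format, OF this] show "dist (\<Sum>k\<in>F. fcoeff f (of_nat_vec k) * of_real (rpow r k) * chr (of_nat_vec k) x) (dil f r x) < d"
        by (simp add: zpow_polar dil_def mult.assoc)
    qed
  qed
qed

lemma continuous_on_dil:
  assumes "f \<in> L2" "r \<in> radii"
  shows "continuous_on UNIV (dil f r)"
  by (rule uniform_limit_theorem[OF _ dil_uniform_limit[OF assms]])
    (auto intro!: always_eventually continuous_intros)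

lemma dil_L2: "f \<in> L2 \<Longrightarrow> r \<in> radii \<Longrightarrow> dil f r \<in> L2"
  by (rule L2_continuous[OF continuous_on_dil])

lemma dil_tendsto:
  assumes "f \<in> L2" "r \<in> radii"
  shows "((\<lambda>F. l2norm (\<lambda>x. (\<Sum>k\<in>F. fcoeff f (of_nat_vec k) * of_real (rpow r k) * chr (of_nat_vec k) x) - dil f r x)) \<longlongrightarrow> 0)
    (finite_subsets_at_top UNIV)"
  using assms by (intro tendsto_l2norm_uniform_limit dil_uniform_limit dil_L2 L2_sum L2_scale chr_L2)

lemma l2inner_dil:
  assumes f: "f \<in> L2" "r \<in> radii" and g: "g \<in> L2"
  shows "((\<lambda>k. fcoeff f (of_nat_vec k) * of_real (rpow r k) * cnj (fcoeff g (of_nat_vec k)))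
    has_sum l2inner (dil f r) g) UNIV"
proof -
  have "((\<lambda>F. l2inner (\<lambda>x. \<Sum>k\<in>F. fcoeff f (of_nat_vec k) * of_real (rpow r k) * chr (of_nat_vec k) x) g)
      \<longlongrightarrow> l2inner (dil f r) g) (finite_subsets_at_top UNIV)"
    by (rule tendsto_l2inner_left[OF dil_tendsto[OF f] _ dil_L2[OF f] g]) (intro L2_sum L2_scale chr_L2)
  moreover have "l2inner (\<lambda>x. \<Sum>k\<in>F. fcoeff f (of_nat_vec k) * of_real (rpow r k) * chr (of_nat_vec k) x) g
      = (\<Sum>k\<in>F. fcoeff f (of_nat_vec k) * of_real (rpow r k) * cnj (fcoeff g (of_nat_vec k)))" for F
    using g by (subst l2inner_sum_left)
      (auto simp: l2inner_scale_left fcoeff_def l2inner_commute[of "chr _" g] intro!: L2_scale)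
  ultimately show ?thesis
    unfolding has_sum_def by simp
qed

lemma inj_of_nat_vec: "of_nat_vec k = of_nat_vec l \<longleftrightarrow> k = l"
  by (simp add: of_nat_vec_def vec_eq_iff)

lemma fcoeff_dil:
  assumes f: "f \<in> L2" "r \<in> radii"
  shows "fcoeff (dil f r) (of_nat_vec k) = fcoeff f (of_nat_vec k) * of_real (rpow r k)"
proof -
  have "((\<lambda>m. fcoeff f (of_nat_vec m) * of_real (rpow r m) * cnj (fcoeff (chr (of_nat_vec k)) (of_nat_vec m)))
    has_sum l2inner (dil f r) (chr (of_nat_vec k))) UNIV"
    by (rule l2inner_dil[OF f chr_L2])
  moreover have "((\<lambda>m. fcoeff f (of_nat_vec m) * of_real (rpow r m) * cnj (fcoeff (chr (of_nat_vec k)) (of_nat_vec m)))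
    has_sum (\<Sum>m\<in>{k}. fcoeff f (of_nat_vec m) * of_real (rpow r m) * cnj (fcoeff (chr (of_nat_vec k)) (of_nat_vec m)))) UNIV"
    by (rule has_sum_finite_neutralI[where B = "{k}"]) (auto simp: fcoeff_chr inj_of_nat_vec)
  ultimately have "l2inner (dil f r) (chr (of_nat_vec k)) =
    (\<Sum>m\<in>{k}. fcoeff f (of_nat_vec m) * of_real (rpow r m) * cnj (fcoeff (chr (of_nat_vec k)) (of_nat_vec m)))"
    by (rule has_sum_unique)
  then show ?thesis
    by (simp add: fcoeff_chr fcoeff_def[symmetric])
qed

lemma fcoeff_dil_neg:
  assumes f: "f \<in> L2" "r \<in> radii" and k: "k $ j < 0"
  shows "fcoeff (dil f r) k = 0"
proof -
  have sum: "((\<lambda>m. fcoeff f (of_nat_vec m) * of_real (rpow r m) * cnj (fcoeff (chr k) (of_nat_vec m)))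
    has_sum l2inner (dil f r) (chr k)) UNIV"
    by (rule l2inner_dil[OF f chr_L2])
  have "fcoeff (chr k) (of_nat_vec m) = 0" for m
    using k by (auto simp: fcoeff_chr of_nat_vec_def)
  then have "l2inner (dil f r) (chr k) = 0"
    by (intro has_sum_unique[OF sum has_sum_0]) simp
  then show ?thesis
    by (simp add: fcoeff_def)
qed

text \<open>A single dilation with all radii 1/2 suffices: its coefficients are those of the
  function times nonzero weights, so the values in the polydisc determine every coefficient.\<close>

lemma H2_eqI_hext:
  assumes f: "f \<in> H2" and g: "g \<in> H2" and eq: "\<And>z. z \<in> polydisc \<Longrightarrow> hext f z = hext g z"
  shows "AE x in \<mu>. f x = g x"
proof (rule L2_eqI_fcoeff)
  define h :: "real^'a" where "h = (\<chi> j. 1/2)"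
  have h: "h \<in> radii" "rpow h m \<noteq> 0" for m
    by (auto simp: h_def radii_def rpow_def)
  have "dil f h = dil g h"
    using eq polar_polydisc[OF h(1)] by (auto simp: dil_def fun_eq_iff)
  then have *: "fcoeff f (of_nat_vec m) = fcoeff g (of_nat_vec m)" for m
    using fcoeff_dil[OF H2_L2[OF f] h(1), of m] fcoeff_dil[OF H2_L2[OF g] h(1), of m] h(2) by simp
  show "fcoeff f k = fcoeff g k" for k
  proof (cases "\<exists>j. k $ j < 0")
    case True
    then show ?thesis
      using H2_fcoeff[OF f] H2_fcoeff[OF g] by metis
  next
    case False
    then show ?thesis
      using * nonneg_eq_of_nat_vec[of k] by (auto simp: not_less)
  qed
qed (use f g in \<open>auto intro: H2_L2\<close>)

subsection \<open>Boundary functions of the Schur class\<close>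

text \<open>Termwise integration of the Taylor series on the circle of radius \<open>r\<close>.
  Orthogonality of exponentials leaves the term with index \<open>m\<close>, and no term when
  \<open>m\<close> is negative.\<close>

lemma circle_coeff:
  assumes h: "h holomorphic_on ball 0 1" and r: "0 \<le> r" "r < 1"
  shows "(LINT t|lborel. unif t * (h (of_real r * exp (\<i> * of_real t)) * exp (- (\<i> * of_real (of_int m * t))))) =
    (if m < 0 then 0 else (deriv ^^ nat m) h 0 / fact (nat m) * of_real r ^ nat m)"
proof -
  define a where "a n = (deriv ^^ n) h 0 / fact n" for n
  define f where "f n t = (a n * of_real r ^ n) * (unif t * exp (\<i> * of_real (of_int (int n - m) * t)))" for n t
  have ps: "(\<lambda>n. a n * w ^ n) sums h w" if "cmod w < 1" for w
    using holomorphic_power_series[OF h, of w] that by (simp add: a_def)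
  \<comment> \<open>Convergence at the larger radius \<open>(1 + r) / 2\<close> gives absolute
    convergence at \<open>r\<close>.\<close>
  have sa: "summable (\<lambda>n. cmod (a n * of_real r ^ n))"
  proof (rule powser_insidea)
    show "summable (\<lambda>n. a n * of_real ((1 + r) / 2) ^ n)"
      using r by (intro sums_summable[OF ps]) (simp only: norm_of_real, simp)
    show "norm (complex_of_real r) < norm (complex_of_real ((1 + r) / 2))"
      using r by (simp only: norm_of_real) simp
  qed
  have int: "integrable lborel (f n)" for n
    unfolding f_def by (intro integrable_mult_right integrable_unif_mult continuous_intros)
  have norm_f: "cmod (f n t) = cmod (a n * of_real r ^ n) * (indicator {0..2*pi} t / (2*pi))" for n t
    unfolding f_def norm_mult norm_exp_i_times norm_of_real by simp
  have fsum: "(\<lambda>n. f n t) sums (unif t * (h (of_real r * exp (\<i> * of_real t)) * exp (- (\<i> * of_real (of_int m * t)))))" for t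
  proof -
    have "cmod (of_real r * exp (\<i> * of_real t)) < 1"
      using r by (simp add: norm_mult)
    from sums_mult[OF sums_mult2[OF ps[OF this], of "exp (- (\<i> * of_real (of_int m * t)))"], of "unif t"]
    have "(\<lambda>n. unif t * (a n * (of_real r * exp (\<i> * of_real t)) ^ n * exp (- (\<i> * of_real (of_int m * t))))) sums
      (unif t * (h (of_real r * exp (\<i> * of_real t)) * exp (- (\<i> * of_real (of_int m * t)))))" .
    moreover have "unif t * (a n * (of_real r * exp (\<i> * of_real t)) ^ n * exp (- (\<i> * of_real (of_int m * t)))) = f n t" for n
      unfolding f_def by (simp add: power_mult_distrib exp_of_nat_mult[symmetric] exp_add[symmetric] exp_diff exp_minus field_simps ring_distribs)
    ultimately show ?thesis by simp
  qed
  have "(\<lambda>n. integral\<^sup>L lborel (f n)) sums (LINT t|lborel. (\<Sum>n. f n t))"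
  proof (rule sums_integral[OF int])
    show "AE t in lborel. summable (\<lambda>n. norm (f n t))"
      unfolding norm_f using sa by (intro AE_I2 summable_mult2)
    have "(LINT t|lborel. norm (f n t)) = cmod (a n * of_real r ^ n)" for n
      unfolding norm_f by simp
    then show "summable (\<lambda>n. LINT t|lborel. norm (f n t))"
      using sa by simp
  qed
  moreover have "(\<Sum>n. f n t) = unif t * (h (of_real r * exp (\<i> * of_real t)) * exp (- (\<i> * of_real (of_int m * t))))" for t
    using sums_unique[OF fsum, of t] by (rule sym)
  moreover have "integral\<^sup>L lborel (f n) = a n * of_real r ^ n * (if int n - m = 0 then 1 else 0)" for n
    unfolding f_def integral_mult_right_zero integral_exp_period ..
  ultimately have "(\<lambda>n. a n * of_real r ^ n * (if int n - m = 0 then 1 else 0)) sums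
      (LINT t|lborel. unif t * (h (of_real r * exp (\<i> * of_real t)) * exp (- (\<i> * of_real (of_int m * t)))))"
    by simp
  moreover have "(\<lambda>n. a n * of_real r ^ n * (if int n - m = 0 then 1 else 0)) sums
      (if m < 0 then 0 else a (nat m) * of_real r ^ nat m)"
  proof (cases "m < 0")
    case True
    then have "(\<lambda>n. a n * of_real r ^ n * (if int n - m = 0 then 1 else 0)) = (\<lambda>n. 0)"
      by auto
    then show ?thesis
      using True by simp
  next
    case False
    have "(\<lambda>n. a n * of_real r ^ n * (if int n - m = 0 then 1 else 0)) sums
        (\<Sum>n\<in>{nat m}. a n * of_real r ^ n * (if int n - m = 0 then 1 else 0))"
      using False by (intro sums_finite) auto
    then show ?thesis
      using False by simp
  qed
  ultimately show ?thesis
    unfolding a_def by (rule sums_unique2)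
qed

section \<open>Slicing the torus in one coordinate\<close>

lemma integrable_PiM_torus:
  fixes g :: "real^'n::finite \<Rightarrow> complex"
  assumes g: "g \<in> borel_measurable borel" and B: "\<And>x. cmod (g x) \<le> B"
  shows "integrable (PiM UNIV (\<lambda>_::'n. lborel)) (\<lambda>\<omega>. (\<Prod>i\<in>UNIV. unif (\<omega> i)) * g (\<chi> i. \<omega> i))"
proof -
  interpret product_sigma_finite "\<lambda>_::'n. lborel :: real measure" ..
  have int: "integrable (PiM UNIV (\<lambda>_::'n. lborel)) (\<lambda>\<omega>. \<Prod>i\<in>UNIV. unif (\<omega> i))"
    using integrable_unif_mult[of "\<lambda>_. 1"] by (intro product_integrable_prod) auto
  show ?thesis
  proof (rule Bochner_Integration.integrable_bound)
    show "integrable (PiM UNIV (\<lambda>_::'n. lborel)) (\<lambda>\<omega>. (\<Prod>i\<in>UNIV. unif (\<omega> i)) * of_real B)"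
      using int by (rule integrable_mult_left)
    show "(\<lambda>\<omega>. (\<Prod>i\<in>UNIV. unif (\<omega> i)) * g (\<chi> i. \<omega> i)) \<in> borel_measurable (PiM UNIV (\<lambda>_::'n. lborel))"
      by (intro borel_measurable_times borel_measurable_integrable[OF int]
          measurable_compose[OF measurable_vec_lambda_PiM g])
    show "AE \<omega> in PiM UNIV (\<lambda>_::'n. lborel). norm ((\<Prod>i\<in>UNIV. unif (\<omega> i)) * g (\<chi> i. \<omega> i))
        \<le> norm ((\<Prod>i\<in>UNIV. unif (\<omega> i)) * of_real B)"
      unfolding norm_mult norm_of_real
      by (intro AE_I2 mult_left_mono order_trans[OF B abs_ge_self]) auto
  qed
qed

text \<open>Fubini with coordinate \<open>j\<close> integrated innermost, so that holomorphy in that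
  variable alone can be used on a circle.\<close>

lemma integral_torus_coordinate:
  fixes g :: "real^'n::finite \<Rightarrow> complex"
  assumes g: "g \<in> borel_measurable borel" and B: "\<And>x. cmod (g x) \<le> B"
  shows "integral\<^sup>L \<mu> g = (LINT x|PiM (UNIV - {j}) (\<lambda>_::'n. lborel).
    (\<Prod>i\<in>UNIV - {j}. unif (x i)) * (LINT y|lborel. unif y * g (\<chi> i. if i = j then y else x i)))"
proof -
  interpret product_sigma_finite "\<lambda>_::'n. lborel :: real measure" ..
  have U: "UNIV = insert j (UNIV - {j})" by auto
  let ?G = "\<lambda>\<omega>. (\<Prod>i\<in>UNIV. unif (\<omega> i)) * g (\<chi> i. \<omega> i)"
  have "integral\<^sup>L \<mu> g = integral\<^sup>L (PiM (insert j (UNIV - {j})) (\<lambda>_::'n. lborel)) ?G"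
    unfolding integral_torus_PiM[OF g] U[symmetric] ..
  also have "\<dots> = (LINT x|PiM (UNIV - {j}) (\<lambda>_::'n. lborel). (LINT y|lborel. ?G (x(j := y))))"
    by (rule product_integral_insert) (use integrable_PiM_torus[OF g B] U[symmetric] in auto)
  also have "\<dots> = (LINT x|PiM (UNIV - {j}) (\<lambda>_::'n. lborel).
    (\<Prod>i\<in>UNIV - {j}. unif (x i)) * (LINT y|lborel. unif y * g (\<chi> i. if i = j then y else x i)))"
  proof (rule Bochner_Integration.integral_cong[OF refl])
    fix x :: "'n \<Rightarrow> real"
    have "?G (x(j := y)) = (\<Prod>i\<in>UNIV - {j}. unif (x i)) * (unif y * g (\<chi> i. if i = j then y else x i))" for y
    proof -
      have "(\<Prod>i\<in>UNIV. unif ((x(j := y)) i)) = unif y * (\<Prod>i\<in>UNIV - {j}. unif ((x(j := y)) i))"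
        by (subst prod.remove[of UNIV j]) auto
      also have "(\<Prod>i\<in>UNIV - {j}. unif ((x(j := y)) i)) = (\<Prod>i\<in>UNIV - {j}. unif (x i))"
        by (rule prod.cong) auto
      finally show ?thesis
        by (simp add: fun_upd_def mult_ac)
    qed
    then show "(LINT y|lborel. ?G (x(j := y))) =
        (\<Prod>i\<in>UNIV - {j}. unif (x i)) * (LINT y|lborel. unif y * g (\<chi> i. if i = j then y else x i))"
      by (simp only: integral_mult_right_zero)
  qed
  finally show ?thesis .
qed

lemma schur_polar_continuous:
  assumes "schur \<phi>" "r \<in> radii"
  shows "continuous_on UNIV (\<lambda>x. \<phi> (polar r x))"
proof (rule continuous_on_compose2[OF _ continuous_on_polar])
  show "continuous_on polydisc \<phi>"
    using assms(1) unfolding schur_def by blast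
qed (use polar_polydisc[OF assms(2)] in blast)

lemma schur_polar_le: "schur \<phi> \<Longrightarrow> r \<in> radii \<Longrightarrow> cmod (\<phi> (polar r x)) \<le> 1"
  using polar_polydisc unfolding schur_def by blast

text \<open>Only the radius in coordinate \<open>j\<close> moves. The inner integral is a Taylor
  coefficient times a power of \<open>s\<close>, and this power is the whole dependence on
  \<open>s\<close>; \<open>D\<close> collects the integral over the remaining angles.\<close>

lemma fcoeff_schur_polar_coordinate:
  fixes \<phi> :: "complex^'n::finite \<Rightarrow> complex" and j :: 'n
  assumes \<phi>: "schur \<phi>" and r: "r \<in> radii"
  shows "\<exists>D. \<forall>s. 0 \<le> s \<longrightarrow> s < 1 \<longrightarrow>
    fcoeff (\<lambda>x. \<phi> (polar (\<chi> i. if i = j then s else r $ i) x)) k = (if k $ j < 0 then 0 else D * of_real s ^ nat (k $ j))"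
proof -
  define h where "h x w = \<phi> (\<chi> i. if i = j then w else of_real (r $ i) * exp (\<i> * of_real (x i)))" for x :: "'n \<Rightarrow> real" and w
  define E where "E x = (\<Prod>i\<in>UNIV - {j}. exp (- (\<i> * of_real (of_int (k $ i) * x i))))" for x :: "'n \<Rightarrow> real"
  define D where "D = (LINT x|PiM (UNIV - {j}) (\<lambda>_::'n. lborel).
    (\<Prod>i\<in>UNIV - {j}. unif (x i)) * (E x * ((deriv ^^ nat (k $ j)) (h x) 0 / fact (nat (k $ j)))))"
  have h: "h x holomorphic_on ball 0 1" for x
    unfolding holomorphic_on_def
  proof
    fix w :: complex assume w: "w \<in> ball 0 1"
    let ?z = "\<chi> i. if i = j then w else of_real (r $ i) * exp (\<i> * of_real (x i))"
    have "?z \<in> polydisc"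
      using w r by (auto simp: polydisc_def norm_mult radii_def)
    then have "(\<lambda>w. \<phi> (\<chi> i. if i = j then w else ?z $ i)) field_differentiable at (?z $ j)"
      using \<phi> unfolding schur_def by blast
    moreover have "(\<lambda>w. \<phi> (\<chi> i. if i = j then w else ?z $ i)) = h x"
      by (auto simp: h_def fun_eq_iff intro!: arg_cong[where f = \<phi>])
    ultimately show "h x field_differentiable at w within ball 0 1"
      by (simp add: field_differentiable_at_within)
  qed
  have "fcoeff (\<lambda>x. \<phi> (polar (\<chi> i. if i = j then s else r $ i) x)) k = (if k $ j < 0 then 0 else D * of_real s ^ nat (k $ j))"
    if s: "0 \<le> s" "s < 1" for s
  proof -
    let ?r = "\<chi> i. if i = j then s else r $ i"
    have r': "?r \<in> radii"
      using r s by (auto simp: radii_def)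
    let ?g = "\<lambda>x. \<phi> (polar ?r x) * cnj (chr k x)"
    have "continuous_on UNIV ?g"
      by (intro continuous_intros schur_polar_continuous[OF \<phi> r'])
    then have gm: "?g \<in> borel_measurable borel"
      by (rule borel_measurable_continuous_onI)
    have g1: "cmod (?g x) \<le> 1" for x
      using schur_polar_le[OF \<phi> r'] by (simp add: norm_mult)
    have "?g (\<chi> i. if i = j then y else x i) =
        E x * (h x (of_real s * exp (\<i> * of_real y)) * exp (- (\<i> * of_real (of_int (k $ j) * y))))" for x y
    proof -
      have "cnj (chr k (\<chi> i. if i = j then y else x i)) =
          (\<Prod>i\<in>UNIV. exp (- (\<i> * of_real (of_int (k $ i) * (if i = j then y else x i)))))"
        by (simp add: chr_def exp_cnj exp_sum sum_distrib_left sum_negf[symmetric])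
      also have "\<dots> = exp (- (\<i> * of_real (of_int (k $ j) * y))) *
          (\<Prod>i\<in>UNIV - {j}. exp (- (\<i> * of_real (of_int (k $ i) * (if i = j then y else x i)))))"
        by (subst prod.remove[of UNIV j]) auto
      also have "(\<Prod>i\<in>UNIV - {j}. exp (- (\<i> * of_real (of_int (k $ i) * (if i = j then y else x i))))) = E x"
        unfolding E_def by (rule prod.cong) auto
      finally have "cnj (chr k (\<chi> i. if i = j then y else x i)) = exp (- (\<i> * of_real (of_int (k $ j) * y))) * E x" .
      moreover have "polar ?r (\<chi> i. if i = j then y else x i) =
          (\<chi> i. if i = j then of_real s * exp (\<i> * of_real y) else of_real (r $ i) * exp (\<i> * of_real (x i)))"
        by (auto simp: polar_def vec_eq_iff)
      ultimately show ?thesis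
        by (simp add: h_def mult_ac)
    qed
    then have eq: "(LINT y|lborel. unif y * ?g (\<chi> i. if i = j then y else x i)) =
        E x * (LINT y|lborel. unif y * (h x (of_real s * exp (\<i> * of_real y)) * exp (- (\<i> * of_real (of_int (k $ j) * y)))))" for x
      unfolding integral_mult_right_zero[symmetric] by (intro Bochner_Integration.integral_cong[OF refl]) (simp only: mult_ac)
    have "fcoeff (\<lambda>x. \<phi> (polar ?r x)) k = integral\<^sup>L \<mu> ?g"
      by (simp add: fcoeff_def l2inner_def)
    also have "\<dots> = (LINT x|PiM (UNIV - {j}) (\<lambda>_::'n. lborel). (\<Prod>i\<in>UNIV - {j}. unif (x i)) *
        (E x * (if k $ j < 0 then 0 else (deriv ^^ nat (k $ j)) (h x) 0 / fact (nat (k $ j)) * of_real s ^ nat (k $ j))))"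
      unfolding integral_torus_coordinate[OF gm g1, of j] eq circle_coeff[OF h s] ..
    \<comment> \<open>The power of \<open>s\<close> leaves the outer integral by a rule valid for
      every integrand, which bypasses the question how the Taylor coefficient depends on the other
      angles.\<close>
    also have "\<dots> = (if k $ j < 0 then 0 else D * of_real s ^ nat (k $ j))"
      unfolding D_def by (simp add: mult.assoc flip: integral_mult_left_zero)
    finally show ?thesis .
  qed
  then show ?thesis
    by blast
qed

lemma fcoeff_schur_polar_neg:
  assumes \<phi>: "schur \<phi>" and r: "r \<in> radii" and k: "k $ j < 0"
  shows "fcoeff (\<lambda>x. \<phi> (polar r x)) k = 0"
proof -
  obtain D where D: "\<And>s. 0 \<le> s \<Longrightarrow> s < 1 \<Longrightarrow>
    fcoeff (\<lambda>x. \<phi> (polar (\<chi> i. if i = j then s else r $ i) x)) k = (if k $ j < 0 then 0 else D * of_real s ^ nat (k $ j))"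
    using fcoeff_schur_polar_coordinate[OF \<phi> r, of j k] by (elim exE) blast
  have "(\<chi> i. if i = j then r $ j else r $ i) = r"
    by (auto simp: vec_eq_iff)
  then show ?thesis
    using D[of "r $ j"] r k by (simp add: radii_def)
qed

text \<open>The coordinates pass from radius 1/2 to their radius in \<open>r\<close> one after
  another, each contributing its own power. A nonzero reference radius permits solving for the
  constant; the powers of 2 come from this.\<close>

lemma fcoeff_schur_polar:
  fixes \<phi> :: "complex^'n::finite \<Rightarrow> complex"
  assumes \<phi>: "schur \<phi>" and r: "r \<in> radii"
  shows "fcoeff (\<lambda>x. \<phi> (polar r x)) (of_nat_vec m) =
    fcoeff (\<lambda>x. \<phi> (polar (\<chi> i. 1/2) x)) (of_nat_vec m) * of_real (\<Prod>i\<in>UNIV. 2 ^ (m $ i)) * of_real (rpow r m)"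
proof -
  \<comment> \<open>\<open>S\<close> is the set of coordinates that have already been moved.\<close>
  have "fcoeff (\<lambda>x. \<phi> (polar (\<chi> i. if i \<in> S then r $ i else 1/2) x)) (of_nat_vec m) =
      fcoeff (\<lambda>x. \<phi> (polar (\<chi> i. 1/2) x)) (of_nat_vec m) * (\<Prod>i\<in>S. of_real (2 * r $ i) ^ (m $ i))"
    if "finite S" for S
    using that
  proof (induction S)
    case (insert j S)
    let ?q = "\<chi> i. if i \<in> S then r $ i else 1/2"
    have q: "?q \<in> radii"
      using r by (auto simp: radii_def)
    obtain D where D: "\<And>s. 0 \<le> s \<Longrightarrow> s < 1 \<Longrightarrow>
        fcoeff (\<lambda>x. \<phi> (polar (\<chi> i. if i = j then s else ?q $ i) x)) (of_nat_vec m) =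
        (if of_nat_vec m $ j < 0 then 0 else D * of_real s ^ nat (of_nat_vec m $ j))"
      using fcoeff_schur_polar_coordinate[OF \<phi> q, of j "of_nat_vec m"] by (elim exE) blast
    have e1: "(\<chi> i. if i = j then r $ j else ?q $ i) = (\<chi> i. if i \<in> insert j S then r $ i else 1/2)"
      by (auto simp: vec_eq_iff)
    have e2: "(\<chi> i. if i = j then 1/2 else ?q $ i) = ?q"
      using insert.hyps by (auto simp: vec_eq_iff)
    have 1: "fcoeff (\<lambda>x. \<phi> (polar (\<chi> i. if i \<in> insert j S then r $ i else 1/2) x)) (of_nat_vec m) = D * of_real (r $ j) ^ (m $ j)"
      using D[of "r $ j"] r unfolding e1 by (simp add: radii_def of_nat_vec_def)
    have "fcoeff (\<lambda>x. \<phi> (polar ?q x)) (of_nat_vec m) = D * (1/2) ^ (m $ j)"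
      using D[of "1/2"] unfolding e2 by (simp add: of_nat_vec_def)
    then have "D = fcoeff (\<lambda>x. \<phi> (polar ?q x)) (of_nat_vec m) * 2 ^ (m $ j)"
      by (simp add: power_divide)
    with 1 insert show ?case
      by (simp add: power_mult_distrib mult_ac)
  qed simp
  from this[of UNIV] show ?thesis
    by (simp add: rpow_def power_mult_distrib prod.distrib mult_ac)
qed

text \<open>The continuous function \<open>cmod (f x - g x)\<close> has integral zero over the cube,
  so it vanishes at each point, faces included. Pointwise values matter since \<open>\<phi>\<close>
  has to be recovered at every point of the polydisc.\<close>

lemma continuous_AE_torus_eq:
  fixes f g :: "'n::finite tfun"
  assumes "continuous_on UNIV f" "continuous_on UNIV g" "AE x in \<mu>. f x = g x" "x \<in> cbox 0 (\<chi> i. 2 * pi)"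
  shows "f x = g x"
proof -
  let ?C = "cbox 0 (\<chi> i. 2 * pi) :: (real^'n) set"
  have "AE x in restrict_space lborel ?C. 0 < ennreal (1 / (2 * pi) ^ CARD('n)) \<longrightarrow> f x = g x"
    using assms(3) unfolding torus_measure_def
    by (rule AE_density[THEN iffD1, rotated]) (rule measurable_const, simp)
  then have "AE x in restrict_space lborel ?C. f x = g x"
    by (rule eventually_mono) (simp add: ennreal_zero_less_divide)
  then have "AE x in lborel. x \<in> ?C \<longrightarrow> f x = g x"
    by (subst (asm) AE_restrict_space_iff) auto
  then obtain N where N: "{x \<in> space lborel. \<not> (x \<in> ?C \<longrightarrow> f x = g x)} \<subseteq> N" "emeasure lborel N = 0" "N \<in> sets lborel"
    by (rule AE_E)
  then have "negligible N"
    by (simp add: negligible_iff_null_sets null_sets_completionI null_setsI)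
  then have "((\<lambda>x. cmod (f x - g x)) has_integral 0) ?C"
    by (rule has_integral_negligible) (use N(1) in auto)
  then have "cmod (f x - g x) = 0"
    using assms
    by (intro has_integral_0_cbox_imp_0[where f = "\<lambda>x. cmod (f x - g x)"])
       (auto intro!: continuous_intros intro: continuous_on_subset simp: interval_ne_empty_cart)
  then show ?thesis by simp
qed

text \<open>The Taylor coefficients of \<open>\<phi>\<close> are square summable: Bessel's
  inequality on the torus of radius \<open>r\<close> has bound 1, and \<open>r\<close> tends to 1.
  Riesz-Fischer gives \<open>p\<close>, and comparing coefficients on each smaller torus identifies
  \<open>hext p\<close> with \<open>\<phi>\<close>.\<close>

theorem schur_boundary_function:
  fixes \<phi> :: "complex^'n::finite \<Rightarrow> complex"
  assumes \<phi>: "schur \<phi>"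
  obtains p where "p \<in> H2" "\<And>z. z \<in> polydisc \<Longrightarrow> hext p z = \<phi> z"
proof -
  \<comment> \<open>The Taylor coefficient of \<open>\<phi>\<close> at exponent \<open>m\<close>,
    read off on the torus of radius 1/2.\<close>
  define b where "b m = fcoeff (\<lambda>x. \<phi> (polar (\<chi> i. 1/2) x)) (of_nat_vec m) * of_real (\<Prod>i\<in>UNIV. 2 ^ (m $ i))" for m :: "nat^'n"
  define c where "c k = (if \<forall>j. k $ j \<ge> 0 then b (\<chi> j. nat (k $ j)) else 0)" for k :: "int^'n"
  define e where "e r k = (\<Prod>j\<in>UNIV. (r::real) ^ nat (k $ j))" for r and k :: "int^'n"
  have c_of_nat: "c (of_nat_vec m) = b m" for m
    by (simp add: c_def of_nat_vec_def)
  have c_neg: "c k = 0" if "k $ j < 0" for k j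
    using that unfolding c_def by (metis not_le)
  have coeff: "fcoeff (\<lambda>x. \<phi> (polar (\<chi> j. r) x)) k = c k * of_real (e r k)" if r: "0 \<le> r" "r < 1" for r k
  proof (cases "\<exists>j. k $ j < 0")
    case True
    then show ?thesis
      using fcoeff_schur_polar_neg[OF \<phi>, of "\<chi> j. r"] c_neg r by (auto simp: radii_def)
  next
    case False
    then obtain m where m: "k = of_nat_vec m"
      using nonneg_eq_of_nat_vec[of k] by (auto simp: not_less)
    have R: "(\<chi> j. r) \<in> radii"
      using r by (simp add: radii_def)
    have E: "e r (of_nat_vec m) = rpow (\<chi> j. r) m"
      by (simp add: e_def rpow_def of_nat_vec_def)
    show ?thesis
      unfolding m c_of_nat b_def E by (rule fcoeff_schur_polar[OF \<phi> R])
  qed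
  have "(\<Sum>k\<in>F. (cmod (c k))\<^sup>2) \<le> 1" if F: "finite F" for F
  proof (rule tendsto_upperbound)
    have "((\<lambda>r. \<Sum>k\<in>F. (cmod (c k * of_real (e r k)))\<^sup>2) \<longlongrightarrow> (\<Sum>k\<in>F. (cmod (c k * of_real (e 1 k)))\<^sup>2)) (at_left 1)"
      unfolding e_def by (intro tendsto_intros)
    then show "((\<lambda>r. \<Sum>k\<in>F. (cmod (c k * of_real (e r k)))\<^sup>2) \<longlongrightarrow> (\<Sum>k\<in>F. (cmod (c k))\<^sup>2)) (at_left 1)"
      by (simp add: e_def)
    have "\<forall>\<^sub>F r in at_left (1::real). r \<in> {0<..<1}"
      by (rule eventually_at_left_real) simp
    then show "\<forall>\<^sub>F r in at_left 1. (\<Sum>k\<in>F. (cmod (c k * of_real (e r k)))\<^sup>2) \<le> 1"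
    proof eventually_elim
      case (elim r)
      then have r: "0 \<le> r" "r < 1" "(\<chi> j. r) \<in> (radii :: (real^'n) set)"
        by (auto simp: radii_def)
      let ?p = "\<lambda>x. \<phi> (polar (\<chi> j. r) x)"
      have L: "?p \<in> L2"
        by (rule L2_continuous[OF schur_polar_continuous[OF \<phi> r(3)]])
      have "l2norm ?p \<le> 1"
        using schur_polar_le[OF \<phi> r(3)] by (intro l2norm_le_bound L) auto
      then have "(l2norm ?p)\<^sup>2 \<le> 1"
        by (simp add: power_le_one)
      then show ?case
        using bessel[OF L F] unfolding coeff[OF r(1,2)] by linarith
    qed
  qed simp
  then obtain p where p: "p \<in> L2" "\<And>k. fcoeff p k = c k"
    using riesz_fischer[of c 1] by blast
  have pH: "p \<in> H2"
    using p c_neg by (auto simp: H2_def)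
  moreover have "hext p z = \<phi> z" if z: "z \<in> polydisc" for z
  proof -
    obtain r x where rx: "r \<in> radii" "x \<in> cbox 0 (\<chi> i. 2 * pi)" "z = polar r x"
      using polar_cases[OF z] by blast
    have "AE x in \<mu>. dil p r x = \<phi> (polar r x)"
    proof (rule L2_eqI_fcoeff)
      show "fcoeff (dil p r) k = fcoeff (\<lambda>x. \<phi> (polar r x)) k" for k
      proof (cases "\<exists>j. k $ j < 0")
        case True
        then show ?thesis
          using fcoeff_schur_polar_neg[OF \<phi> rx(1)] fcoeff_dil_neg[OF p(1) rx(1)] by metis
      next
        case False
        then obtain m where m: "k = of_nat_vec m"
          using nonneg_eq_of_nat_vec[of k] by (auto simp: not_less)
        show ?thesis
          unfolding m fcoeff_dil[OF p(1) rx(1)] fcoeff_schur_polar[OF \<phi> rx(1)] p(2) c_of_nat b_def ..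
      qed
      show "dil p r \<in> L2"
        by (rule dil_L2[OF p(1) rx(1)])
      show "(\<lambda>x. \<phi> (polar r x)) \<in> L2"
        by (rule L2_continuous[OF schur_polar_continuous[OF \<phi> rx(1)]])
    qed
    then have "dil p r x = \<phi> (polar r x)"
      by (rule continuous_AE_torus_eq[OF continuous_on_dil[OF p(1) rx(1)] schur_polar_continuous[OF \<phi> rx(1)] _ rx(2)])
    then show ?thesis
      by (simp add: dil_def rx(3))
  qed
  ultimately show ?thesis
    by (rule that)
qed

subsection \<open>Weak limits and bounded functions\<close>

text \<open>Trigonometric polynomials are dense, so for a bounded sequence convergence of each
  coefficient already is weak convergence.\<close>

lemma weak_null:
  assumes D: "\<And>m::nat. D m \<in> L2" "\<And>m. l2norm (D m) \<le> C"
    and lim: "\<And>k. (\<lambda>m. fcoeff (D m) k) \<longlonglongrightarrow> 0" and g: "g \<in> L2"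
  shows "(\<lambda>m. l2inner (D m) g) \<longlonglongrightarrow> 0"
proof (rule tendstoI)
  fix e :: real assume e: "e > 0"
  have C: "C \<ge> 0"
    using D(2)[of 0] l2norm_nonneg[of "D 0"] by linarith
  let ?S = "\<lambda>N. trig_sum (fcoeff g) (exhaust N)"
  have "\<forall>\<^sub>F N in sequentially. l2norm (\<lambda>x. ?S N x - g x) < e / (2 * (C + 1))"
    using trig_sum_tendsto[OF g] e C by (intro order_tendstoD) auto
  then obtain N where N: "l2norm (\<lambda>x. ?S N x - g x) < e / (2 * (C + 1))"
    by (meson eventually_sequentially order_refl)
  have "(\<lambda>m. cnj (\<Sum>k\<in>exhaust N. fcoeff g k * cnj (fcoeff (D m) k))) \<longlonglongrightarrow> cnj (\<Sum>k\<in>exhaust N. fcoeff g k * cnj 0)"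
    by (intro tendsto_intros lim)
  moreover have "cnj (\<Sum>k\<in>exhaust N. fcoeff g k * cnj (fcoeff (D m) k)) = l2inner (D m) (?S N)" for m
    using l2inner_trig_sum_left[OF D(1)] l2inner_commute[of "D m" "?S N"] by simp
  ultimately have "(\<lambda>m. l2inner (D m) (?S N)) \<longlonglongrightarrow> 0"
    by simp
  then have "\<forall>\<^sub>F m in sequentially. cmod (l2inner (D m) (?S N)) < e / 2"
    using e tendstoD[of "\<lambda>m. l2inner (D m) (?S N)" 0 sequentially "e / 2"] by simp
  then show "\<forall>\<^sub>F m in sequentially. dist (l2inner (D m) g) 0 < e"
  proof eventually_elim
    case (elim m)
    have "l2inner (D m) g = l2inner (D m) (?S N) - l2inner (D m) (\<lambda>x. ?S N x - g x)"
      using D g by (simp add: l2inner_diff_right)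
    then have "cmod (l2inner (D m) g) \<le> cmod (l2inner (D m) (?S N)) + cmod (l2inner (D m) (\<lambda>x. ?S N x - g x))"
      by (metis norm_triangle_ineq4)
    also have "cmod (l2inner (D m) (\<lambda>x. ?S N x - g x)) \<le> l2norm (D m) * l2norm (\<lambda>x. ?S N x - g x)"
      by (intro l2_cauchy_schwarz D L2_diff trig_sum_L2 g)
    also have "\<dots> \<le> C * (e / (2 * (C + 1)))"
      using D(2)[of m] N C by (intro mult_mono) auto
    also have "\<dots> \<le> e / 2"
      using C e by (simp add: field_simps)
    finally show ?case
      using elim by simp
  qed
qed

lemma inner_le_l1norm:
  assumes f: "f \<in> L2" "AE x in \<mu>. cmod (f x) \<le> 1" and g: "g \<in> L2"
  shows "cmod (l2inner f g) \<le> l1norm g"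
proof -
  have "cmod (l2inner f g) \<le> (LINT x|\<mu>. cmod (f x * cnj (g x)))"
    unfolding l2inner_def by (rule integral_norm_bound)
  also have "\<dots> \<le> l1norm g"
    unfolding l1norm_def
  proof (rule integral_mono_AE)
    show "integrable \<mu> (\<lambda>x. cmod (f x * cnj (g x)))"
      by (intro integrable_norm inner_integrable f g)
    show "integrable \<mu> (\<lambda>x. cmod (g x))"
      by (intro integrable_norm L2_integrable g)
    show "AE x in \<mu>. cmod (f x * cnj (g x)) \<le> cmod (g x)"
      using f(2) by eventually_elim (simp add: norm_mult mult_left_le_one_le)
  qed
  finally show ?thesis .
qed

text \<open>Testing with the phase of \<open>f\<close> where its modulus exceeds 1 gives
  \<open>l1norm g\<close> plus the integral of the excess over 1, which must therefore vanish. In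
  this dual form the bound survives weak limits.\<close>

lemma bounded_if_inner_le_l1norm:
  assumes f: "f \<in> L2" and le: "\<And>g. g \<in> L2 \<Longrightarrow> cmod (l2inner f g) \<le> l1norm g"
  shows "AE x in \<mu>. cmod (f x) \<le> 1"
proof -
  have [measurable]: "f \<in> borel_measurable \<mu>"
    using f by (rule L2_measurable)
  define g where "g x = (if cmod (f x) > 1 then f x / of_real (cmod (f x)) else 0)" for x
  have [measurable]: "g \<in> borel_measurable \<mu>"
    unfolding g_def by measurable
  have g: "g \<in> L2"
    by (rule L2_bounded[where B = 1]) (auto simp: g_def norm_divide)
  have int: "integrable \<mu> (\<lambda>x. max 0 (cmod (f x) - 1))"
  proof (rule Bochner_Integration.integrable_bound)
    show "integrable \<mu> (\<lambda>x. cmod (f x))"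
      by (intro integrable_norm L2_integrable f)
  qed (auto intro: AE_I2)
  have int1: "integrable \<mu> (\<lambda>x. cmod (g x))"
    by (intro integrable_norm L2_integrable g)
  have "f x * cnj (g x) = of_real (max 0 (cmod (f x) - 1) + cmod (g x))" for x
  proof (cases "cmod (f x) > 1")
    case True
    then have "f x * cnj (g x) = (f x * cnj (f x)) / of_real (cmod (f x))"
      by (simp add: g_def)
    also have "\<dots> = of_real (cmod (f x))"
      using True by (simp add: complex_norm_square[symmetric] power2_eq_square)
    moreover have "f x \<noteq> 0"
      using True by auto
    ultimately show ?thesis
      using True by (simp add: g_def norm_divide)
  qed (simp add: g_def)
  then have "l2inner f g = of_real (LINT x|\<mu>. max 0 (cmod (f x) - 1) + cmod (g x))"
    unfolding l2inner_def by (simp only: integral_complex_of_real)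
  also have "(LINT x|\<mu>. max 0 (cmod (f x) - 1) + cmod (g x)) = (LINT x|\<mu>. max 0 (cmod (f x) - 1)) + l1norm g"
    unfolding l1norm_def by (rule Bochner_Integration.integral_add[OF int int1])
  finally have "cmod (l2inner f g) = \<bar>(LINT x|\<mu>. max 0 (cmod (f x) - 1)) + l1norm g\<bar>"
    by (simp only: norm_of_real)
  moreover have "(LINT x|\<mu>. max 0 (cmod (f x) - 1)) \<ge> 0"
    by simp
  ultimately have "(LINT x|\<mu>. max 0 (cmod (f x) - 1)) = 0"
    using le[OF g] by linarith
  then have "AE x in \<mu>. max 0 (cmod (f x) - 1) = 0"
    by (subst (asm) integral_nonneg_eq_0_iff_AE[OF int]) auto
  then show ?thesis
    by eventually_elim (simp add: max_def split: if_splits)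
qed

text \<open>The test inequality against each \<open>g\<close> passes to the limit. This is the
  closedness of the unit ball of bounded functions required for minimising over it.\<close>

lemma bounded_L2_limit:
  assumes F: "\<And>i::nat. F i \<in> L2" "\<And>i. AE x in \<mu>. cmod (F i x) \<le> 1" and f: "f \<in> L2"
    and lim: "(\<lambda>i. l2norm (\<lambda>x. F i x - f x)) \<longlonglongrightarrow> 0"
  shows "AE x in \<mu>. cmod (f x) \<le> 1"
proof (rule bounded_if_inner_le_l1norm[OF f])
  fix g :: "real^'a \<Rightarrow> complex" assume g: "g \<in> L2"
  have "(\<lambda>i. cmod (l2inner (F i) g)) \<longlonglongrightarrow> cmod (l2inner f g)"
    by (intro tendsto_norm tendsto_l2inner_left lim F f g)
  then show "cmod (l2inner f g) \<le> l1norm g"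
    using inner_le_l1norm[OF F g] by (intro LIMSEQ_le_const2) auto
qed

section \<open>Radii tending to 1\<close>

definition radius_seq :: "nat \<Rightarrow> real^'n::finite" where
  "radius_seq m = (\<chi> j. 1 - inverse (real (Suc m)))"

lemma radius_seq_radii: "radius_seq m \<in> radii"
  by (simp add: radius_seq_def radii_def field_simps)

lemma fcoeff_dil_radius_seq:
  assumes "p \<in> H2"
  shows "(\<lambda>m. fcoeff (dil p (radius_seq m)) k) \<longlonglongrightarrow> fcoeff p k"
proof (cases "\<exists>j. k $ j < 0")
  case True
  then show ?thesis
    using H2_fcoeff[OF assms] fcoeff_dil_neg[OF H2_L2[OF assms] radius_seq_radii] by fastforce
next
  case False
  then obtain l where l: "k = of_nat_vec l"
    using nonneg_eq_of_nat_vec[of k] by (auto simp: not_less)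
  have "(\<lambda>m. fcoeff p k * of_real (\<Prod>j\<in>UNIV. (1 + - inverse (real (Suc m))) ^ (l $ j))) \<longlonglongrightarrow>
      fcoeff p k * of_real (\<Prod>j\<in>UNIV. 1 ^ (l $ j))"
    by (intro tendsto_intros LIMSEQ_inverse_real_of_nat_add_minus)
  then show ?thesis
    unfolding l fcoeff_dil[OF H2_L2[OF assms] radius_seq_radii] by (simp add: rpow_def radius_seq_def)
qed

lemma dil_radius_seq_le:
  assumes "\<And>z. z \<in> polydisc \<Longrightarrow> cmod (hext p z) \<le> 1"
  shows "cmod (dil p (radius_seq m) x) \<le> 1"
  unfolding dil_def by (rule assms[OF polar_polydisc[OF radius_seq_radii]])

lemma dil_radius_seq_L2: "p \<in> H2 \<Longrightarrow> dil p (radius_seq m) \<in> L2"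
  by (rule dil_L2[OF H2_L2 radius_seq_radii])

text \<open>The dilations are bounded by 1 and each coefficient converges. This weak convergence
  takes the place of radial limits almost everywhere.\<close>

lemma dil_radius_seq_weak:
  assumes p: "p \<in> H2" and le: "\<And>z. z \<in> polydisc \<Longrightarrow> cmod (hext p z) \<le> 1" and g: "g \<in> L2"
  shows "(\<lambda>m. l2inner (\<lambda>x. dil p (radius_seq m) x - p x) g) \<longlonglongrightarrow> 0"
proof (rule weak_null[OF _ _ _ g])
  note L = dil_radius_seq_L2[OF p] H2_L2[OF p]
  show "(\<lambda>x. dil p (radius_seq m) x - p x) \<in> L2" for m
    by (intro L2_diff L)
  have "l2norm (dil p (radius_seq m)) \<le> 1" for m
    using dil_radius_seq_le[OF le] by (intro l2norm_le_bound L) auto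
  then show "l2norm (\<lambda>x. dil p (radius_seq m) x - p x) \<le> 1 + l2norm p" for m
    using l2norm_triangle[OF L(1) L2_uminus[OF L(2)], of m] l2norm_scale[of "-1" p] by (auto intro: order_trans)
  show "(\<lambda>m. fcoeff (\<lambda>x. dil p (radius_seq m) x - p x) k) \<longlonglongrightarrow> 0" for k
    using fcoeff_dil_radius_seq[OF p, of k] L by (simp add: fcoeff_diff LIM_zero_iff)
qed

text \<open>The dilations satisfy the bound at every point, and the test inequality that
  characterises it passes to their weak limit \<open>p\<close>.\<close>

lemma boundary_bounded:
  assumes p: "p \<in> H2" and le: "\<And>z. z \<in> polydisc \<Longrightarrow> cmod (hext p z) \<le> 1"
  shows "AE x in \<mu>. cmod (p x) \<le> 1"
proof (rule bounded_if_inner_le_l1norm[OF H2_L2[OF p]])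
  fix g :: "real^'a \<Rightarrow> complex" assume g: "g \<in> L2"
  note L = dil_radius_seq_L2[OF p] H2_L2[OF p]
  have "(\<lambda>m. l2inner (dil p (radius_seq m)) g) \<longlonglongrightarrow> l2inner p g"
    using dil_radius_seq_weak[OF p le g] L g by (simp add: l2inner_diff_left LIM_zero_iff)
  then have "(\<lambda>m. cmod (l2inner (dil p (radius_seq m)) g)) \<longlonglongrightarrow> cmod (l2inner p g)"
    by (rule tendsto_norm)
  moreover have "cmod (l2inner (dil p (radius_seq m)) g) \<le> l1norm g" for m
    using dil_radius_seq_le[OF le] by (intro inner_le_l1norm L g) auto
  ultimately show "cmod (l2inner p g) \<le> l1norm g"
    by (intro LIMSEQ_le_const2) auto
qed

text \<open>The dilations of \<open>p\<close> are uniform limits of polynomials, and they converge boundedly and weakly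
  to \<open>p\<close>.\<close>

lemma bounded_mult_orthogonal:
  assumes p: "p \<in> H2" "AE x in \<mu>. cmod (p x) \<le> 1" and f: "f \<in> L2" and q: "q \<in> L2"
    and 0: "\<And>k. l2inner (\<lambda>x. chr (of_nat_vec k) x * f x) q = 0"
  shows "l2inner (\<lambda>x. p x * f x) q = 0"
proof -
  note L = dil_radius_seq_L2[OF p(1)] H2_L2[OF p(1)]
  note le = hext_norm_le_1[OF p]
  let ?P = "\<lambda>m. dil p (radius_seq m)"
  have Pb: "AE x in \<mu>. cmod (?P m x) \<le> 1" for m
    using dil_radius_seq_le[OF le] by auto
  have Pf: "(\<lambda>x. ?P m x * f x) \<in> L2" for m
    by (rule L2_mult_bounded[OF f L2_measurable[OF L(1)] Pb])
  have pf: "(\<lambda>x. p x * f x) \<in> L2"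
    by (rule L2_mult_bounded[OF f L2_measurable[OF L(2)] p(2)])
  \<comment> \<open>For fixed \<open>m\<close> finite sums of monomials converge uniformly to the
    dilation, so their products with \<open>f\<close> converge in L^2, and each finite sum is
    covered by the hypothesis on monomials.\<close>
  have zero: "l2inner (\<lambda>x. ?P m x * f x) q = 0" for m
  proof -
    let ?r = "radius_seq m :: real^'a"
    let ?S = "\<lambda>F x. \<Sum>k\<in>F. fcoeff p (of_nat_vec k) * of_real (rpow ?r k) * chr (of_nat_vec k) x"
    have SL: "?S F \<in> L2" for F
      by (intro L2_sum L2_scale chr_L2)
    have eq: "(\<lambda>x. ?S F x * f x) = (\<lambda>x. \<Sum>k\<in>F. fcoeff p (of_nat_vec k) * of_real (rpow ?r k) * (chr (of_nat_vec k) x * f x))" for F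
      by (simp add: sum_distrib_right mult.assoc)
    have SfL: "(\<lambda>x. ?S F x * f x) \<in> L2" for F
      unfolding eq by (intro L2_sum L2_scale chr_mult_L2 f)
    have "((\<lambda>F. l2norm (\<lambda>x. ?S F x * f x - ?P m x * f x)) \<longlongrightarrow> 0) (finite_subsets_at_top UNIV)"
    proof (rule tendstoI)
      fix e :: real assume e: "e > 0"
      define d where "d = e / (2 * (l2norm f + 1))"
      have d: "d > 0"
        unfolding d_def using e by (intro divide_pos_pos) (auto intro: add_nonneg_pos)
      have "\<forall>\<^sub>F F in finite_subsets_at_top UNIV. \<forall>x\<in>UNIV. dist (?S F x) (?P m x) < d"
        using dil_uniform_limit[OF L(2) radius_seq_radii] d by (rule uniform_limitD)
      then show "\<forall>\<^sub>F F in finite_subsets_at_top UNIV. dist (l2norm (\<lambda>x. ?S F x * f x - ?P m x * f x)) 0 < e"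
      proof eventually_elim
        case (elim F)
        have "l2norm (\<lambda>x. (?S F x - ?P m x) * f x) \<le> d * l2norm f"
        proof (rule l2norm_mult_le[OF f])
          show "(\<lambda>x. ?S F x - ?P m x) \<in> borel_measurable \<mu>"
            by (intro L2_measurable L2_diff SL L(1))
          show "AE x in \<mu>. cmod (?S F x - ?P m x) \<le> d"
            using elim by (auto simp: dist_norm less_imp_le)
        qed (use d in simp)
        also have "\<dots> \<le> e / 2"
        proof -
          have "l2norm f * e \<le> (l2norm f + 1) * e"
            using e by (intro mult_right_mono) auto
          moreover have "l2norm f + 1 > 0"
            by (intro add_nonneg_pos) auto
          ultimately show ?thesis
            by (simp add: d_def field_simps)
        qed
        also have "\<dots> < e" using e by simp
        finally show ?case
          by (simp add: left_diff_distrib)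
      qed
    qed
    then have "((\<lambda>F. l2inner (\<lambda>x. ?S F x * f x) q) \<longlongrightarrow> l2inner (\<lambda>x. ?P m x * f x) q) (finite_subsets_at_top UNIV)"
      by (rule tendsto_l2inner_left[OF _ SfL Pf q])
    moreover have "l2inner (\<lambda>x. ?S F x * f x) q = 0" for F
      unfolding eq using q f 0
      by (subst l2inner_sum_left) (auto simp: l2inner_scale_left intro!: L2_scale chr_mult_L2)
    ultimately show ?thesis
      by (simp add: tendsto_const_iff)
  qed
  have "(\<lambda>m. l2inner (\<lambda>x. (?P m x - p x) * f x) q) \<longlonglongrightarrow> 0"
  proof (rule weak_null[OF _ _ _ q])
    have b: "AE x in \<mu>. cmod (?P m x - p x) \<le> 2" for m
      using p(2) Pb[of m]
    proof eventually_elim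
      case (elim x)
      then show ?case
        using norm_triangle_ineq4[of "?P m x" "p x"] by linarith
    qed
    have bm: "(\<lambda>x. ?P m x - p x) \<in> borel_measurable \<mu>" for m
      by (intro L2_measurable L2_diff L)
    show "(\<lambda>x. (?P m x - p x) * f x) \<in> L2" for m
      by (rule L2_mult_bounded[OF f bm b])
    show "l2norm (\<lambda>x. (?P m x - p x) * f x) \<le> 2 * l2norm f" for m
      by (rule l2norm_mult_le[OF f bm b]) simp
    show "(\<lambda>m. fcoeff (\<lambda>x. (?P m x - p x) * f x) k) \<longlonglongrightarrow> 0" for k
    proof -
      \<comment> \<open>Moved to the other side of the inner product, \<open>f\<close> becomes part
        of the test function, so weak convergence of the dilations gives convergence of each
        coefficient of the product.\<close>
      have "(\<lambda>x. chr k x * cnj (f x)) \<in> L2"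
        using f by (intro chr_mult_L2) simp
      from dil_radius_seq_weak[OF p(1) le this] show ?thesis
        unfolding fcoeff_def l2inner_def by (simp add: mult_ac)
    qed
  qed
  moreover have "l2inner (\<lambda>x. (?P m x - p x) * f x) q = - l2inner (\<lambda>x. p x * f x) q" for m
    using zero[of m] Pf[of m] pf q by (simp add: left_diff_distrib l2inner_diff_left)
  ultimately show ?thesis
    by (simp add: LIMSEQ_const_iff)
qed

subsection \<open>Duality\<close>

lemma is_proj_cong_AE:
  assumes "is_proj S f g" "l2_closed_subspace S" "f \<in> L2" "f' \<in> L2" "g' \<in> L2"
    "AE x in \<mu>. f x = f' x" "AE x in \<mu>. g x = g' x"
  shows "is_proj S f' g'"
proof (rule is_projI)
  note SL = l2_closed_subspace_subset[OF assms(2)]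
  have g: "g \<in> S" by (rule is_projD(1)[OF assms(1)])
  show "g' \<in> S"
    by (rule l2_closed_subspaceD(5)[OF assms(2) g assms(5,7)])
  show "S \<subseteq> L2" by (rule SL)
  show "f' \<in> L2" by (rule assms(4))
  fix h assume h: "h \<in> S"
  have "l2inner f' h = l2inner f h"
    using assms SL h by (intro l2inner_cong_AE) auto
  also have "\<dots> = l2inner g h"
    by (rule is_proj_inner[OF assms(1) h SL assms(3)])
  also have "\<dots> = l2inner g' h"
    using assms SL h g by (intro l2inner_cong_AE) auto
  finally show "l2inner f' h = l2inner g' h" .
qed

text \<open>Makes the norm of a projection independent of the selected representative, so that it
  can be computed from an explicit affine formula.\<close>

lemma is_proj_l2norm_eq:
  assumes "l2_closed_subspace S" "f \<in> L2" "is_proj S f g" "is_proj S f h"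
  shows "l2norm g = l2norm h"
  using is_proj_unique[OF assms] is_projD(1)[OF assms(3)] is_projD(1)[OF assms(4)]
    l2_closed_subspace_subset[OF assms(1)] by (intro l2norm_cong_AE) auto

text \<open>Hahn-Banach extension and the duality of \<open>L\<^sup>1\<close> and \<open>L\<^sup>\<infinity>\<close> in one step: \<open>k\<close> minimises the norm of the
  projection of \<open>p - k\<close> to \<open>M\<close> over the unit ball of \<open>L\<^sup>\<infinity>\<close>. The first variation in the direction
  of the sign of that projection shows that the minimum is 0.\<close>

theorem L1_duality:
  fixes M :: "('n::finite) tfun set"
  assumes M: "l2_closed_subspace M" and p: "p \<in> L2"
    and le: "\<And>w. w \<in> M \<Longrightarrow> cmod (l2inner p w) \<le> l1norm w"
  obtains k where "k \<in> L2" "AE x in \<mu>. cmod (k x) \<le> 1" "\<And>w. w \<in> M \<Longrightarrow> l2inner k w = l2inner p w"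
proof -
  note M_L2 = l2_closed_subspace_subset[OF M]
  define K where "K = {k :: 'n tfun. k \<in> L2 \<and> (AE x in \<mu>. cmod (k x) \<le> 1)}"
  define P where "P k = PQ M (\<lambda>x. p x - k x)" for k
  have pk: "(\<lambda>x. p x - k x) \<in> L2" if "k \<in> L2" for k
    by (rule L2_diff[OF p that])
  have P: "is_proj M (\<lambda>x. p x - k x) (P k)" if "k \<in> L2" for k
    unfolding P_def by (rule is_proj_PQ[OF M pk[OF that]])
  have PL: "P k \<in> L2" if "k \<in> L2" for k
    using is_projD(1)[OF P[OF that]] M_L2 by auto
  have comb: "(\<lambda>x. (1 - of_real t) * k x + of_real t * l x) \<in> K" if "k \<in> K" "l \<in> K" "0 \<le> t" "t \<le> 1" for k l and t :: real
  proof -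
    have "AE x in \<mu>. cmod ((1 - of_real t) * k x + of_real t * l x) \<le> 1"
    proof -
      have "AE x in \<mu>. cmod (k x) \<le> 1" "AE x in \<mu>. cmod (l x) \<le> 1"
        using that by (auto simp: K_def)
      then show ?thesis
      proof eventually_elim
        case (elim x)
        have "cmod ((1 - of_real t) * k x + of_real t * l x) \<le> cmod (of_real (1 - t) * k x) + cmod (of_real t * l x)"
          using norm_triangle_ineq[of "of_real (1 - t) * k x" "of_real t * l x"] by simp
        also have "\<dots> = (1 - t) * cmod (k x) + t * cmod (l x)"
          using that by (simp add: norm_mult del: of_real_diff)
        also have "\<dots> \<le> (1 - t) * 1 + t * 1"
          using that elim by (intro add_mono mult_left_mono) auto
        finally show ?case by simp
      qed
    qed
    then show ?thesis
      using that by (auto simp: K_def intro!: L2_add L2_scale)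
  qed
  have "\<exists>k\<in>K. \<forall>l\<in>K. l2norm (P k) \<le> l2norm (P l)"
  proof (rule L2_minimizer[of K "\<lambda>k. l2norm (P k)" 1])
    show "K \<subseteq> L2" by (auto simp: K_def)
    have "(\<lambda>_. 0) \<in> K" by (simp add: K_def)
    then show "K \<noteq> {}" by blast
    show mid: "(\<lambda>x. (k x + l x) / 2) \<in> K" if "k \<in> K" "l \<in> K" for k l
    proof -
      have eq: "(\<lambda>x. (1 - of_real (1/2)) * k x + of_real (1/2) * l x) = (\<lambda>x. (k x + l x) / 2)"
        by (auto simp: field_simps)
      show ?thesis
        using comb[OF that, of "1/2"] unfolding eq by simp
    qed
    show "k \<in> K" if "\<And>i. F i \<in> K" "k \<in> L2" "(\<lambda>i. l2norm (\<lambda>x. F i x - k x)) \<longlonglongrightarrow> 0" for F k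
      using that bounded_L2_limit[of F k] by (simp add: K_def)
    show "l2norm (P (\<lambda>x. (k x + l x) / 2)) \<le> (l2norm (P k) + l2norm (P l)) / 2" if kl: "k \<in> K" "l \<in> K" for k l
    proof -
      have L: "k \<in> L2" "l \<in> L2" "(\<lambda>x. (k x + l x) / 2) \<in> L2"
        using kl mid[OF kl] by (simp_all add: K_def)
      have "is_proj M (\<lambda>x. (1/2) * ((p x - k x) + (p x - l x))) (\<lambda>x. (1/2) * (P k x + P l x))"
        by (rule is_proj_scale[OF M L2_add[OF pk[OF L(1)] pk[OF L(2)]]
            is_proj_add[OF M pk[OF L(1)] pk[OF L(2)] P[OF L(1)] P[OF L(2)]]])
      moreover have "(\<lambda>x. (1/2) * ((p x - k x) + (p x - l x))) = (\<lambda>x. p x - (k x + l x) / 2)"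
        by (auto simp: field_simps)
      ultimately have "is_proj M (\<lambda>x. p x - (k x + l x) / 2) (\<lambda>x. (1/2) * (P k x + P l x))"
        by simp
      from is_proj_l2norm_eq[OF M pk[OF L(3)] P[OF L(3)] this]
      show ?thesis
        unfolding l2norm_scale using l2norm_triangle[OF PL[OF L(1)] PL[OF L(2)]] by simp
    qed
    show "l2norm (P k) \<le> l2norm (P l) + l2norm (\<lambda>x. l x - k x)" if "k \<in> K" "l \<in> K" for k l
    proof -
      have L: "k \<in> L2" "l \<in> L2"
        using that by (simp_all add: K_def)
      have "is_proj M (\<lambda>x. (p x - k x) - (p x - l x)) (\<lambda>x. P k x - P l x)"
        by (rule is_proj_diff[OF M pk[OF L(1)] pk[OF L(2)] P[OF L(1)] P[OF L(2)]])
      from is_proj_norm_le[OF M _ this] have "l2norm (\<lambda>x. P k x - P l x) \<le> l2norm (\<lambda>x. l x - k x)"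
        using L2_diff[OF pk[OF L(1)] pk[OF L(2)]] by simp
      then show ?thesis
        using l2norm_triangle_sub[OF PL[OF L(1)] PL[OF L(2)]] by linarith
    qed
    show "l2norm k \<le> l2norm (P k) + 1" if "k \<in> K" for k
      using that l2norm_le_bound[of k 1] by (simp add: K_def add_increasing)
  qed auto
  then obtain k where kK: "k \<in> K" and k_min: "\<And>l. l \<in> K \<Longrightarrow> l2norm (P k) \<le> l2norm (P l)"
    by blast
  have kL: "k \<in> L2" and k1: "AE x in \<mu>. cmod (k x) \<le> 1"
    using kK by (auto simp: K_def)
  define w where "w = P k"
  have w: "w \<in> M" "w \<in> L2"
    using is_projD(1)[OF P[OF kL]] PL[OF kL] by (auto simp: w_def)
  \<comment> \<open>Moving from \<open>k\<close> towards \<open>l\<close> stays in the convex set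
    \<open>K\<close> and changes the projection affinely to \<open>w - t v\<close>; minimality of
    \<open>k\<close> gives the one-sided condition.\<close>
  have opt: "Re (l2inner (\<lambda>x. l x - k x) w) \<le> 0" if l: "l \<in> K" for l
  proof -
    have lL: "l \<in> L2" using l by (simp add: K_def)
    define v where "v = PQ M (\<lambda>x. l x - k x)"
    have v: "is_proj M (\<lambda>x. l x - k x) v"
      unfolding v_def by (rule is_proj_PQ[OF M L2_diff[OF lL kL]])
    have vL: "v \<in> L2"
      using is_projD(1)[OF v] M_L2 by auto
    have "Re (l2inner w v) \<le> 0"
    proof (rule l2_variation_le[OF w(2) vL])
      fix t :: real assume t: "0 < t" "t \<le> 1"
      let ?m = "\<lambda>x. (1 - of_real t) * k x + of_real t * l x"
      have mK: "?m \<in> K"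
        using comb[OF kK l] t by simp
      then have mL: "?m \<in> L2" by (simp add: K_def)
      have "is_proj M (\<lambda>x. (p x - k x) - of_real t * (l x - k x)) (\<lambda>x. P k x - of_real t * v x)"
        by (rule is_proj_diff[OF M pk[OF kL] L2_scale[OF L2_diff[OF lL kL]] P[OF kL]
            is_proj_scale[OF M L2_diff[OF lL kL] v]])
      moreover have "(\<lambda>x. (p x - k x) - of_real t * (l x - k x)) = (\<lambda>x. p x - ?m x)"
        by (auto simp: algebra_simps)
      ultimately have "is_proj M (\<lambda>x. p x - ?m x) (\<lambda>x. P k x - of_real t * v x)"
        by simp
      from is_proj_l2norm_eq[OF M pk[OF mL] P[OF mL] this]
      show "l2norm w \<le> l2norm (\<lambda>x. w x - of_real t * v x)"
        using k_min[OF mK] by (simp add: w_def)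
    qed
    moreover have "l2inner (\<lambda>x. l x - k x) w = l2inner v w"
      by (rule is_proj_inner[OF v w(1) M_L2 L2_diff[OF lL kL]])
    ultimately show ?thesis
      using l2inner_commute[of v w] by simp
  qed
  have [measurable]: "w \<in> borel_measurable \<mu>"
    by (rule L2_measurable[OF w(2)])
  \<comment> \<open>The phase of \<open>w\<close> lies in \<open>K\<close> and attains
    \<open>l1norm w\<close>, hence \<open>l1norm w \<le> Re (l2inner k w)\<close>. As
    \<open>Re (l2inner p w) \<le> l1norm w\<close>, the difference \<open>(l2norm w)\<^sup>2\<close>
    of the two inner products is at most 0.\<close>
  define s where "s x = (if w x = 0 then 0 else w x / of_real (cmod (w x)))" for x
  have sm: "s \<in> borel_measurable \<mu>"
    unfolding s_def by measurable
  have s1: "AE x in \<mu>. cmod (s x) \<le> 1"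
    by (auto simp: s_def norm_divide)
  have sL: "s \<in> L2"
    by (rule L2_bounded[OF sm s1])
  then have sK: "s \<in> K"
    using s1 by (simp add: K_def)
  have "s x * cnj (w x) = of_real (cmod (w x))" for x
    by (auto simp: s_def complex_norm_square[symmetric] power2_eq_square)
  then have sw: "l2inner s w = of_real (l1norm w)"
    unfolding l2inner_def l1norm_def by (simp only: integral_complex_of_real)
  have "l1norm w \<le> Re (l2inner k w)"
    using opt[OF sK] sL kL w(2) sw by (simp add: l2inner_diff_left)
  moreover have "of_real ((l2norm w)\<^sup>2) = l2inner p w - l2inner k w"
    using is_proj_inner[OF P[OF kL] w(1) M_L2 pk[OF kL]] p kL w(2)
    by (simp add: w_def[symmetric] l2inner_self l2inner_diff_left)
  then have "(l2norm w)\<^sup>2 = Re (l2inner p w) - Re (l2inner k w)"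
    by (metis Re_complex_of_real minus_complex.simps(1))
  moreover have "Re (l2inner p w) \<le> l1norm w"
    using le[OF w(1)] complex_Re_le_cmod order_trans by blast
  ultimately have "(l2norm w)\<^sup>2 \<le> 0"
    by linarith
  then have "l2norm w = 0" by simp
  then have "l2inner k h = l2inner p h" if h: "h \<in> M" for h
  proof -
    have hL: "h \<in> L2" using h M_L2 by auto
    have "cmod (l2inner w h) \<le> 0"
      using l2_cauchy_schwarz[OF w(2) hL] \<open>l2norm w = 0\<close> by simp
    moreover have "l2inner (\<lambda>x. p x - k x) h = l2inner w h"
      unfolding w_def by (rule is_proj_inner[OF P[OF kL] h M_L2 pk[OF kL]])
    ultimately show ?thesis
      using p kL hL by (simp add: l2inner_diff_left)
  qed
  with kL k1 show ?thesis
    by (rule that)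
qed

subsection \<open>Quotient modules\<close>

lemma quotient_moduleD:
  assumes "quotient_module Q"
  shows "l2_closed_subspace Q" "Q \<subseteq> H2"
    "f \<in> Q \<Longrightarrow> is_proj H2 (\<lambda>x. cnj (zc i x) * f x) g \<Longrightarrow> g \<in> Q"
  using assms unfolding quotient_module_def by blast+

lemma of_nat_vec_axis: "of_nat_vec (axis i 1) = axis i 1"
  by (auto simp: of_nat_vec_def axis_def vec_eq_iff)

lemma chr_of_nat_vec_step: "chr (of_nat_vec (m + axis i 1)) x = zc i x * chr (of_nat_vec m) x"
  by (simp add: of_nat_vec_add of_nat_vec_axis chr_add zc_eq_chr del: One_nat_def)

lemma nat_vec_induct [case_names zero step]:
  fixes m :: "nat^'n::finite"
  assumes "P 0" and step: "\<And>m i. P m \<Longrightarrow> P (m + axis i 1)"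
  shows "P m"
proof (induction "\<Sum>j\<in>UNIV. m $ j" arbitrary: m)
  case 0
  then have "m = 0"
    by (simp add: vec_eq_iff)
  then show ?case using assms(1) by simp
next
  case (Suc n)
  then have "\<exists>i. m $ i > 0"
    by (metis Zero_not_Suc gr0I sum.neutral)
  then obtain i where i: "m $ i > 0" by blast
  define l where "l = (\<chi> j. if j = i then m $ j - 1 else m $ j)"
  have m: "m = l + axis i 1"
    using i by (auto simp: l_def axis_def vec_eq_iff)
  have "(\<Sum>j\<in>UNIV. m $ j) = (\<Sum>j\<in>UNIV. l $ j) + 1"
    unfolding m by (simp add: sum.distrib axis_def)
  then have "P l"
    using Suc by (intro Suc.hyps(1)) simp
  then show ?case
    unfolding m by (rule step)
qed

lemma zc_eq_chr_of_nat: "zc i = chr (of_nat_vec (axis i 1))"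
  by (simp add: zc_eq_chr of_nat_vec_axis del: One_nat_def)

lemma zc_mult_H2: "f \<in> H2 \<Longrightarrow> (\<lambda>x. zc i x * f x) \<in> H2"
  unfolding zc_eq_chr_of_nat by (rule chr_mult_H2)

lemma zc_H2: "zc i \<in> H2"
  unfolding zc_eq_chr_of_nat by (rule chr_in_H2)

text \<open>By adjunction: \<open>Q\<close> is invariant under the adjoint of multiplication by
  \<open>zc i\<close>, so its complement in \<open>H2\<close> is invariant under the multiplication
  itself.\<close>

lemma quotient_module_orth_shift:
  assumes Q: "quotient_module Q" and f: "f \<in> H2" and 0: "\<And>q. q \<in> Q \<Longrightarrow> l2inner f q = 0" and q: "q \<in> Q"
  shows "l2inner (\<lambda>x. zc i x * f x) q = 0"
proof -
  have qL: "q \<in> L2"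
    using quotient_moduleD(2)[OF Q] q H2_L2 by blast
  have zq: "(\<lambda>x. cnj (zc i x) * q x) \<in> L2"
    unfolding zc_eq_chr chr_uminus[symmetric] by (rule chr_mult_L2[OF qL])
  let ?g = "PQ H2 (\<lambda>x. cnj (zc i x) * q x)"
  have g: "is_proj H2 (\<lambda>x. cnj (zc i x) * q x) ?g"
    by (rule is_proj_PQ[OF l2_closed_subspace_H2 zq])
  have "l2inner (\<lambda>x. cnj (zc i x) * q x) f = l2inner ?g f"
    by (rule is_proj_inner[OF g f l2_closed_subspace_subset[OF l2_closed_subspace_H2] zq])
  also have "\<dots> = cnj (l2inner f ?g)"
    by (rule l2inner_commute)
  also have "\<dots> = 0"
    using 0[OF quotient_moduleD(3)[OF Q q g]] by simp
  finally have "cnj (l2inner (\<lambda>x. cnj (zc i x) * q x) f) = 0"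
    by simp
  then show ?thesis
    unfolding l2inner_commute[symmetric] by (simp add: l2inner_def mult_ac)
qed

text \<open>Iterating the shifts gives invariance under monomials, and
  \<open>bounded_mult_orthogonal\<close> extends it to the bounded symbol \<open>p\<close>.\<close>

lemma quotient_module_orth_mult:
  assumes Q: "quotient_module Q" and p: "p \<in> H2" "AE x in \<mu>. cmod (p x) \<le> 1"
    and f: "f \<in> H2" and 0: "\<And>q. q \<in> Q \<Longrightarrow> l2inner f q = 0" and q: "q \<in> Q"
  shows "l2inner (\<lambda>x. p x * f x) q = 0"
proof (rule bounded_mult_orthogonal[OF p H2_L2[OF f]])
  show "q \<in> L2"
    using quotient_moduleD(2)[OF Q] q H2_L2 by blast
  fix k
  have "(\<lambda>x. chr (of_nat_vec k) x * f x) \<in> H2 \<and> (\<forall>q\<in>Q. l2inner (\<lambda>x. chr (of_nat_vec k) x * f x) q = 0)"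
  proof (induction k rule: nat_vec_induct)
    case zero
    have "of_nat_vec 0 = (0 :: int^'a)"
      by (simp add: of_nat_vec_def vec_eq_iff)
    then show ?case using f 0 by simp
  next
    case (step k i)
    have "(\<lambda>x. chr (of_nat_vec (k + axis i 1)) x * f x) = (\<lambda>x. zc i x * (chr (of_nat_vec k) x * f x))"
      by (simp add: chr_of_nat_vec_step mult.assoc del: One_nat_def)
    then show ?case
      using step quotient_module_orth_shift[OF Q, of "\<lambda>x. chr (of_nat_vec k) x * f x"] zc_mult_H2 by auto
  qed
  then show "l2inner (\<lambda>x. chr (of_nat_vec k) x * f x) q = 0"
    using q by blast
qed

section \<open>Compressions of multiplication operators\<close>

lemma mult_L2_bounded_H2:
  assumes "p \<in> H2" "AE x in \<mu>. cmod (p x) \<le> 1" "f \<in> L2"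
  shows "(\<lambda>x. p x * f x) \<in> L2"
  by (rule L2_mult_bounded[OF assms(3) L2_measurable[OF H2_L2[OF assms(1)]] assms(2)])

text \<open>The orthogonal complement of \<open>Q\<close> in \<open>H2\<close> is invariant under \<open>p\<close>, so that
  \<open>P\<^sub>Q p P\<^sub>Q = P\<^sub>Q p\<close> on \<open>H2\<close>.\<close>

lemma is_proj_mult_iff:
  assumes Q: "quotient_module Q" and p: "p \<in> H2" "AE x in \<mu>. cmod (p x) \<le> 1"
    and f: "f \<in> H2" and g: "is_proj Q f g"
  shows "is_proj Q (\<lambda>x. p x * f x) h \<longleftrightarrow> is_proj Q (\<lambda>x. p x * g x) h"
proof -
  note QD = quotient_moduleD[OF Q]
  have gQ: "g \<in> Q" by (rule is_projD(1)[OF g])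
  then have gH: "g \<in> H2" using QD(2) by blast
  have fg: "(\<lambda>x. f x - g x) \<in> H2"
    by (rule l2_closed_subspace_diff[OF l2_closed_subspace_H2 f gH])
  have L: "(\<lambda>x. p x * f x) \<in> L2" "(\<lambda>x. p x * g x) \<in> L2"
    by (rule mult_L2_bounded_H2[OF p H2_L2[OF f]], rule mult_L2_bounded_H2[OF p H2_L2[OF gH]])
  have QL: "Q \<subseteq> L2"
    by (rule l2_closed_subspace_subset[OF QD(1)])
  have eq: "l2inner (\<lambda>x. p x * f x) q = l2inner (\<lambda>x. p x * g x) q" if q: "q \<in> Q" for q
  proof -
    have "l2inner (\<lambda>x. p x * (f x - g x)) q = 0"
      by (rule quotient_module_orth_mult[OF Q p fg is_projD(2)[OF g] q])
    then show ?thesis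
      using L q QL by (auto simp: right_diff_distrib l2inner_diff_left)
  qed
  have "is_proj Q (\<lambda>x. p x * g x) h" if h: "is_proj Q (\<lambda>x. p x * f x) h"
    using is_projD(1)[OF h] is_proj_inner[OF h _ QL L(1)] eq by (intro is_projI QL L) simp_all
  moreover have "is_proj Q (\<lambda>x. p x * f x) h" if h: "is_proj Q (\<lambda>x. p x * g x) h"
    using is_projD(1)[OF h] is_proj_inner[OF h _ QL L(2)] eq by (intro is_projI QL L) simp_all
  ultimately show ?thesis by blast
qed

text \<open>\<open>Tphi\<close> is fixed only through the values of \<open>hext\<close> on the
  polydisc, and these determine an \<open>H2\<close> function a.e. The product with the boundary
  function has the required values, so it is the function selected, up to a null set.\<close>

lemma Tphi_hext:
  assumes p: "p \<in> H2" "AE x in \<mu>. cmod (p x) \<le> 1" and \<phi>: "\<And>z. z \<in> polydisc \<Longrightarrow> hext p z = \<phi> z" and f: "f \<in> H2"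
  shows "Tphi \<phi> f \<in> H2" "AE x in \<mu>. Tphi \<phi> f x = p x * f x"
proof -
  let ?P = "\<lambda>g. g \<in> H2 \<and> (\<forall>z\<in>polydisc. hext g z = \<phi> z * hext f z)"
  have pf: "(\<lambda>x. p x * f x) \<in> H2" "\<And>z. z \<in> polydisc \<Longrightarrow> hext (\<lambda>x. p x * f x) z = \<phi> z * hext f z"
    using H2_mult_bounded[OF p zero_le_one f] \<phi> by auto
  have T: "?P (Tphi \<phi> f)"
    unfolding Tphi_def by (rule someI[of ?P "\<lambda>x. p x * f x"]) (use pf in blast)
  then show "Tphi \<phi> f \<in> H2" by blast
  show "AE x in \<mu>. Tphi \<phi> f x = p x * f x"
    using T pf by (intro H2_eqI_hext) auto
qed

lemma is_proj_Sphi: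
  assumes Q: "quotient_module Q" and p: "p \<in> H2" "AE x in \<mu>. cmod (p x) \<le> 1"
    and \<phi>: "\<And>z. z \<in> polydisc \<Longrightarrow> hext p z = \<phi> z" and f: "f \<in> Q"
  shows "is_proj Q (\<lambda>x. p x * f x) (Sphi Q \<phi> f)"
proof -
  note QD = quotient_moduleD[OF Q]
  have fH: "f \<in> H2" using QD(2) f by blast
  have T: "Tphi \<phi> f \<in> H2" "AE x in \<mu>. Tphi \<phi> f x = p x * f x"
    using \<phi> by (auto intro!: Tphi_hext[OF p _ fH])
  have S: "is_proj Q (Tphi \<phi> f) (Sphi Q \<phi> f)"
    unfolding Sphi_def by (rule is_proj_PQ[OF QD(1) H2_L2[OF T(1)]])
  have SL: "Sphi Q \<phi> f \<in> L2"
    using is_projD(1)[OF S] l2_closed_subspace_subset[OF QD(1)] by blast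
  show ?thesis
    by (rule is_proj_cong_AE[OF S QD(1) H2_L2[OF T(1)] mult_L2_bounded_H2[OF p H2_L2[OF fH]] SL T(2)])
      (rule AE_I2, rule refl)
qed

text \<open>Trades holomorphic symbols on the polydisc for bounded functions on the torus; from here
  on liftability is a statement about \<open>p\<close> alone.\<close>

lemma liftable_iff_boundary:
  assumes Q: "quotient_module Q" and X: "\<And>f. f \<in> Q \<Longrightarrow> X f \<in> Q"
  shows "liftable Q X \<longleftrightarrow> (\<exists>p\<in>H2. (AE x in \<mu>. cmod (p x) \<le> 1) \<and> (\<forall>f\<in>Q. is_proj Q (\<lambda>x. p x * f x) (X f)))"
proof
  note QD = quotient_moduleD[OF Q]
  have QL: "Q \<subseteq> L2"
    by (rule l2_closed_subspace_subset[OF QD(1)])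
  {
    assume "liftable Q X"
    then obtain \<phi> where \<phi>: "schur \<phi>" "\<And>f. f \<in> Q \<Longrightarrow> AE x in \<mu>. X f x = Sphi Q \<phi> f x"
      by (auto simp: liftable_def)
    obtain p where p: "p \<in> H2" "\<And>z. z \<in> polydisc \<Longrightarrow> hext p z = \<phi> z"
      using schur_boundary_function[OF \<phi>(1)] by blast
    have p1: "AE x in \<mu>. cmod (p x) \<le> 1"
      using \<phi>(1) p(2) by (intro boundary_bounded[OF p(1)]) (auto simp: schur_def)
    have "is_proj Q (\<lambda>x. p x * f x) (X f)" if f: "f \<in> Q" for f
    proof -
      have pf: "(\<lambda>x. p x * f x) \<in> L2"
        by (rule mult_L2_bounded_H2[OF p(1) p1]) (use f QL in blast)
      have XL: "X f \<in> L2"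
        using X[OF f] QL by blast
      have "AE x in \<mu>. Sphi Q \<phi> f x = X f x"
        using \<phi>(2)[OF f] by eventually_elim simp
      moreover have "is_proj Q (\<lambda>x. p x * f x) (Sphi Q \<phi> f)"
        using p(2) by (intro is_proj_Sphi[OF Q p(1) p1 _ f]) auto
      ultimately show ?thesis
        by (intro is_proj_cong_AE[OF _ QD(1) pf pf XL]) auto
    qed
    with p p1 show "\<exists>p\<in>H2. (AE x in \<mu>. cmod (p x) \<le> 1) \<and> (\<forall>f\<in>Q. is_proj Q (\<lambda>x. p x * f x) (X f))"
      by blast
  next
    assume "\<exists>p\<in>H2. (AE x in \<mu>. cmod (p x) \<le> 1) \<and> (\<forall>f\<in>Q. is_proj Q (\<lambda>x. p x * f x) (X f))"
    then obtain p where p: "p \<in> H2" "AE x in \<mu>. cmod (p x) \<le> 1" and pX: "\<And>f. f \<in> Q \<Longrightarrow> is_proj Q (\<lambda>x. p x * f x) (X f)"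
      by blast
    have "AE x in \<mu>. X f x = Sphi Q (hext p) f x" if f: "f \<in> Q" for f
    proof (rule is_proj_unique[OF QD(1) _ pX[OF f] is_proj_Sphi[where \<phi> = "hext p", OF Q p _ f]])
      show "(\<lambda>x. p x * f x) \<in> L2"
        by (rule mult_L2_bounded_H2[OF p]) (use f QL in blast)
    qed (rule refl)
    then show "liftable Q X"
      unfolding liftable_def using schur_hext[OF p] by blast
  }
qed

text \<open>The conjugates of \<open>m\<close> and \<open>h\<close> have no frequency in the
  nonnegative cone, so \<open>p\<close> does not see them. Two \<open>H2\<close> functions with the
  same inner products against \<open>Q\<close> thus define the same functional.\<close>

lemma integral_sum3:
  assumes p: "p \<in> H2" and q: "q \<in> L2" and m: "m \<in> Mn" and h: "h \<in> H2_0"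
  shows "(LINT x|\<mu>. p x * (cnj (q x) + m x + h x)) = l2inner p q"
proof -
  have "(\<lambda>x. cnj (m x)) \<in> spectral (uminus ` {k. (\<exists>i. k $ i > 0) \<and> (\<exists>j. k $ j < 0)})"
    using m by (simp add: Mn_eq_spectral spectral_cnj image_image)
  with p have pm: "l2inner p (\<lambda>x. cnj (m x)) = 0"
    unfolding H2_eq_spectral by (rule spectral_orthogonal) (auto simp: not_less[symmetric])
  have "(\<lambda>x. cnj (h x)) \<in> spectral (uminus ` ({k. \<forall>j. k $ j \<ge> 0} - {0}))"
    using h by (simp add: H2_0_eq_spectral spectral_cnj image_image)
  moreover have "{k. \<forall>j. k $ j \<ge> 0} \<inter> uminus ` ({k. \<forall>j. k $ j \<ge> 0} - {0}) = ({} :: (int^'a) set)"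
  proof -
    have "l = 0" if "\<forall>j. 0 \<le> (- l) $ j" "\<forall>j. 0 \<le> l $ j" for l :: "int^'a"
      using that by (auto simp: vec_eq_iff intro: order_antisym)
    then show ?thesis by blast
  qed
  ultimately have ph: "l2inner p (\<lambda>x. cnj (h x)) = 0"
    using p unfolding H2_eq_spectral by (intro spectral_orthogonal)
  have L: "p \<in> L2" "m \<in> L2" "h \<in> L2"
    using p m h by (auto simp: H2_def Mn_def H2_0_def)
  have "(LINT x|\<mu>. p x * (cnj (q x) + m x + h x)) =
      l2inner p (\<lambda>x. q x + (cnj (m x) + cnj (h x)))"
    by (simp add: l2inner_def add.assoc)
  also have "\<dots> = l2inner p q"
    using L q pm ph by (simp add: l2inner_add_right L2_add)
  finally show ?thesis .
qed

lemma sum3_conj_set: "f \<in> sum3 (conj_set Q) B C \<longleftrightarrow> (\<exists>q\<in>Q. \<exists>m\<in>B. \<exists>h\<in>C. f = (\<lambda>x. cnj (q x) + m x + h x))"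
proof
  assume "f \<in> sum3 (conj_set Q) B C"
  then obtain a m h where a: "a \<in> conj_set Q" "m \<in> B" "h \<in> C" "f = (\<lambda>x. a x + m x + h x)"
    unfolding sum3_def by blast
  then obtain q where "q \<in> Q" "a = (\<lambda>x. cnj (q x))"
    unfolding conj_set_def by blast
  with a show "\<exists>q\<in>Q. \<exists>m\<in>B. \<exists>h\<in>C. f = (\<lambda>x. cnj (q x) + m x + h x)"
    by blast
next
  assume "\<exists>q\<in>Q. \<exists>m\<in>B. \<exists>h\<in>C. f = (\<lambda>x. cnj (q x) + m x + h x)"
  then obtain q m h where q: "q \<in> Q" "m \<in> B" "h \<in> C" "f = (\<lambda>x. cnj (q x) + m x + h x)"
    by blast
  have "(\<lambda>x. cnj (q x)) \<in> conj_set Q"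
    unfolding conj_set_def using q(1) by blast
  then show "f \<in> sum3 (conj_set Q) B C"
    unfolding sum3_def mem_Collect_eq using q
    by (intro exI[of _ "\<lambda>x. cnj (q x)"] exI[of _ m] exI[of _ h]) simp
qed

text \<open>Projecting \<open>w\<close> to \<open>Q\<close> leaves a rest orthogonal to all of
  \<open>H2\<close>. Its conjugate has no frequency with all entries nonpositive, and removing the
  \<open>H2_0\<close> part leaves mixed frequencies only.\<close>

lemma cnj_mem_sum3:
  assumes Q: "quotient_module Q" and w: "w \<in> L2"
    and orth: "\<And>u. u \<in> H2 \<Longrightarrow> (\<And>q. q \<in> Q \<Longrightarrow> l2inner u q = 0) \<Longrightarrow> l2inner w u = 0"
  shows "(\<lambda>x. cnj (w x)) \<in> sum3 (conj_set Q) Mn H2_0"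
proof -
  note QD = quotient_moduleD[OF Q]
  have QL: "Q \<subseteq> L2" by (rule l2_closed_subspace_subset[OF QD(1)])
  note HL = l2_closed_subspace_subset[OF l2_closed_subspace_H2]
  define q where "q = PQ Q w"
  have q: "is_proj Q w q" unfolding q_def by (rule is_proj_PQ[OF QD(1) w])
  have qQ: "q \<in> Q" "q \<in> L2" using is_projD(1)[OF q] QL by auto
  define b where "b x = w x - q x" for x
  have b: "b \<in> L2" unfolding b_def by (rule L2_diff[OF w qQ(2)])
  define u where "u = PQ H2 b"
  have u: "is_proj H2 b u" unfolding u_def by (rule is_proj_PQ[OF l2_closed_subspace_H2 b])
  have uH: "u \<in> H2" "u \<in> L2" using is_projD(1)[OF u] HL by auto
  have uQ: "l2inner u q' = 0" if q': "q' \<in> Q" for q'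
  proof -
    have "l2inner u q' = l2inner b q'"
      using is_proj_inner[OF u _ HL b, of q'] QD(2) q' by auto
    also have "\<dots> = 0"
      using is_projD(2)[OF q q'] unfolding b_def .
    finally show ?thesis .
  qed
  \<comment> \<open>\<open>u\<close> lies in \<open>H2\<close> and is orthogonal to
    \<open>Q\<close>, so \<open>w\<close> and \<open>q\<close> are both orthogonal to it; being the
    projection of \<open>b\<close>, it is then orthogonal to itself.\<close>
  have "l2inner b u = 0"
    using orth[OF uH(1) uQ] uQ[OF qQ(1)] l2inner_commute[of q u] w qQ(2) uH(2)
    unfolding b_def by (simp add: l2inner_diff_left)
  then have "l2inner u u = 0"
    using is_proj_inner[OF u uH(1) HL b] by simp
  then have "l2norm u = 0"
    by (simp add: l2inner_self)
  then have u0: "l2inner u h = 0" if "h \<in> L2" for h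
    using l2_cauchy_schwarz[OF uH(2) that] by simp
  have b0: "fcoeff b (of_nat_vec k) = 0" for k
    unfolding fcoeff_def using is_proj_inner[OF u chr_in_H2 HL b] u0[OF chr_L2] by simp
  have cb: "(\<lambda>x. cnj (b x)) \<in> L2" using b by simp
  have cb0: "fcoeff (\<lambda>x. cnj (b x)) k = 0" if "\<And>j. k $ j \<le> 0" for k
  proof -
    have "\<exists>l. - k = of_nat_vec l"
      using that by (intro nonneg_eq_of_nat_vec) simp
    then show ?thesis
      using b0 by (auto simp: fcoeff_cnj)
  qed
  define A where "A = {k :: int^'a. \<forall>j. k $ j \<ge> 0} - {0}"
  define h where "h = PQ (spectral A) (\<lambda>x. cnj (b x))"
  have h: "is_proj (spectral A) (\<lambda>x. cnj (b x)) h"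
    unfolding h_def by (rule is_proj_PQ[OF l2_closed_subspace_spectral cb])
  have hA: "h \<in> spectral A" by (rule is_projD(1)[OF h])
  then have hL: "h \<in> L2" by (rule spectral_L2)
  define m where "m x = cnj (b x) - h x" for x
  have "m \<in> Mn"
    unfolding Mn_eq_spectral spectral_def
  proof (intro CollectI conjI allI impI)
    show "m \<in> L2" unfolding m_def by (rule L2_diff[OF cb hL])
    fix k :: "int^'a" assume k: "k \<notin> {k. (\<exists>i. k $ i > 0) \<and> (\<exists>j. k $ j < 0)}"
    show "fcoeff m k = 0"
    proof (cases "k \<in> A")
      case True
      then have "chr k \<in> spectral A"
        by (auto simp: spectral_def fcoeff_chr)
      from is_projD(2)[OF h this] show ?thesis
        unfolding fcoeff_def m_def .
    next
      case False
      \<comment> \<open>A frequency outside \<open>A\<close> that is not mixed has only nonpositive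
        entries, the zero frequency included, and there the coefficients of the conjugate of
        \<open>b\<close> vanish.\<close>
      then have "\<And>j. k $ j \<le> 0"
        using k unfolding A_def by (cases "k = 0") (auto simp: not_le not_less)
      then show ?thesis
        using spectral_fcoeff[OF hA False] cb0 cb hL unfolding m_def by (simp add: fcoeff_diff)
    qed
  qed
  moreover have "h \<in> H2_0"
    using hA by (simp add: H2_0_eq_spectral A_def)
  moreover have "(\<lambda>x. cnj (w x)) = (\<lambda>x. cnj (q x) + m x + h x)"
    by (simp add: m_def b_def)
  ultimately show ?thesis
    unfolding sum3_conj_set using qQ(1) by blast
qed

subsection \<open>Module maps\<close>

lemma contraction_onD:
  assumes "contraction_on Q X"
  shows "f \<in> Q \<Longrightarrow> X f \<in> Q"
    "f \<in> Q \<Longrightarrow> g \<in> Q \<Longrightarrow> AE x in \<mu>. f x = g x \<Longrightarrow> AE x in \<mu>. X f x = X g x"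
    "f \<in> Q \<Longrightarrow> g \<in> Q \<Longrightarrow> AE x in \<mu>. X (\<lambda>y. f y + g y) x = X f x + X g x"
    "f \<in> Q \<Longrightarrow> AE x in \<mu>. X (\<lambda>y. c * f y) x = c * X f x"
    "f \<in> Q \<Longrightarrow> l2norm (X f) \<le> l2norm f"
  using assms unfolding contraction_on_def by blast+

text \<open>Both sides agree on projections of monomials, by induction on the exponent since \<open>X\<close> commutes with
  the compressed shifts; the general case follows by density.\<close>

theorem module_map_eq_compression:
  fixes Q :: "('n::finite) tfun set"
  assumes Q: "quotient_module Q" and XC: "contraction_on Q X" and XM: "module_map Q X"
    and p: "p \<in> H2" "AE x in \<mu>. cmod (p x) \<le> 1"
    and one: "is_proj Q p (X (PQ Q (\<lambda>_. 1)))" and f: "f \<in> Q"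
  shows "is_proj Q (\<lambda>x. p x * f x) (X f)"
proof -
  note QD = quotient_moduleD[OF Q] and XD = contraction_onD[OF XC]
  note QS = l2_closed_subspaceD[OF QD(1)]
  have QL: "Q \<subseteq> L2" by (rule l2_closed_subspace_subset[OF QD(1)])
  have PQ: "is_proj Q g (PQ Q g)" if "g \<in> L2" for g
    by (rule is_proj_PQ[OF QD(1) that])
  have PQ_Q: "PQ Q g \<in> Q" if "g \<in> L2" for g
    by (rule is_projD(1)[OF PQ[OF that]])
  have pL: "(\<lambda>x. p x * g x) \<in> L2" if "g \<in> L2" for g
    by (rule mult_L2_bounded_H2[OF p that])
  have X_L2: "X g \<in> L2" if "g \<in> Q" for g
    using XD(1)[OF that] QL by blast
  have zc1: "AE x in \<mu>. cmod (zc i x) \<le> 1" for i :: 'n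
    by (simp add: zc_eq_chr)
  \<comment> \<open>Stated for \<open>g\<close> in \<open>H2\<close> through its projection, since
    the monomials on which the induction runs need not belong to \<open>Q\<close>.\<close>
  define R where "R g \<longleftrightarrow> g \<in> H2 \<and> is_proj Q (\<lambda>x. p x * g x) (X (PQ Q g))" for g
  \<comment> \<open>\<open>X\<close> respects a.e. equality, so a convenient representative
    \<open>h\<close> of the projection may replace the selected \<open>PQ Q g\<close>.\<close>
  have R_cong: "is_proj Q (\<lambda>x. p x * g x) (X (PQ Q g))"
    if g: "g \<in> L2" and h: "h \<in> Q" "is_proj Q g h" and k: "is_proj Q (\<lambda>x. p x * g x) k" "k \<in> L2"
      and hk: "AE x in \<mu>. X h x = k x" for g h k
  proof -
    have "AE x in \<mu>. h x = PQ Q g x"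
      by (rule is_proj_unique[OF QD(1) g h(2) PQ[OF g]])
    then have "AE x in \<mu>. X h x = X (PQ Q g) x"
      by (rule XD(2)[OF h(1) PQ_Q[OF g]])
    with hk have "AE x in \<mu>. k x = X (PQ Q g) x"
      by eventually_elim simp
    then show ?thesis
      by (intro is_proj_cong_AE[OF k(1) QD(1) pL[OF g] pL[OF g] X_L2[OF PQ_Q[OF g]]]) auto
  qed
  have R_add: "R (\<lambda>x. g x + h x)" if g: "R g" and h: "R h" for g h
  proof -
    have H: "g \<in> H2" "h \<in> H2" and L: "g \<in> L2" "h \<in> L2"
      using g h H2_L2 by (auto simp: R_def)
    have gp: "is_proj Q (\<lambda>x. p x * g x) (X (PQ Q g))" and hp: "is_proj Q (\<lambda>x. p x * h x) (X (PQ Q h))"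
      using g h by (auto simp: R_def)
    have "is_proj Q (\<lambda>x. p x * (g x + h x)) (X (PQ Q (\<lambda>x. g x + h x)))"
    proof (rule R_cong[OF L2_add[OF L] QS(3)[OF PQ_Q[OF L(1)] PQ_Q[OF L(2)]]
          is_proj_add[OF QD(1) L PQ[OF L(1)] PQ[OF L(2)]] _ _ XD(3)[OF PQ_Q[OF L(1)] PQ_Q[OF L(2)]]])
      show "is_proj Q (\<lambda>x. p x * (g x + h x)) (\<lambda>x. X (PQ Q g) x + X (PQ Q h) x)"
        unfolding distrib_left by (rule is_proj_add[OF QD(1) pL[OF L(1)] pL[OF L(2)] gp hp])
      show "(\<lambda>x. X (PQ Q g) x + X (PQ Q h) x) \<in> L2"
        by (intro L2_add X_L2 PQ_Q L)
    qed
    then show ?thesis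
      using l2_closed_subspaceD(3)[OF l2_closed_subspace_H2 H] by (simp add: R_def)
  qed
  have R_scale: "R (\<lambda>x. c * g x)" if g: "R g" for c g
  proof -
    have H: "g \<in> H2" and L: "g \<in> L2"
      using g H2_L2 by (auto simp: R_def)
    have gp: "is_proj Q (\<lambda>x. p x * g x) (X (PQ Q g))"
      using g by (simp add: R_def)
    have "is_proj Q (\<lambda>x. p x * (c * g x)) (X (PQ Q (\<lambda>x. c * g x)))"
    proof (rule R_cong[OF L2_scale[OF L] QS(4)[OF PQ_Q[OF L]]
          is_proj_scale[OF QD(1) L PQ[OF L]] _ _ XD(4)[OF PQ_Q[OF L]]])
      show "is_proj Q (\<lambda>x. p x * (c * g x)) (\<lambda>x. c * X (PQ Q g) x)"
        unfolding mult.left_commute[of "p _" c] by (rule is_proj_scale[OF QD(1) pL[OF L] gp])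
      show "(\<lambda>x. c * X (PQ Q g) x) \<in> L2"
        by (intro L2_scale X_L2 PQ_Q L)
    qed
    then show ?thesis
      using l2_closed_subspaceD(4)[OF l2_closed_subspace_H2 H] by (simp add: R_def)
  qed
  have R_chr: "R (chr (of_nat_vec m))" for m
  proof (induction m rule: nat_vec_induct)
    case zero
    have "of_nat_vec 0 = (0 :: int^'n)"
      by (simp add: of_nat_vec_def vec_eq_iff)
    then show ?case
      using one one_in_H2 by (simp add: R_def)
  next
    case (step m i)
    let ?e = "chr (of_nat_vec m) :: 'n tfun" and ?e' = "\<lambda>x. zc i x * chr (of_nat_vec m) x"
    let ?g = "PQ Q ?e"
    have eq: "chr (of_nat_vec (m + axis i 1)) = ?e'"
      by (rule ext) (rule chr_of_nat_vec_step)
    have H: "?e' \<in> H2" by (rule zc_mult_H2[OF chr_in_H2])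
    have g: "is_proj Q ?e ?g" by (rule PQ[OF chr_L2])
    have gQ: "?g \<in> Q" by (rule PQ_Q[OF chr_L2])
    have Sz: "is_proj Q (\<lambda>x. zc i x * h x) (Sz Q i h)" if "h \<in> Q" for h
      unfolding Sz_def using that QL by (intro PQ mult_L2_bounded_H2[OF zc_H2 zc1]) auto
    \<comment> \<open>Projecting before multiplication by \<open>zc i\<close> does not change the
      compression. This is used for the monomial here and for \<open>p\<close> times the monomial
      below; the module property joins the two.\<close>
    have 1: "is_proj Q ?e' (Sz Q i ?g)"
      using Sz[OF gQ] is_proj_mult_iff[OF Q zc_H2 zc1 chr_in_H2 g] by blast
    have pe: "is_proj Q (\<lambda>x. p x * ?e x) (X ?g)"
      using step by (simp add: R_def)
    have peH: "(\<lambda>x. p x * ?e x) \<in> H2"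
      by (rule H2_mult_bounded(1)[OF p zero_le_one chr_in_H2])
    have "is_proj Q (\<lambda>x. zc i x * (p x * ?e x)) (Sz Q i (X ?g))"
      using Sz[OF XD(1)[OF gQ]] is_proj_mult_iff[OF Q zc_H2 zc1 peH pe] by blast
    then have 2: "is_proj Q (\<lambda>x. p x * ?e' x) (Sz Q i (X ?g))"
      by (simp only: mult.left_commute)
    have "Sz Q i (X ?g) \<in> L2"
      using is_projD(1)[OF 2] QL by blast
    moreover have "AE x in \<mu>. X (Sz Q i ?g) x = Sz Q i (X ?g) x"
      using XM gQ unfolding module_map_def by blast
    ultimately have "is_proj Q (\<lambda>x. p x * ?e' x) (X (PQ Q ?e'))"
      by (intro R_cong[OF H2_L2[OF H] is_projD(1)[OF 1] 1 2])
    then show ?case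
      unfolding eq R_def using H by blast
  qed
  have R_zero: "R (\<lambda>_. 0)"
    using R_scale[OF R_chr, of 0] by simp
  have fH: "f \<in> H2" and fL: "f \<in> L2"
    using QD(2) QL f by auto
  have R_term: "R (\<lambda>x. fcoeff f k * chr k x)" for k
  proof (cases "\<exists>j. k $ j < 0")
    case True
    then have "fcoeff f k = 0"
      using H2_fcoeff[OF fH] by blast
    then show ?thesis using R_zero by simp
  next
    case False
    then obtain m where m: "k = of_nat_vec m"
      using nonneg_eq_of_nat_vec[of k] by (auto simp: not_less)
    show ?thesis
      unfolding m by (rule R_scale[OF R_chr])
  qed
  have R_sum: "R (trig_sum (fcoeff f) F)" if "finite F" for F
    using that
  proof induction
    case empty
    then show ?case using R_zero by (simp add: trig_sum_def [abs_def])
  next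
    case (insert k F)
    then show ?case
      using R_add[OF R_term[of k] insert.IH] by (simp add: trig_sum_def [abs_def])
  qed
  let ?S = "\<lambda>N. trig_sum (fcoeff f) (exhaust N)"
  have S: "is_proj Q (\<lambda>x. p x * ?S N x) (X (PQ Q (?S N)))" for N
    using R_sum[OF finite_exhaust] by (simp add: R_def)
  have SQ: "PQ Q (?S N) \<in> Q" for N
    by (rule PQ_Q[OF trig_sum_L2])
  have lim: "(\<lambda>N. l2norm (\<lambda>x. ?S N x - f x)) \<longlonglongrightarrow> 0"
    by (rule trig_sum_tendsto[OF fL])
  have le1: "l2norm (\<lambda>x. p x * ?S N x - p x * f x) \<le> l2norm (\<lambda>x. ?S N x - f x)" for N
    using l2norm_mult_le[OF L2_diff[OF trig_sum_L2 fL] L2_measurable[OF H2_L2[OF p(1)]] p(2)]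
    by (simp add: right_diff_distrib)
  \<comment> \<open>\<open>X\<close> is contractive and \<open>f\<close> is its own projection, so
    the error is at most that of the Fourier sum.\<close>
  have le2: "l2norm (\<lambda>x. X (PQ Q (?S N)) x - X f x) \<le> l2norm (\<lambda>x. ?S N x - f x)" for N
  proof -
    let ?g = "PQ Q (?S N)"
    have mf: "(\<lambda>y. -1 * f y) \<in> Q" by (rule QS(4)[OF f])
    have "AE x in \<mu>. X ?g x - X f x = X (\<lambda>y. ?g y + -1 * f y) x"
      using XD(3)[OF SQ mf, of N] XD(4)[OF f, of "-1"] by eventually_elim simp
    then have "l2norm (\<lambda>x. X ?g x - X f x) = l2norm (X (\<lambda>y. ?g y + -1 * f y))"
      by (intro l2norm_cong_AE L2_diff X_L2 SQ f QS(3)[OF SQ mf])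
    also have "\<dots> \<le> l2norm (\<lambda>y. ?g y + -1 * f y)"
      by (rule XD(5)[OF QS(3)[OF SQ mf]])
    also have "\<dots> \<le> l2norm (\<lambda>x. ?S N x - f x)"
    proof -
      have "is_proj Q f f"
        by (rule is_projI[OF f QL fL refl])
      from is_proj_norm_le[OF QD(1) L2_diff[OF trig_sum_L2 fL] is_proj_diff[OF QD(1) trig_sum_L2 fL PQ[OF trig_sum_L2] this]]
      show ?thesis by simp
    qed
    finally show ?thesis .
  qed
  show ?thesis
  proof (rule is_projI[OF XD(1)[OF f] QL pL[OF fL]])
    fix q assume q: "q \<in> Q"
    then have qL: "q \<in> L2" using QL by blast
    have 1: "(\<lambda>N. l2norm (\<lambda>x. p x * ?S N x - p x * f x)) \<longlonglongrightarrow> 0"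
      by (rule tendsto_sandwich[OF _ _ tendsto_const lim]) (use le1 in auto)
    have 2: "(\<lambda>N. l2norm (\<lambda>x. X (PQ Q (?S N)) x - X f x)) \<longlonglongrightarrow> 0"
      by (rule tendsto_sandwich[OF _ _ tendsto_const lim]) (use le2 in auto)
    have "(\<lambda>N. l2inner (\<lambda>x. p x * ?S N x) q) \<longlonglongrightarrow> l2inner (\<lambda>x. p x * f x) q"
      by (rule tendsto_l2inner_left[OF 1 pL[OF trig_sum_L2] pL[OF fL] qL])
    moreover have "(\<lambda>N. l2inner (X (PQ Q (?S N))) q) \<longlonglongrightarrow> l2inner (X f) q"
      by (rule tendsto_l2inner_left[OF 2 X_L2[OF SQ] X_L2[OF f] qL])
    moreover have "l2inner (\<lambda>x. p x * ?S N x) q = l2inner (X (PQ Q (?S N))) q" for N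
      by (rule is_proj_inner[OF S q QL pL[OF trig_sum_L2]])
    ultimately show "l2inner (\<lambda>x. p x * f x) q = l2inner (X f) q"
      using LIMSEQ_unique by simp
  qed
qed

theorem liftable_iff_contractive:
  fixes Q :: "('n::finite) tfun set"
  assumes Q: "quotient_module Q" and XC: "contraction_on Q X" and XM: "module_map Q X"
    and \<psi>: "\<psi> = X (PQ Q (\<lambda>_. 1))"
  shows "liftable Q X \<longleftrightarrow> (\<forall>f \<in> sum3 (conj_set Q) Mn H2_0. cmod (LINT x|\<mu>. \<psi> x * f x) \<le> l1norm f)"
proof -
  note QD = quotient_moduleD[OF Q] and XD = contraction_onD[OF XC]
  have QL: "Q \<subseteq> L2" by (rule l2_closed_subspace_subset[OF QD(1)])
  have P1: "is_proj Q (\<lambda>_. 1) (PQ Q (\<lambda>_. 1))"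
    by (rule is_proj_PQ[OF QD(1) one_L2])
  have \<psi>Q: "\<psi> \<in> Q"
    unfolding \<psi> by (rule XD(1)[OF is_projD(1)[OF P1]])
  then have \<psi>H: "\<psi> \<in> H2" and \<psi>L: "\<psi> \<in> L2"
    using QD(2) QL by auto
  have lift: "liftable Q X \<longleftrightarrow> (\<exists>p\<in>H2. (AE x in \<mu>. cmod (p x) \<le> 1) \<and> (\<forall>f\<in>Q. is_proj Q (\<lambda>x. p x * f x) (X f)))"
    by (rule liftable_iff_boundary[OF Q XD(1)])
  show ?thesis
  proof
    assume "liftable Q X"
    then obtain p where p: "p \<in> H2" "AE x in \<mu>. cmod (p x) \<le> 1" and pX: "\<And>f. f \<in> Q \<Longrightarrow> is_proj Q (\<lambda>x. p x * f x) (X f)"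
      using lift by blast
    have pL: "p \<in> L2" by (rule H2_L2[OF p(1)])
    \<comment> \<open>\<open>P\<^sub>Q p = P\<^sub>Q (p P\<^sub>Q 1) = X (P\<^sub>Q 1)\<close>: the
      difference between 1 and its projection stays in the complement of \<open>Q\<close> after
      multiplication by \<open>p\<close>.\<close>
    have "is_proj Q (\<lambda>x. p x * 1) \<psi>"
      using pX[OF is_projD(1)[OF P1]] is_proj_mult_iff[OF Q p one_in_H2 P1] unfolding \<psi> by blast
    then have "is_proj Q p \<psi>" by simp
    then have eq: "l2inner p q = l2inner \<psi> q" if "q \<in> Q" for q
      using that by (rule is_proj_inner[OF _ _ QL pL])
    show "\<forall>f \<in> sum3 (conj_set Q) Mn H2_0. cmod (LINT x|\<mu>. \<psi> x * f x) \<le> l1norm f"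
    proof
      fix f assume "f \<in> sum3 (conj_set Q) Mn H2_0"
      then obtain q m h where f: "q \<in> Q" "m \<in> Mn" "h \<in> H2_0" "f = (\<lambda>x. cnj (q x) + m x + h x)"
        unfolding sum3_conj_set by blast
      have qL: "q \<in> L2" using f(1) QL by blast
      have fL: "f \<in> L2"
        unfolding f(4) using qL f(2,3) by (intro L2_add) (auto simp: Mn_def H2_0_def H2_def)
      have "(LINT x|\<mu>. \<psi> x * f x) = (LINT x|\<mu>. p x * f x)"
        unfolding f(4) integral_sum3[OF \<psi>H qL f(2,3)] integral_sum3[OF p(1) qL f(2,3)] using eq[OF f(1)] by simp
      also have "\<dots> = l2inner p (\<lambda>x. cnj (f x))"
        by (simp add: l2inner_def)
      finally show "cmod (LINT x|\<mu>. \<psi> x * f x) \<le> l1norm f"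
        using inner_le_l1norm[OF pL p(2), of "\<lambda>x. cnj (f x)"] fL by (simp add: l1norm_def)
    qed
  next
    assume le: "\<forall>f \<in> sum3 (conj_set Q) Mn H2_0. cmod (LINT x|\<mu>. \<psi> x * f x) \<le> l1norm f"
    \<comment> \<open>\<open>N\<close> is the complement of \<open>Q\<close> in \<open>H2\<close>
      and \<open>M\<close> its annihilator. \<open>M\<close> is closed and its conjugates lie in the
      space of the functional, so duality applies. It contains \<open>Q\<close> and every character
      with a negative exponent, which yields the projection \<open>\<psi>\<close> and membership in
      \<open>H2\<close>.\<close>
    define N where "N = {u \<in> H2. \<forall>q\<in>Q. l2inner u q = 0}"
    have NL: "N \<subseteq> L2" using H2_L2 by (auto simp: N_def)
    define M where "M = {w \<in> L2. \<forall>u\<in>N. l2inner w u = 0}"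
    have M: "l2_closed_subspace M"
      unfolding M_def by (rule l2_closed_subspace_orth[OF NL])
    have "cmod (l2inner \<psi> w) \<le> l1norm w" if w: "w \<in> M" for w
    proof -
      have "(\<lambda>x. cnj (w x)) \<in> sum3 (conj_set Q) Mn H2_0"
        using w by (intro cnj_mem_sum3[OF Q]) (auto simp: M_def N_def)
      from bspec[OF le this] have "cmod (LINT x|\<mu>. \<psi> x * cnj (w x)) \<le> l1norm (\<lambda>x. cnj (w x))" .
      then show ?thesis
        by (simp add: l2inner_def l1norm_def)
    qed
    then obtain p where p: "p \<in> L2" "AE x in \<mu>. cmod (p x) \<le> 1" "\<And>w. w \<in> M \<Longrightarrow> l2inner p w = l2inner \<psi> w"
      using L1_duality[OF M \<psi>L] by blast
    have "fcoeff p k = 0" if k: "k $ j < 0" for k j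
    proof -
      have "l2inner (chr k) u = 0" if "u \<in> N" for u
      proof -
        have "fcoeff u k = 0"
          using that k by (intro H2_fcoeff[of u k j]) (simp_all add: N_def)
        then show ?thesis
          using l2inner_commute[of "chr k" u] by (simp add: fcoeff_def)
      qed
      then have "chr k \<in> M" by (simp add: M_def)
      then show ?thesis
        using p(3) H2_fcoeff[of \<psi> k j, OF \<psi>H k] by (simp add: fcoeff_def)
    qed
    then have pH: "p \<in> H2"
      using p(1) by (auto simp: H2_def)
    have "q \<in> M" if q: "q \<in> Q" for q
    proof -
      have "l2inner q u = 0" if "u \<in> N" for u
        using that q l2inner_commute[of q u] by (simp add: N_def)
      then show ?thesis using q QL by (auto simp: M_def)
    qed
    then have "is_proj Q p \<psi>"
      using p(1,3) by (intro is_projI[OF \<psi>Q QL]) auto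
    then have "is_proj Q (\<lambda>x. p x * f x) (X f)" if "f \<in> Q" for f
      using that unfolding \<psi> by (rule module_map_eq_compression[OF Q XC XM pH p(2)])
    then show "liftable Q X"
      using lift pH p(2) by blast
  qed
qed

text \<open>On the sum the functional is \<open>l2inner \<psi> q\<close>. Its level set at 1 is the
  conjugate of \<open>\<psi>\<close> divided by \<open>(l2norm \<psi>)\<^sup>2\<close>, minus the
  space in the distance. The distance is thus the infimum of the L^1 norm on that level set, and
  homogeneity does the rest.\<close>

lemma contractive_iff_dist:
  fixes Q :: "('n::finite) tfun set" and \<psi> :: "'n tfun"
  assumes Q: "quotient_module Q" and \<psi>: "\<psi> \<in> Q" and nz: "\<not> (AE x in \<mu>. \<psi> x = 0)"
  shows "(\<forall>f \<in> sum3 (conj_set Q) Mn H2_0. cmod (LINT x|\<mu>. \<psi> x * f x) \<le> l1norm f) \<longleftrightarrow>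
    (INF h \<in> sum3 {g \<in> conj_set Q. l2inner g (\<lambda>x. cnj (\<psi> x)) = 0} Mn H2_0.
      l1norm (\<lambda>x. cnj (\<psi> x) / complex_of_real ((l2norm \<psi>)\<^sup>2) - h x)) \<ge> 1"
    (is "?L \<longleftrightarrow> (INF h \<in> ?T. ?d h) \<ge> 1")
proof -
  note QD = quotient_moduleD[OF Q]
  note QS = l2_closed_subspaceD[OF QD(1)]
  have QL: "Q \<subseteq> L2" by (rule l2_closed_subspace_subset[OF QD(1)])
  have \<psi>H: "\<psi> \<in> H2" and \<psi>L: "\<psi> \<in> L2"
    using \<psi> QD(2) QL by auto
  define c where "c = complex_of_real ((l2norm \<psi>)\<^sup>2)"
  have c: "c \<noteq> 0" "cnj c = c" "l2inner \<psi> \<psi> = c"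
    using nz \<psi>L by (auto simp: c_def l2norm_eq_0_iff l2inner_self)
  let ?Q' = "{q \<in> Q. l2inner \<psi> q = 0}"
  have "l2inner (\<lambda>x. cnj (q x)) (\<lambda>x. cnj (\<psi> x)) = l2inner \<psi> q" for q
    by (simp add: l2inner_def mult.commute)
  then have "{g \<in> conj_set Q. l2inner g (\<lambda>x. cnj (\<psi> x)) = 0} = conj_set ?Q'"
    unfolding conj_set_def by auto
  then have T: "h \<in> ?T \<longleftrightarrow> (\<exists>q\<in>?Q'. \<exists>m\<in>Mn. \<exists>k\<in>H2_0. h = (\<lambda>x. cnj (q x) + m x + k x))" for h
    by (simp only: sum3_conj_set)
  have zero: "(\<lambda>_. 0) \<in> Mn" "(\<lambda>_. 0) \<in> H2_0"
    unfolding Mn_eq_spectral H2_0_eq_spectral by (rule l2_closed_subspaceD(2)[OF l2_closed_subspace_spectral])+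
  have scale: "(\<lambda>x. a * m x) \<in> Mn" "(\<lambda>x. a * h x) \<in> H2_0" if "m \<in> Mn" "h \<in> H2_0" for a m h
    using that unfolding Mn_eq_spectral H2_0_eq_spectral
    by (auto intro: l2_closed_subspaceD(4)[OF l2_closed_subspace_spectral])
  \<comment> \<open>The real infimum is governed by lower bounds when the set is nonempty and
    bounded below; both are checked here.\<close>
  have "(\<lambda>_. 0) \<in> ?T"
    unfolding T using QS(2) zero by (intro bexI[of _ "\<lambda>_. 0"]) (auto simp: l2inner_def)
  then have "?T \<noteq> {}" by blast
  moreover have "bdd_below (?d ` ?T)"
    by (rule bdd_belowI[of _ 0]) (auto simp: l1norm_def)
  ultimately have INF: "(INF h \<in> ?T. ?d h) \<ge> 1 \<longleftrightarrow> (\<forall>h\<in>?T. 1 \<le> ?d h)"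
    by (rule le_cINF_iff)
  show ?thesis
    unfolding INF
  proof
    assume L: ?L
    show "\<forall>h\<in>?T. 1 \<le> ?d h"
    proof
      fix h assume "h \<in> ?T"
      then obtain q m k where h: "q \<in> Q" "l2inner \<psi> q = 0" "m \<in> Mn" "k \<in> H2_0" "h = (\<lambda>x. cnj (q x) + m x + k x)"
        unfolding T by blast
      \<comment> \<open>The conjugate of \<open>q'\<close> is the \<open>Q\<close> part of the
        difference whose norm is estimated; \<open>l2inner \<psi> q' = 1\<close> is the value of the
        functional there.\<close>
      define q' where "q' x = (1 / c) * \<psi> x - q x" for x
      have q': "q' \<in> Q"
        unfolding q'_def by (rule l2_closed_subspace_diff[OF QD(1) QS(4)[OF \<psi>] h(1)])
      have eq: "(\<lambda>x. cnj (\<psi> x) / c - h x) = (\<lambda>x. cnj (q' x) + (-1) * m x + (-1) * k x)"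
        unfolding q'_def h(5) using c(2) by (auto simp: fun_eq_iff)
      have mk: "(\<lambda>x. (-1) * m x) \<in> Mn" "(\<lambda>x. (-1) * k x) \<in> H2_0"
        using scale[OF h(3,4)] by blast+
      have q'L: "q' \<in> L2" using q' QL by blast
      have "(\<lambda>x. cnj (q' x) + (-1) * m x + (-1) * k x) \<in> sum3 (conj_set Q) Mn H2_0"
        unfolding sum3_conj_set by (rule bexI[OF bexI[OF bexI[OF refl mk(2)] mk(1)] q'])
      from bspec[OF L this]
      have "cmod (LINT x|\<mu>. \<psi> x * (cnj (q' x) + (-1) * m x + (-1) * k x)) \<le> ?d h"
        unfolding c_def[symmetric] eq .
      moreover have "l2inner \<psi> q' = 1"
      proof -
        have "q \<in> L2" using h(1) QL by blast
        then have "l2inner \<psi> q' = l2inner \<psi> (\<lambda>x. (1 / c) * \<psi> x) - l2inner \<psi> q"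
          unfolding q'_def by (intro l2inner_diff_right L2_scale \<psi>L)
        then show ?thesis
          unfolding l2inner_scale_right using c h(2) by simp
      qed
      ultimately show "1 \<le> ?d h"
        unfolding integral_sum3[OF \<psi>H q'L mk] by simp
    qed
  next
    assume R: "\<forall>h\<in>?T. 1 \<le> ?d h"
    show ?L
    proof
      fix f assume "f \<in> sum3 (conj_set Q) Mn H2_0"
      then obtain q m k where f: "q \<in> Q" "m \<in> Mn" "k \<in> H2_0" "f = (\<lambda>x. cnj (q x) + m x + k x)"
        unfolding sum3_conj_set by blast
      have qL: "q \<in> L2" using f(1) QL by blast
      define a where "a = l2inner \<psi> q"
      have int: "(LINT x|\<mu>. \<psi> x * f x) = a"
        unfolding f(4) a_def by (rule integral_sum3[OF \<psi>H qL f(2,3)])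
      show "cmod (LINT x|\<mu>. \<psi> x * f x) \<le> l1norm f"
      proof (cases "a = 0")
        case True
        then show ?thesis unfolding int by (simp add: l1norm_def)
      next
        case False
        \<comment> \<open>Chosen so that subtracting \<open>h\<close> from the normalised conjugate
          of \<open>\<psi>\<close> leaves \<open>f / a\<close>. The factor \<open>1 / cnj a\<close>
          becomes \<open>1 / a\<close> under conjugation, and
          \<open>l2inner \<psi> q' = 1 - 1 = 0\<close>.\<close>
        define q' where "q' x = (1 / c) * \<psi> x - (1 / cnj a) * q x" for x
        define h where "h x = cnj (q' x) + (-1/a) * m x + (-1/a) * k x" for x
        have q': "q' \<in> Q"
          unfolding q'_def by (rule l2_closed_subspace_diff[OF QD(1) QS(4)[OF \<psi>] QS(4)[OF f(1)]])
        have "l2inner \<psi> q' = l2inner \<psi> (\<lambda>x. (1 / c) * \<psi> x) - l2inner \<psi> (\<lambda>x. (1 / cnj a) * q x)"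
          unfolding q'_def by (intro l2inner_diff_right L2_scale \<psi>L qL)
        then have "l2inner \<psi> q' = 0"
          unfolding l2inner_scale_right a_def[symmetric] using c False by simp
        with q' have q'': "q' \<in> ?Q'" by simp
        have mk: "(\<lambda>x. (-1/a) * m x) \<in> Mn" "(\<lambda>x. (-1/a) * k x) \<in> H2_0"
          using scale[OF f(2,3)] by blast+
        have "h \<in> ?T"
          unfolding T h_def [abs_def] by (rule bexI[OF bexI[OF bexI[OF refl mk(2)] mk(1)] q''])
        with R have "1 \<le> ?d h" by blast
        also have "(\<lambda>x. cnj (\<psi> x) / complex_of_real ((l2norm \<psi>)\<^sup>2) - h x) = (\<lambda>x. f x / a)"
          unfolding c_def[symmetric] h_def q'_def f(4) using c(2) False by (auto simp: fun_eq_iff field_simps)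
        also have "l1norm (\<lambda>x. f x / a) = l1norm f / cmod a"
          by (simp add: l1norm_def norm_divide)
        finally show ?thesis
          unfolding int using False by (simp add: field_simps)
      qed
    qed
  qed
qed

text \<open>\<open>psi_nz\<close> is implicit in the distance condition, which divides by
  \<open>(l2norm \<psi>)\<^sup>2\<close>. For \<open>\<psi> = 0\<close> the quotient would be the
  zero function, at distance 0, whereas \<open>X\<close> would then be zero and lifted by the symbol
  0.\<close>

theorem theorem4p4:
  fixes Q :: "('n::finite) tfun set" and X :: "'n tfun \<Rightarrow> 'n tfun" and \<psi> :: "'n tfun"
  assumes QM: "quotient_module Q"
    and XC: "contraction_on Q X"
    and XM: "module_map Q X"
    and psi_def: "\<psi> = X (PQ Q (\<lambda>_. 1))"
    and psi_nz: "\<not> (AE x in torus_measure. \<psi> x = 0)"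
  shows "(liftable Q X
          \<longleftrightarrow> (\<forall>f \<in> sum3 (conj_set Q) Mn H2_0.
                 cmod (LINT x|torus_measure. \<psi> x * f x) \<le> l1norm f))
       \<and> (liftable Q X
          \<longleftrightarrow> (INF h \<in> sum3 {g \<in> conj_set Q. l2inner g (\<lambda>x. cnj (\<psi> x)) = 0} Mn H2_0.
                 l1norm (\<lambda>x. cnj (\<psi> x) / complex_of_real ((l2norm \<psi>)\<^sup>2) - h x)) \<ge> 1)"
proof -
  have "is_proj Q (\<lambda>_. 1) (PQ Q (\<lambda>_. 1))"
    by (rule is_proj_PQ[OF quotient_moduleD(1)[OF QM] one_L2])
  then have "\<psi> \<in> Q"
    unfolding psi_def by (rule contraction_onD(1)[OF XC is_projD(1)])
  from contractive_iff_dist[OF QM this psi_nz] liftable_iff_contractive[OF QM XC XM psi_def]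
  show ?thesis by blast
qed

end
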